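(* Let $n\ge 2$ be a fixed integer. Uniformly over $\delta\in\mathbb{Q}$, as $H\to\infty$: \begin{itemize} \item if $\delta\ne 0$, then \[\#\mathcal{D}_n(\mathbb{Z}^{-1};H,\delta)\le\begin{cases} H^{o(1)}, & \text{if } n=2,\\ H^{7+o(1)}, & \text{if } n=3,\\ H^{n^2-n/2-1/(2n-2)+o(1)}, & \text{if } n\ge 4;\end{cases}\] \item if $\delta=0$, then \[\#\mathcal{D}_n(\mathbb{Z}^{-1};H,0)\le\begin{cases} H^{2+o(1)}, & \text{if } n=2,\\ H^{7+o(1)}, & \text{if } n=3,\\ H^{n^2-n/2+o(1)}, & \text{if } n\ge 4.\end{cases}\] \end{itemize}
   Context: For a real $H\ge 1$, let $\mathcal{E}(H)=\{1/a:\ a\in\mathbb{Z},\ 1\le |a|\le H\}$. Let $\mathcal{M}_{n,n}(\mathbb{Z}^{-1};H)$ be the set of $n\times n$ matrices with all entries in $\mathcal{E}(H)$, and for $\delta\in\mathbb{Q}$ let $\mathcal{D}_n(\mathbb{Z}^{-1};H,\delta)=\{A\in\mathcal{M}_{n,n}(\mathbb{Z}^{-1};H):\ \det A=\delta\}$. A bound $X\le H^{c+o(1)}$ uniformly over $\delta$ means: for every $\varepsilon>0$ there is $H_0$ depending only on $\varepsilon,n$ with $X\le H^{c+\varepsilon}$ for all $H\ge H_0$ and all $\delta$ in the stated range. *)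

theory Defs
  imports Complex_Main "Jordan_Normal_Form.Determinant"
begin

definition egyptian :: "real \<Rightarrow> rat set" where
  "egyptian H = {1 / of_int a | a :: int. 1 \<le> \<bar>a\<bar> \<and> of_int \<bar>a\<bar> \<le> H}"

definition egyptian_mats :: "nat \<Rightarrow> real \<Rightarrow> rat mat set" where
  "egyptian_mats n H =
     {A \<in> carrier_mat n n. \<forall>i<n. \<forall>j<n. A $$ (i, j) \<in> egyptian H}"

definition egyptian_det_mats :: "nat \<Rightarrow> real \<Rightarrow> rat \<Rightarrow> rat mat set" where
  "egyptian_det_mats n H \<delta> = {A \<in> egyptian_mats n H. det A = \<delta>}"

text \<open>The uniform bound \<open>X H \<delta> \<le> H\<^sup>c\<^sup>+\<^sup>o\<^sup>(\<^sup>1\<^sup>)\<close> for \<open>\<delta> \<in> \<Delta>\<close>: the threshold \<open>H\<^sub>0\<close> is chosen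
  before \<open>\<delta>\<close>.\<close>

definition power_bound_uniform ::
    "(real \<Rightarrow> rat \<Rightarrow> nat) \<Rightarrow> rat set \<Rightarrow> real \<Rightarrow> bool" where
  "power_bound_uniform X \<Delta> c \<longleftrightarrow>
     (\<forall>\<epsilon>>0. \<exists>H\<^sub>0\<ge>1. \<forall>H\<ge>H\<^sub>0. \<forall>\<delta>\<in>\<Delta>. real (X H \<delta>) \<le> H powr (c + \<epsilon>))"

text \<open>All these sets are finite, so \<open>card\<close> is a genuine count.\<close>

lemma finite_egyptian: "finite (egyptian H)"
proof -
  have "egyptian H \<subseteq> (\<lambda>a::int. 1 / of_int a) ` {- \<lfloor>H\<rfloor>..\<lfloor>H\<rfloor>}"
    unfolding egyptian_def by (auto simp: le_floor_iff abs_le_iff intro!: imageI) linarith+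
  then show ?thesis
    by (rule finite_subset) simp
qed

lemma finite_egyptian_mats: "finite (egyptian_mats n H)"
proof -
  let ?I = "{..<n} \<times> {..<n}"
  have "egyptian_mats n H \<subseteq> mat n n ` (PiE ?I (\<lambda>_. egyptian H))"
  proof
    fix A assume A: "A \<in> egyptian_mats n H"
    then have "A = mat n n (restrict (($$) A) ?I)"
      by (intro eq_matI) (auto simp: egyptian_mats_def)
    moreover have "restrict (($$) A) ?I \<in> PiE ?I (\<lambda>_. egyptian H)"
      using A by (auto simp: egyptian_mats_def)
    ultimately show "A \<in> mat n n ` (PiE ?I (\<lambda>_. egyptian H))" by blast
  qed
  moreover have "finite (PiE ?I (\<lambda>_. egyptian H))"
    by (intro finite_PiE) (simp_all add: finite_egyptian)
  ultimately show ?thesis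
    by (meson finite_imageI finite_subset)
qed

lemma finite_egyptian_det_mats: "finite (egyptian_det_mats n H \<delta>)"
  unfolding egyptian_det_mats_def using finite_egyptian_mats by simp

end

(*
  Expanding the determinant along one row turns the problem into counting solutions of
  A_1/x_1 + ... + A_n/x_n = b with 1 <= |x_i| <= H, uniformly in the (polynomially bounded)
  coefficients. A prime p dividing x_i, but not the coefficients or the denominator of b, must divide
  a second x_j; so x_1...x_n is squareful up to a factor composed of the bad primes. There are
  H^(o(1)) such factors and H^(o(1)) factorisations, hence at most H^(n/2+o(1)) solutions.

  If b /= 0 and n >= 4, let T be the product of the good primes whose exponent in x_1...x_n is
  exactly 2. Either T <= H^(n/4), and then x_1...x_n = T^2 Q with Q cubeful leaves only
  H^(5n/12+o(1)) solutions; or some pair x_i, x_j shares a part d >= H^(1/(2n-2)) of T. In the second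
  case d is determined by the remaining data, which saves a factor d, unless
  A_i/x_i + A_j/x_j = 0, when one inducts on the other n - 2 variables.

  A singular matrix contains t rows which are minimally dependent; the coefficients of their relation
  are minors supported on t - 1 columns, and each of the other columns solves the equation in t
  variables with b = 0. If det A = delta /= 0, either all cofactors of the last row are nonzero and
  the equation for this row applies, or one of them vanishes and the bound for singular
  (n-1) x (n-1) matrices does.
*)
theory Submission
  imports Defs
begin

section \<open>Smooth and powerful numbers\<close>

text \<open>The condition \<open>b \<noteq> 0\<close> is what makes a saving over H^(n/2) possible:
  for b = 0, n even and all coefficients 1, the cancelling pairs x_i = -x_j alone give about H^(n/2)
  solutions. A cancelling pair is therefore the one configuration that the extraction of a common
  part cannot treat. It is pushed down, two variables at a time, to equations in two or three
  variables. For two variables and b nonzero, completing the product leaves a divisor count. Three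
  variables reduce to two by fixing one of them; this costs H, which beats H^(3/2) and is the reason
  why n = 3 stands apart in the theorem. The coefficients that occur are minors of the matrix. They
  are rationals whose common denominator is a product of matrix entries, so they are controlled only
  by a power of H. Hence all constants must depend on an exponent \<open>L\<close> and never on the
  coefficients or the right-hand side. A modulus N of size H^(O(1)) is harmless because it enters
  the counts only as N^e with e arbitrarily small.\<close>

definition smooth :: "nat set \<Rightarrow> real \<Rightarrow> nat set" where
  "smooth Q X = {m. 0 < m \<and> real m \<le> X \<and> prime_factors m \<subseteq> Q}"

text \<open>The numbers that are \<open>k\<close>-full away from \<open>N\<close>: the primes of
  \<open>N\<close> are the bad ones, at which any exponent is tolerated.\<close>

definition full_off :: "nat \<Rightarrow> nat \<Rightarrow> real \<Rightarrow> nat set" where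
  "full_off k N X =
     {m. 0 < m \<and> real m \<le> X \<and> (\<forall>p. prime p \<longrightarrow> p dvd m \<longrightarrow> \<not> p dvd N \<longrightarrow> p ^ k dvd m)}"

lemma finite_bounded_nat: "finite {m::nat. real m \<le> X}"
proof (rule finite_subset)
  show "{m::nat. real m \<le> X} \<subseteq> {..nat \<lfloor>X\<rfloor>}"
    by (auto simp: le_nat_floor)
qed simp

lemma card_bounded_nat: "0 \<le> X \<Longrightarrow> real (card {m::nat. 0 < m \<and> real m \<le> X}) \<le> X"
proof -
  assume X: "0 \<le> X"
  have "{m::nat. 0 < m \<and> real m \<le> X} \<subseteq> {1..nat \<lfloor>X\<rfloor>}"
    by (auto simp: le_nat_floor)
  then have "card {m::nat. 0 < m \<and> real m \<le> X} \<le> nat \<lfloor>X\<rfloor>"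
    using card_mono[of "{1..nat \<lfloor>X\<rfloor>}"] by simp
  with X show ?thesis by linarith
qed

lemma finite_smooth [simp]: "finite (smooth Q X)"
  by (rule finite_subset[OF _ finite_bounded_nat[of X]]) (auto simp: smooth_def)

lemma finite_full_off [simp]: "finite (full_off k N X)"
  by (rule finite_subset[OF _ finite_bounded_nat[of X]]) (auto simp: full_off_def)

text \<open>Rankin's bound, by adding one prime \<open>q\<close> at a time. An element is either
  free of \<open>q\<close> or \<open>q\<close> times an element below \<open>X div q\<close>; after
  division by X^e the new Euler product solves the resulting recursion B = W + q^(-e) B.\<close>

lemma card_smooth_nat_le:
  fixes Q :: "nat set" and e :: real
  assumes "finite Q" "\<And>p. p \<in> Q \<Longrightarrow> prime p" "e > 0"
  shows "real (card (smooth Q (real X))) \<le> real X powr e * (\<Prod>p\<in>Q. 1 / (1 - real p powr - e))"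
  using assms(1,2)
proof (induction Q arbitrary: X rule: finite_induct)
  case empty
  show ?case
  proof (cases "X = 0")
    case True
    then have "smooth {} (real X) = {}" by (auto simp: smooth_def)
    with True show ?thesis by simp
  next
    case False
    have "smooth {} (real X) \<subseteq> {1}"
      by (auto simp: smooth_def prime_factorization_empty_iff)
    then have "card (smooth {} (real X)) \<le> 1"
      using card_mono[of "{1::nat}"] by simp
    moreover have "1 \<le> real X powr e"
      using False assms(3) by (intro ge_one_powr_ge_zero) auto
    ultimately show ?thesis by simp
  qed
next
  case (insert q Q)
  define W where "W = (\<Prod>p\<in>Q. 1 / (1 - real p powr - e))"
  have q: "prime q" using insert.prems by simp
  then have q1: "real q > 1" using prime_gt_1_nat by simp
  have r: "0 < real q powr - e" "real q powr - e < 1"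
    using q1 assms(3) by (auto simp: powr_less_one)
  have W: "W \<ge> 0" unfolding W_def
  proof (intro prod_nonneg ballI)
    fix p assume "p \<in> Q"
    then have "real p > 1" using insert.prems prime_gt_1_nat by simp
    then have "real p powr - e < 1" using assms(3) by (intro powr_less_one) auto
    then show "0 \<le> 1 / (1 - real p powr - e)" by simp
  qed
  \<comment> \<open>Division by \<open>q\<close> shrinks the size bound but not the set of primes,
    so a second induction, on \<open>X\<close>, runs for fixed \<open>q\<close>.\<close>
  have main: "real (card (smooth (insert q Q) (real X))) \<le> real X powr e * (W / (1 - real q powr - e))"
  proof (induction X rule: less_induct)
    case (less X)
    show ?case
    proof (cases "X = 0")
      case True
      then have "smooth (insert q Q) (real X) = {}" by (auto simp: smooth_def)
      with True show ?thesis by simp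
    next
      case False
      have lt: "X div q < X" using False q1 by simp
      have "real (X div q * q) \<le> real X" unfolding of_nat_le_iff by simp
      then have div_le: "real (X div q) \<le> real X / real q"
        using q1 by (simp add: field_simps)
      have sub: "smooth (insert q Q) (real X) \<subseteq>
          smooth Q (real X) \<union> (\<lambda>m. q * m) ` smooth (insert q Q) (real (X div q))"
      proof
        fix m assume m: "m \<in> smooth (insert q Q) (real X)"
        show "m \<in> smooth Q (real X) \<union> (\<lambda>m. q * m) ` smooth (insert q Q) (real (X div q))"
        proof (cases "q dvd m")
          case False
          then have "q \<notin> prime_factors m" by (auto simp: in_prime_factors_iff)
          with m show ?thesis by (auto simp: smooth_def)
        next
          case True
          then obtain l where l: "m = q * l" by auto
          have "0 < l" using m l by (auto simp: smooth_def)
          moreover have "l \<le> X div q"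
            using m l q1 by (auto simp: smooth_def less_eq_div_iff_mult_less_eq mult.commute)
          moreover have "prime_factors l \<subseteq> prime_factors m"
            using l m by (intro dvd_prime_factors) (auto simp: smooth_def)
          ultimately have "l \<in> smooth (insert q Q) (real (X div q))"
            using m by (auto simp: smooth_def)
          with l show ?thesis by auto
        qed
      qed
      have "card (smooth (insert q Q) (real X)) \<le>
          card (smooth Q (real X)) + card (smooth (insert q Q) (real (X div q)))"
        by (intro order.trans[OF card_mono[OF _ sub]] order.trans[OF card_Un_le] add_mono
              card_image_le) auto
      then have "real (card (smooth (insert q Q) (real X))) \<le>
          real (card (smooth Q (real X))) + real (card (smooth (insert q Q) (real (X div q))))"
        by linarith
      also have "\<dots> \<le> real X powr e * W + real (X div q) powr e * (W / (1 - real q powr - e))"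
        using insert.IH[of X] insert.prems less.IH[OF lt] by (intro add_mono) (auto simp: W_def)
      also have "\<dots> \<le> real X powr e * W + (real X / real q) powr e * (W / (1 - real q powr - e))"
        using W r assms(3) by (intro add_left_mono mult_right_mono powr_mono2)
            (auto simp: div_le)
      also have "(real X / real q) powr e = real X powr e * real q powr - e"
        by (simp add: powr_divide powr_minus_divide)
      also have "real X powr e * W + real X powr e * real q powr - e * (W / (1 - real q powr - e))
          = real X powr e * (W / (1 - real q powr - e))"
        using r by (simp add: field_simps)
      finally show ?thesis .
    qed
  qed
  show ?case using main insert.hyps by (simp add: W_def mult.commute)
qed

lemma prod_prime_factors_le: "N > 0 \<Longrightarrow> (\<Prod>p\<in>prime_factors N. p) \<le> (N::nat)"
proof -
  assume N: "N > 0"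
  have "(\<Prod>p\<in>prime_factors N. p) \<le> (\<Prod>p\<in>prime_factors N. p ^ multiplicity p N)"
    using N by (intro prod_mono) (auto simp: prime_factors_multiplicity intro!: self_le_power prime_gt_0_nat Suc_leI)
  also have "\<dots> = N" using N by (simp add: prime_factorization_nat[symmetric])
  finally show ?thesis .
qed

text \<open>With y = p^e the Euler factor is y / (y - 1), which is at most y once y >= 2. The other
  primes lie below a bound depending on \<open>e\<close> alone and cost a constant each, while the
  product of all the p^e is a power of the radical of \<open>N\<close>.\<close>

lemma prod_euler_factors_le:
  fixes e :: real
  assumes "e > 0"
  shows "\<exists>K>0. \<forall>N::nat. N > 0 \<longrightarrow>
    (\<Prod>p\<in>prime_factors N. 1 / (1 - real p powr - e)) \<le> K * real N powr e"
proof -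
  \<comment> \<open>From \<open>P0\<close> on, p^e >= 2; below it the factor is at most its value
    \<open>c\<close> at p = 2.\<close>
  define P0 where "P0 = nat \<lceil>2 powr (1 / e)\<rceil>"
  define c where "c = 1 / (1 - 2 powr - e)"
  have two: "(2::real) powr - e < 1" using assms by (simp add: powr_less_one)
  have c1: "c \<ge> 1" unfolding c_def using two by (simp add: field_simps)
  show ?thesis
  proof (intro exI conjI allI impI)
    show "c ^ P0 > 0" using c1 by simp
    fix N :: nat assume N: "N > 0"
    have fac: "0 \<le> 1 / (1 - real p powr - e) \<and>
       1 / (1 - real p powr - e) \<le> (if p < P0 then c else 1) * real p powr e" 
      if p: "p \<in> prime_factors N" for p
    proof -
      have p2: "real p \<ge> 2" using p prime_ge_2_nat by auto
      have pe: "1 \<le> real p powr e" using p2 assms by (intro ge_one_powr_ge_zero) auto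
      have m: "real p powr - e \<le> 2 powr - e"
        using p2 assms by (intro powr_mono2') auto
      show ?thesis
      proof (cases "p < P0")
        case True
        have "1 / (1 - real p powr - e) \<le> c" unfolding c_def
          using m two by (intro divide_left_mono) auto
        also have "\<dots> \<le> c * real p powr e" using c1 pe by simp
        finally show ?thesis using True m two by simp
      next
        case False
        then have "real p \<ge> 2 powr (1/e)" unfolding P0_def by linarith
        then have "real p powr e \<ge> (2 powr (1/e)) powr e"
          using assms by (intro powr_mono2) auto
        then have g: "real p powr e \<ge> 2" using assms by (simp add: powr_powr)
        have "1 / (1 - real p powr - e) = real p powr e / (real p powr e - 1)"
          using p2 g by (simp add: powr_minus field_simps)
        also have "\<dots> \<le> real p powr e / 1" using g by (intro divide_left_mono) auto
        finally show ?thesis using False m two by simp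
      qed
    qed
    have "(\<Prod>p\<in>prime_factors N. 1 / (1 - real p powr - e)) \<le>
        (\<Prod>p\<in>prime_factors N. (if p < P0 then c else 1) * real p powr e)"
      using fac by (intro prod_mono) auto
    also have "\<dots> = (\<Prod>p\<in>prime_factors N. (if p < P0 then c else 1)) * (\<Prod>p\<in>prime_factors N. real p powr e)"
      by (simp add: prod.distrib)
    also have "(\<Prod>p\<in>prime_factors N. (if p < P0 then c else 1)) = c ^ card {p\<in>prime_factors N. p < P0}"
      by (simp add: prod.If_cases Int_def)
    also have "card {p\<in>prime_factors N. p < P0} \<le> P0"
      using card_mono[of "{..<P0}" "{p\<in>prime_factors N. p < P0}"] by auto
    then have "c ^ card {p\<in>prime_factors N. p < P0} \<le> c ^ P0" using c1 by (intro power_increasing) auto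
    also have "(\<Prod>p\<in>prime_factors N. real p powr e) = real (\<Prod>p\<in>prime_factors N. p) powr e"
      by (simp add: prod_powr_distrib)
    also have "\<dots> \<le> real N powr e"
      using prod_prime_factors_le[OF N] assms by (intro powr_mono2) (auto simp del: of_nat_prod)
    finally show "(\<Prod>p\<in>prime_factors N. 1 / (1 - real p powr - e)) \<le> c ^ P0 * real N powr e"
      using c1 by (simp add: mult_left_mono mult_right_mono prod_nonneg order.trans)
  qed
qed

lemma card_smooth_le:
  fixes e :: real
  assumes "e > 0"
  shows "\<exists>K>0. \<forall>N X. N > 0 \<longrightarrow> X \<ge> 0 \<longrightarrow>
    real (card (smooth (prime_factors N) X)) \<le> K * X powr e * real N powr e"
proof -
  obtain K where K: "K > 0" "\<And>N::nat. N > 0 \<Longrightarrow>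
    (\<Prod>p\<in>prime_factors N. 1 / (1 - real p powr - e)) \<le> K * real N powr e"
    using prod_euler_factors_le[OF assms] by blast
  show ?thesis
  proof (intro exI conjI allI impI)
    fix N :: nat and X :: real assume N: "N > 0" and X: "X \<ge> 0"
    have "smooth (prime_factors N) X = smooth (prime_factors N) (real (nat \<lfloor>X\<rfloor>))"
    proof -
      have "real m \<le> X \<longleftrightarrow> real m \<le> real (nat \<lfloor>X\<rfloor>)" for m
        using X by (metis le_nat_floor of_nat_floor order_trans of_nat_le_iff)
      then show ?thesis by (simp add: smooth_def)
    qed
    then have "real (card (smooth (prime_factors N) X)) \<le>
       real (nat \<lfloor>X\<rfloor>) powr e * (\<Prod>p\<in>prime_factors N. 1 / (1 - real p powr - e))"
      using card_smooth_nat_le[of "prime_factors N" e "nat \<lfloor>X\<rfloor>"] assms by auto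
    also have "\<dots> \<le> real (nat \<lfloor>X\<rfloor>) powr e * (K * real N powr e)"
      using K(2)[OF N] by (intro mult_left_mono) auto
    also have "\<dots> \<le> X powr e * (K * real N powr e)"
      using X assms K(1) by (intro mult_right_mono powr_mono2) auto
    finally show "real (card (smooth (prime_factors N) X)) \<le> K * X powr e * real N powr e"
      by (simp add: mult_ac)
  qed (fact K(1))
qed

text \<open>Divisors of \<open>m\<close> are composed of primes of \<open>m\<close>, so the divisor
  bound is the smooth count with modulus and size bound both equal to \<open>m\<close>.\<close>

lemma card_divisors_le:
  fixes e :: real
  assumes "e > 0"
  shows "\<exists>K>0. \<forall>m::nat. m > 0 \<longrightarrow> real (card {d. d dvd m}) \<le> K * real m powr e"
proof -
  obtain K where K: "K > 0" "\<And>N X. N > 0 \<Longrightarrow> X \<ge> 0 \<Longrightarrow>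
    real (card (smooth (prime_factors N) X)) \<le> K * X powr (e/2) * real N powr (e/2)"
    using card_smooth_le[of "e/2"] assms by auto
  show ?thesis
  proof (intro exI conjI allI impI)
    fix m :: nat assume m: "m > 0"
    have "{d. d dvd m} \<subseteq> smooth (prime_factors m) (real m)"
    proof
      fix d assume "d \<in> {d. d dvd m}"
      then have d: "d dvd m" by simp
      with m have "0 < d" "d \<le> m" by (auto intro: dvd_imp_le Nat.gr0I)
      moreover have "prime_factors d \<subseteq> prime_factors m"
        using d m by (intro dvd_prime_factors) auto
      ultimately show "d \<in> smooth (prime_factors m) (real m)" by (simp add: smooth_def)
    qed
    then have "card {d. d dvd m} \<le> card (smooth (prime_factors m) (real m))"
      by (intro card_mono) auto
    also have "real \<dots> \<le> K * real m powr (e/2) * real m powr (e/2)"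
      using K(2)[OF m, of "real m"] by simp
    also have "\<dots> = K * real m powr e" by (simp add: powr_add[symmetric] mult.assoc)
    finally show "real (card {d. d dvd m}) \<le> K * real m powr e" by simp
  qed (fact K(1))
qed

text \<open>Take \<open>u\<close> maximal with \<open>u ^ k dvd m\<close>. A prime of the cofactor
  dividing neither \<open>u\<close> nor \<open>N\<close> would divide that cofactor to the power
  \<open>k\<close> and could be absorbed into \<open>u\<close>.\<close>

lemma full_off_decomp:
  assumes "m \<in> full_off k N X" "k > 0" "N > 0"
  shows "\<exists>u w. m = u ^ k * w \<and> u > 0 \<and> w \<in> smooth (prime_factors (u * N)) X"
proof -
  have m: "m > 0" "real m \<le> X" using assms by (auto simp: full_off_def)
  define U where "U = {u. u ^ k dvd m}"
  have fin: "finite U"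
  proof (rule finite_subset)
    show "U \<subseteq> {..m}"
    proof
      fix u assume "u \<in> U"
      then have "u ^ k \<le> m" using m by (auto simp: U_def intro: dvd_imp_le)
      moreover have "u \<le> u ^ k" using assms(2) by (cases "u = 0") (auto intro: self_le_power)
      ultimately show "u \<in> {..m}" by simp
    qed
  qed simp
  have ne: "1 \<in> U" by (simp add: U_def)
  define u where "u = Max U"
  have uU: "u \<in> U" unfolding u_def using fin ne by (intro Max_in) auto
  have umax: "v \<le> u" if "v \<in> U" for v unfolding u_def using fin that by simp
  have u: "u > 0" using umax[OF ne] by simp
  obtain w where w: "m = u ^ k * w" using uU by (auto simp: U_def)
  have w0: "w > 0" using m w by (cases w) auto
  have "w \<le> m" using w u by simp
  then have wX: "real w \<le> X" using m by simp
  have "prime_factors w \<subseteq> prime_factors (u * N)"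
  proof
    fix p assume "p \<in> prime_factors w"
    then have p: "prime p" "p dvd w" by auto
    have "p dvd u * N"
    proof (rule ccontr)
      assume "\<not> p dvd u * N"
      then have np: "\<not> p dvd u" "\<not> p dvd N" by auto
      have "p dvd m" using p w by simp
      then have "p ^ k dvd m" using assms(1) p(1) np by (auto simp: full_off_def)
      moreover have "coprime (p ^ k) (u ^ k)"
        using p(1) np(1) by (intro coprime_power_left_iff[THEN iffD2] disjI1 coprime_power_right_iff[THEN iffD2])
           (auto simp: prime_imp_coprime)
      ultimately have "p ^ k dvd w" using w by (simp add: coprime_dvd_mult_right_iff)
      then have "(u * p) ^ k dvd m" using w by (simp add: power_mult_distrib mult_dvd_mono)
      then have "u * p \<le> u" using umax by (simp add: U_def)
      then show False using u prime_gt_1_nat[OF p(1)] by simp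
    qed
    then show "p \<in> prime_factors (u * N)" using p u assms(3) by (auto simp: in_prime_factors_iff)
  qed
  then have "w \<in> smooth (prime_factors (u * N)) X" using w0 wX by (auto simp: smooth_def)
  with w u show ?thesis by blast
qed

text \<open>There are at most X^(1/k) values of \<open>u\<close>; for each of them the cofactor is
  composed of primes of \<open>u * N\<close>, which leaves only a small power of \<open>X\<close>
  and \<open>N\<close>.\<close>

lemma card_full_off_le:
  fixes e :: real
  assumes "e > 0" "k > 0"
  shows "\<exists>K>0. \<forall>N X. N > 0 \<longrightarrow> X \<ge> 0 \<longrightarrow>
    real (card (full_off k N X)) \<le> K * X powr (1 / real k + e) * real N powr e"
proof -
  define e' where "e' = e / 2"
  have e': "e' > 0" using assms by (simp add: e'_def)
  obtain K where K: "K > 0" "\<And>N X. N > 0 \<Longrightarrow> X \<ge> 0 \<Longrightarrow>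
    real (card (smooth (prime_factors N) X)) \<le> K * X powr e' * real N powr e'"
    using card_smooth_le[OF e'] by auto
  show ?thesis
  proof (intro exI conjI allI impI)
    fix N :: nat and X :: real assume N: "N > 0" and X: "X \<ge> 0"
    show "real (card (full_off k N X)) \<le> K * X powr (1 / real k + e) * real N powr e"
    \<comment> \<open>Below 1 the set is empty. Otherwise X^(1/k) <= X, so that \<open>u\<close> may
      be replaced by \<open>X\<close> inside the small power.\<close>
    proof (cases "X < 1")
      case True
      then have "full_off k N X = {}" by (auto simp: full_off_def)
      then show ?thesis using K(1) by simp
    next
      case False
      define U where "U = {u::nat. 0 < u \<and> real u \<le> X powr (1 / real k)}"
      have finU: "finite U"
        by (rule finite_subset[OF _ finite_bounded_nat[of "X powr (1 / real k)"]]) (auto simp: U_def)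
      have cU: "real (card U) \<le> X powr (1 / real k)"
        unfolding U_def by (intro card_bounded_nat) auto
      define V where "V = (SIGMA u:U. smooth (prime_factors (u * N)) X)"
      have "full_off k N X \<subseteq> (\<lambda>(u, w). u ^ k * w) ` V"
      proof
        fix m assume m: "m \<in> full_off k N X"
        obtain u w where uw: "m = u ^ k * w" "u > 0" "w \<in> smooth (prime_factors (u * N)) X"
          using full_off_decomp[OF m assms(2) N] by blast
        have "u ^ k \<le> m" using uw by (auto simp: smooth_def)
        then have "real (u ^ k) \<le> X" using m by (auto simp: full_off_def simp del: of_nat_power)
        then have "(real u ^ k) powr (1 / real k) \<le> X powr (1 / real k)"
          by (intro powr_mono2) auto
        also have "(real u ^ k) powr (1 / real k) = real u"
          using uw(2) assms(2) by (simp add: powr_realpow[symmetric] powr_powr)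
        finally have "u \<in> U" using uw(2) by (simp add: U_def)
        then show "m \<in> (\<lambda>(u, w). u ^ k * w) ` V" using uw by (force simp: V_def)
      qed
      then have "card (full_off k N X) \<le> card V"
        by (rule surj_card_le[rotated]) (auto simp: V_def finU)
      also have "card V = (\<Sum>u\<in>U. card (smooth (prime_factors (u * N)) X))"
        unfolding V_def using finU by simp
      finally have "real (card (full_off k N X)) \<le> (\<Sum>u\<in>U. real (card (smooth (prime_factors (u * N)) X)))"
        unfolding of_nat_sum[symmetric] of_nat_le_iff .
      also have "\<dots> \<le> (\<Sum>u\<in>U. K * X powr e' * (X * real N) powr e')"
      proof (intro sum_mono)
        fix u assume u: "u \<in> U"
        have "X powr (1 / real k) \<le> X powr 1" using False assms(2) by (intro powr_mono) auto
        then have uX: "real u \<le> X" using u False by (auto simp: U_def)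
        have "real (card (smooth (prime_factors (u * N)) X)) \<le> K * X powr e' * real (u * N) powr e'"
          using u N X by (intro K(2)) (auto simp: U_def)
        also have "\<dots> \<le> K * X powr e' * (X * real N) powr e'"
          using K(1) e' uX by (intro mult_left_mono powr_mono2) (auto intro: mult_right_mono)
        finally show "real (card (smooth (prime_factors (u * N)) X)) \<le> K * X powr e' * (X * real N) powr e'" .
      qed
      also have "\<dots> = real (card U) * (K * X powr e' * (X * real N) powr e')" by simp
      also have "\<dots> \<le> X powr (1 / real k) * (K * X powr e' * (X * real N) powr e')"
        using K(1) cU by (intro mult_right_mono) auto
      also have "\<dots> = K * X powr (1 / real k + e) * real N powr e'"
        using X by (simp add: powr_mult powr_add e'_def field_simps flip: power2_eq_square)
           (simp add: power2_eq_square powr_add[symmetric])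
      also have "\<dots> \<le> K * X powr (1 / real k + e) * real N powr e"
        using K(1) N assms(1) by (intro mult_left_mono powr_mono) (auto simp: e'_def)
      finally show ?thesis .
    qed
  qed (fact K(1))
qed

section \<open>Linear equations in reciprocals\<close>

definition nz :: "real \<Rightarrow> int set" where
  "nz H = {a. 1 \<le> \<bar>a\<bar> \<and> real_of_int \<bar>a\<bar> \<le> H}"

lemma nz_subset: "nz H \<subseteq> {1..\<lfloor>H\<rfloor>} \<union> {-\<lfloor>H\<rfloor>..-1}"
proof
  fix a assume "a \<in> nz H"
  then have "1 \<le> \<bar>a\<bar>" "\<bar>a\<bar> \<le> \<lfloor>H\<rfloor>" by (auto simp: nz_def le_floor_iff)
  then show "a \<in> {1..\<lfloor>H\<rfloor>} \<union> {-\<lfloor>H\<rfloor>..-1}" by auto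
qed

lemma finite_nz [simp]: "finite (nz H)"
  by (rule finite_subset[OF nz_subset]) simp

lemma card_nz_le: "0 \<le> H \<Longrightarrow> real (card (nz H)) \<le> 2 * H"
proof -
  assume H: "0 \<le> H"
  have "card (nz H) \<le> card ({1..\<lfloor>H\<rfloor>} \<union> {-\<lfloor>H\<rfloor>..-1})"
    by (intro card_mono nz_subset) simp
  also have "\<dots> \<le> nat \<lfloor>H\<rfloor> + nat \<lfloor>H\<rfloor>"
    by (rule order.trans[OF card_Un_le]) simp
  finally show ?thesis using H by linarith
qed

lemma nz_nonzero: "a \<in> nz H \<Longrightarrow> a \<noteq> 0"
  by (auto simp: nz_def)

section \<open>Tuples with a prescribed product of absolute values\<close>

definition absprod :: "'a set \<Rightarrow> ('a \<Rightarrow> int) \<Rightarrow> nat" where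
  "absprod I x = (\<Prod>i\<in>I. nat \<bar>x i\<bar>)"

lemma absprod_pos: "finite I \<Longrightarrow> (\<And>i. i \<in> I \<Longrightarrow> x i \<noteq> 0) \<Longrightarrow> absprod I x > 0"
  by (auto simp: absprod_def intro!: prod_pos)

lemma dvd_absprod:
  assumes "finite I" "i \<in> I"
  shows "x i dvd int (absprod I x)"
proof -
  have "nat \<bar>x i\<bar> dvd absprod I x"
    unfolding absprod_def using assms by (intro dvd_prodI) auto
  then show ?thesis by (simp add: nat_abs_dvd_iff)
qed

lemma absprod_le_power:
  assumes "finite I" "\<And>i. i \<in> I \<Longrightarrow> real_of_int \<bar>x i\<bar> \<le> B"
  shows "real (absprod I x) \<le> B ^ card I"
proof -
  have "real (absprod I x) = (\<Prod>i\<in>I. real_of_int \<bar>x i\<bar>)"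
    unfolding absprod_def by (simp add: of_nat_prod)
  also have "\<dots> \<le> (\<Prod>i\<in>I. B)" using assms by (intro prod_mono) auto
  finally show ?thesis by simp
qed

lemma card_int_divisors_le:
  fixes m :: nat
  assumes "m > 0"
  shows "finite {a::int. a dvd int m} \<and> card {a::int. a dvd int m} \<le> 2 * card {d. d dvd m}"
proof -
  let ?D = "{d. d dvd m}"
  have fin: "finite ?D" using assms by simp
  have sub: "{a::int. a dvd int m} \<subseteq> int ` ?D \<union> (\<lambda>d. - int d) ` ?D"
  proof
    fix a :: int assume a: "a \<in> {a::int. a dvd int m}"
    have "a = int (nat \<bar>a\<bar>) \<or> a = - int (nat \<bar>a\<bar>)" by linarith
    moreover have "nat \<bar>a\<bar> \<in> ?D" using a by (simp add: nat_abs_dvd_iff)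
    ultimately show "a \<in> int ` ?D \<union> (\<lambda>d. - int d) ` ?D" by blast
  qed
  have "card {a::int. a dvd int m} \<le> card (int ` ?D) + card ((\<lambda>d. - int d) ` ?D)"
    using fin by (intro order.trans[OF card_mono[OF _ sub] card_Un_le]) auto
  also have "\<dots> \<le> 2 * card ?D" using card_image_le[OF fin, of int] card_image_le[OF fin, of "\<lambda>d. - int d"]
    by linarith
  finally show ?thesis using finite_subset[OF sub] fin by auto
qed

text \<open>Every coordinate is, up to sign, a divisor of the product, so a value m of the product
  comes from at most (2 d(m))^n tuples, where d is the divisor function.\<close>

lemma card_tuples_le:
  fixes e :: real
  assumes "e > 0"
  shows "\<exists>K>0. \<forall>F X. \<forall>I::nat set. finite I \<longrightarrow> card I = n \<longrightarrow> finite F \<longrightarrow> (\<forall>m\<in>F. 0 < m \<and> real m \<le> X) \<longrightarrow> X \<ge> 0 \<longrightarrow>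
    real (card {x \<in> PiE I (\<lambda>_. UNIV). absprod I x \<in> F}) \<le> K * real (card F) * X powr e"
proof -
  \<comment> \<open>The divisor bound is used once per coordinate; the added 1 covers
    \<open>n = 0\<close>.\<close>
  define e' where "e' = e / (real n + 1)"
  have e': "e' > 0" using assms by (simp add: e'_def)
  have ne': "e' * real n \<le> e" using assms by (simp add: e'_def field_simps)
  obtain K where K: "K > 0" "\<And>m::nat. m > 0 \<Longrightarrow> real (card {d. d dvd m}) \<le> K * real m powr e'"
    using card_divisors_le[OF e'] by blast
  show ?thesis
  proof (intro exI conjI allI impI)
    show "(2 * K) ^ n > 0" using K by simp
    fix F :: "nat set" and X :: real and I :: "nat set"
    assume I: "finite I" "card I = n" and F: "finite F" "\<forall>m\<in>F. 0 < m \<and> real m \<le> X" and X: "X \<ge> 0"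
    define G where "G m = PiE I (\<lambda>_. {a::int. a dvd int m})" for m
    have sub: "{x \<in> PiE I (\<lambda>_. UNIV). absprod I x \<in> F} \<subseteq> (\<Union>m\<in>F. G m)"
    proof
      fix x assume x: "x \<in> {x \<in> PiE I (\<lambda>_. UNIV). absprod I x \<in> F}"
      then have "x \<in> G (absprod I x)" using I unfolding G_def
        by (auto simp: dvd_absprod PiE_iff)
      with x show "x \<in> (\<Union>m\<in>F. G m)" by blast
    qed
    have finG: "finite (G m)" if "m \<in> F" for m
      unfolding G_def using I F that card_int_divisors_le by (intro finite_PiE) auto
    have G: "real (card (G m)) \<le> (2 * K) ^ n * X powr e" if m: "m \<in> F" for m
    proof -
      have m0: "m > 0" "real m \<le> X" using F m by auto
      have "real (card (G m)) = real (card {a::int. a dvd int m}) ^ n"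
        unfolding G_def using I by (simp add: card_PiE)
      also have "\<dots> \<le> (2 * (K * real m powr e')) ^ n"
        using K(2)[OF m0(1)] card_int_divisors_le[OF m0(1)] by (intro power_mono) auto
      also have "\<dots> = (2 * K) ^ n * real m powr (e' * real n)"
        using m0 by (simp add: power_mult_distrib powr_powr[symmetric] powr_realpow)
      also have "\<dots> \<le> (2 * K) ^ n * real m powr e"
        using m0 K ne' by (intro mult_left_mono powr_mono) auto
      also have "\<dots> \<le> (2 * K) ^ n * X powr e"
        using m0 K assms by (intro mult_left_mono powr_mono2) auto
      finally show ?thesis .
    qed
    have "card {x \<in> PiE I (\<lambda>_. UNIV). absprod I x \<in> F} \<le> card (\<Union>m\<in>F. G m)"
      using F finG by (intro card_mono[OF _ sub]) auto
    also have "\<dots> \<le> (\<Sum>m\<in>F. card (G m))" by (rule card_UN_le[OF F(1)])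
    finally have "real (card {x \<in> PiE I (\<lambda>_. UNIV). absprod I x \<in> F}) \<le> (\<Sum>m\<in>F. real (card (G m)))"
      unfolding of_nat_sum[symmetric] of_nat_le_iff .
    also have "\<dots> \<le> (\<Sum>m\<in>F. (2 * K) ^ n * X powr e)" by (intro sum_mono G)
    finally show "real (card {x \<in> PiE I (\<lambda>_. UNIV). absprod I x \<in> F}) \<le> (2 * K) ^ n * real (card F) * X powr e"
      by (simp add: mult_ac)
  qed
qed

lemma finite_tuples:
  assumes "finite I" "finite F" "0 \<notin> F"
  shows "finite {x \<in> PiE I (\<lambda>_. UNIV). absprod I x \<in> F}"
proof (rule finite_subset)
  show "{x \<in> PiE I (\<lambda>_. UNIV). absprod I x \<in> F} \<subseteq> (\<Union>m\<in>F. PiE I (\<lambda>_. {a::int. a dvd int m}))"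
    using assms(1) by (auto simp: PiE_iff intro!: bexI[of _ "absprod I _"] dvd_absprod)
  show "finite (\<Union>m\<in>F. PiE I (\<lambda>_. {a::int. a dvd int m}))"
  proof (intro finite_UN_I assms finite_PiE)
    fix m assume "m \<in> F"
    then have "m > 0" using assms(3) by (cases m) auto
    then show "finite {a::int. a dvd int m}" using card_int_divisors_le by blast
  qed
qed

lemma card_tuples_full_le:
  fixes e :: real
  assumes "e > 0" "k > 0"
  shows "\<exists>K>0. \<forall>N X. \<forall>I::nat set. finite I \<longrightarrow> card I = n \<longrightarrow> N > 0 \<longrightarrow> X \<ge> 0 \<longrightarrow>
    real (card {x \<in> PiE I (\<lambda>_. UNIV). absprod I x \<in> full_off k N X})
      \<le> K * X powr (1 / real k + e) * real N powr e"
proof -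
  obtain K1 where K1: "K1 > 0" "\<And>F X. \<And>I::nat set. finite I \<Longrightarrow> card I = n \<Longrightarrow> finite F \<Longrightarrow>
      (\<forall>m\<in>F. 0 < m \<and> real m \<le> X) \<Longrightarrow> X \<ge> 0 \<Longrightarrow>
      real (card {x \<in> PiE I (\<lambda>_. UNIV). absprod I x \<in> F}) \<le> K1 * real (card F) * X powr (e/2)"
    using card_tuples_le[of "e/2" n] assms by auto
  obtain K2 where K2: "K2 > 0" "\<And>N X. N > 0 \<Longrightarrow> X \<ge> 0 \<Longrightarrow>
      real (card (full_off k N X)) \<le> K2 * X powr (1 / real k + e/2) * real N powr (e/2)"
    using card_full_off_le[of "e/2" k] assms by auto
  show ?thesis
  proof (intro exI conjI allI impI)
    show "K1 * K2 > 0" using K1 K2 by simp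
    fix N :: nat and X :: real and I :: "nat set"
    assume I: "finite I" "card I = n" and N: "N > 0" and X: "X \<ge> 0"
    have "real (card {x \<in> PiE I (\<lambda>_. UNIV). absprod I x \<in> full_off k N X})
      \<le> K1 * real (card (full_off k N X)) * X powr (e/2)"
      using I X by (intro K1(2) finite_full_off) (auto simp: full_off_def)
    also have "\<dots> \<le> K1 * (K2 * X powr (1 / real k + e/2) * real N powr (e/2)) * X powr (e/2)"
      using K1 K2(2)[OF N X] by (intro mult_left_mono mult_right_mono) auto
    also have "\<dots> = K1 * K2 * (X powr (1 / real k + e/2) * X powr (e/2)) * real N powr (e/2)"
      by (simp add: mult_ac)
    also have "X powr (1 / real k + e/2) * X powr (e/2) = X powr (1 / real k + e)"
      by (simp add: powr_add[symmetric] add.commute)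
    also have "K1 * K2 * X powr (1 / real k + e) * real N powr (e/2) \<le>
      K1 * K2 * X powr (1 / real k + e) * real N powr e"
      using K1 K2 N assms by (intro mult_left_mono powr_mono) auto
    finally show "real (card {x \<in> PiE I (\<lambda>_. UNIV). absprod I x \<in> full_off k N X})
      \<le> K1 * K2 * X powr (1 / real k + e) * real N powr e" .
  qed
qed

section \<open>The equation and the primes shared by two of its variables\<close>

definition Sol :: "nat set \<Rightarrow> (nat \<Rightarrow> int) \<Rightarrow> rat \<Rightarrow> real \<Rightarrow> (nat \<Rightarrow> int) set" where
  "Sol I A b H = {x \<in> PiE I (\<lambda>_. nz H). (\<Sum>i\<in>I. of_int (A i) / of_int (x i)) = b}"

lemma finite_Sol [simp]: "finite I \<Longrightarrow> finite (Sol I A b H)"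
  unfolding Sol_def by (intro finite_Collect_conjI disjI1) (simp add: finite_PiE)

lemma Sol_nz: "x \<in> Sol I A b H \<Longrightarrow> i \<in> I \<Longrightarrow> x i \<in> nz H"
  by (auto simp: Sol_def)

lemma Sol_nonzero: "x \<in> Sol I A b H \<Longrightarrow> i \<in> I \<Longrightarrow> x i \<noteq> 0"
  by (auto simp: Sol_def dest!: PiE_mem nz_nonzero)

lemma absprod_Sol_le: "finite I \<Longrightarrow> x \<in> Sol I A b H \<Longrightarrow> real (absprod I x) \<le> H ^ card I"
  by (intro absprod_le_power) (auto dest!: Sol_nz simp: nz_def)

text \<open>Multiply the equation by \<open>v\<close> and by the product \<open>R\<close> of the
  other variables. Every term except the \<open>i\<close>-th becomes integral, hence so does that
  one, and \<open>x i\<close> divides \<open>v * A i * R\<close>. A prime of \<open>x i\<close> must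
  then divide one of these three factors.\<close>

lemma prime_shared:
  fixes A x :: "nat \<Rightarrow> int" and b :: rat and p :: nat
  assumes "finite I" "(\<Sum>i\<in>I. of_int (A i) / of_int (x i)) = b" "\<And>i. i \<in> I \<Longrightarrow> x i \<noteq> 0"
    "of_int v * b \<in> \<int>" "prime p" "i \<in> I" "int p dvd x i" "\<not> int p dvd v" "\<not> int p dvd A i"
  shows "\<exists>j\<in>I. j \<noteq> i \<and> int p dvd x j"
proof (rule ccontr)
  assume H: "\<not> (\<exists>j\<in>I. j \<noteq> i \<and> int p dvd x j)"
  define R where "R = (\<Prod>j\<in>I - {i}. x j)"
  have pp: "prime (int p)" using assms(5) by simp
  have pR: "\<not> int p dvd R" unfolding R_def
    using H assms(1) by (subst prime_dvd_prod_iff[OF _ pp]) auto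
  have int: "of_int v * (of_int (A j) / of_int (x j)) * of_int R \<in> (\<int> :: rat set)" if j: "j \<in> I - {i}" for j
  proof -
    have "R = x j * (\<Prod>j\<in>I - {i} - {j}. x j)"
      unfolding R_def using assms(1) j by (intro prod.remove) auto
    then have "of_int v * (of_int (A j) / of_int (x j)) * of_int R
        = (of_int (v * A j * (\<Prod>j\<in>I - {i} - {j}. x j)) :: rat)"
      using assms(3) j by simp
    then show ?thesis by (metis Ints_of_int)
  qed
  have "b = of_int (A i) / of_int (x i) + (\<Sum>j\<in>I - {i}. of_int (A j) / of_int (x j))"
    using sum.remove[OF assms(1,6), of "\<lambda>i. of_int (A i) / of_int (x i) :: rat"] assms(2) by simp
  then have "of_int v * (of_int (A i) / of_int (x i)) * of_int R =
      of_int v * b * of_int R - (\<Sum>j\<in>I - {i}. of_int v * (of_int (A j) / of_int (x j)) * of_int R)"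
    by (simp add: algebra_simps sum_distrib_left sum_distrib_right)
  also have "\<dots> \<in> \<int>"
  proof (intro Ints_diff Ints_sum)
    show "of_int v * b * of_int R \<in> \<int>" by (rule Ints_mult[OF assms(4) Ints_of_int])
  qed (rule int)
  finally obtain z where z: "of_int v * (of_int (A i) / of_int (x i)) * of_int R = (of_int z :: rat)"
    by (elim Ints_cases)
  then have "of_int (v * A i * R) = (of_int (z * x i) :: rat)"
    using assms(3)[OF assms(6)] by (simp add: field_simps)
  then have "v * A i * R = z * x i" by (simp only: of_int_eq_iff)
  then have "int p dvd v * A i * R" using assms(7) by simp
  then show False using pp pR assms(8,9) by (auto simp: prime_dvd_mult_iff)
qed

text \<open>A single parameter serves as factor and as exponent. This is the size of a bounded minor
  after multiplication by a common denominator, and it lets every constant depend on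
  \<open>L\<close> alone.\<close>

definition admissible :: "nat \<Rightarrow> real \<Rightarrow> nat set \<Rightarrow> (nat \<Rightarrow> int) \<Rightarrow> bool" where
  "admissible L H I A \<longleftrightarrow> finite I \<and> (\<forall>i\<in>I. A i \<noteq> 0 \<and> real_of_int \<bar>A i\<bar> \<le> real L * H ^ L)"

text \<open>The arithmetic content of the equation, freed from its coefficients and its right-hand
  side: these survive only in the modulus \<open>N\<close>.\<close>

definition shares_primes_off :: "nat \<Rightarrow> nat set \<Rightarrow> (nat \<Rightarrow> int) \<Rightarrow> bool" where
  "shares_primes_off N I x \<longleftrightarrow> (\<forall>p i. prime p \<longrightarrow> \<not> p dvd N \<longrightarrow> i \<in> I \<longrightarrow> int p dvd x i \<longrightarrow>
     (\<exists>j\<in>I. j \<noteq> i \<and> int p dvd x j))"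

lemma Sol_denominator:
  assumes "finite I" "x0 \<in> Sol I A b H"
  shows "of_nat (absprod I x0) * b \<in> \<int>"
proof -
  define v where "v = absprod I x0"
  have "b = (\<Sum>i\<in>I. of_int (A i) / of_int (x0 i))" using assms by (simp add: Sol_def)
  then have "of_nat v * b = (\<Sum>i\<in>I. of_int (int v) * (of_int (A i) / of_int (x0 i)))"
    by (simp add: sum_distrib_left)
  also have "\<dots> \<in> \<int>"
  proof (intro Ints_sum)
    fix i assume i: "i \<in> I"
    have "x0 i dvd int v" using dvd_absprod[OF assms(1) i, of x0] unfolding v_def .
    then obtain c where c: "int v = x0 i * c" by blast
    then have "of_int (int v) * (of_int (A i) / of_int (x0 i)) = (of_int (c * A i) :: rat)"
      using Sol_nonzero[OF assms(2) i] unfolding c by simp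
    then show "of_int (int v) * (of_int (A i) / of_int (x0 i)) \<in> (\<int> :: rat set)" by (metis Ints_of_int)
  qed
  finally show ?thesis unfolding v_def .
qed

text \<open>The denominator of \<open>b\<close> needs no a priori bound: it divides the product of the
  entries of any one solution.\<close>

lemma Sol_modulus:
  assumes "admissible L H I A" "H \<ge> 1" "card I = n" "Sol I A b H \<noteq> {}"
  shows "\<exists>N>0. real N \<le> real L ^ n * H ^ (n * (L + 1)) \<and> (\<forall>x \<in> Sol I A b H. shares_primes_off N I x)"
proof -
  obtain x0 where x0: "x0 \<in> Sol I A b H" using assms by blast
  have fin: "finite I" using assms by (simp add: admissible_def)
  \<comment> \<open>\<open>v\<close> clears the denominator of \<open>b\<close> and \<open>M\<close>
    contains all primes of the coefficients, so a prime outside \<open>v * M\<close> satisfies both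
    conditions under which it has to be shared.\<close>
  define v where "v = absprod I x0"
  define M where "M = absprod I A"
  have v: "v > 0" "real v \<le> H ^ n"
    unfolding v_def using fin x0 Sol_nonzero absprod_Sol_le[OF fin x0] assms by (auto intro!: absprod_pos)
  have M: "M > 0" "real M \<le> (real L * H ^ L) ^ n"
    unfolding M_def using assms fin
    by (auto intro!: absprod_pos absprod_le_power simp: admissible_def)
  have vb: "of_int (int v) * b \<in> \<int>"
    using Sol_denominator[OF fin x0] by (simp add: v_def)
  show ?thesis
  proof (intro exI conjI ballI)
    show "v * M > 0" using v M by simp
    have "real (v * M) \<le> H ^ n * (real L * H ^ L) ^ n"
      using v M assms by (simp add: mult_mono)
    also have "\<dots> = real L ^ n * H ^ (n * (L + 1))"
      by (simp add: power_mult_distrib power_mult[symmetric] power_add mult_ac)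
    finally show "real (v * M) \<le> real L ^ n * H ^ (n * (L + 1))" .
    fix x assume x: "x \<in> Sol I A b H"
    show "shares_primes_off (v * M) I x" unfolding shares_primes_off_def
    proof (intro allI impI)
      fix p i assume p: "prime p" "\<not> p dvd v * M" "i \<in> I" "int p dvd x i"
      have "\<not> int p dvd int v" using p by (auto simp: int_dvd_int_iff)
      moreover have "\<not> int p dvd A i"
      proof
        assume "int p dvd A i"
        then have "int p dvd int M" unfolding M_def using dvd_absprod[OF fin p(3), of A] dvd_trans by blast
        then have "p dvd M" by simp
        then show False using p by simp
      qed
      ultimately show "\<exists>j\<in>I. j \<noteq> i \<and> int p dvd x j"
        using x Sol_nonzero[OF x] vb p fin by (intro prime_shared[of I A x b "int v" p i]) (auto simp: Sol_def)
    qed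
  qed
qed

lemma prime_dvd_absprodD:
  assumes "finite I" "prime p" "p dvd absprod I x"
  shows "\<exists>i\<in>I. int p dvd x i"
  using assms by (auto simp: absprod_def prime_dvd_prod_iff)

lemma absprod_remove2:
  assumes "finite I" "i \<in> I" "j \<in> I" "i \<noteq> j"
  shows "absprod I x = nat \<bar>x i\<bar> * (nat \<bar>x j\<bar> * absprod (I - {i, j}) x)"
proof -
  have "absprod I x = nat \<bar>x i\<bar> * (\<Prod>k\<in>I - {i}. nat \<bar>x k\<bar>)"
    unfolding absprod_def using assms by (intro prod.remove) auto
  also have "(\<Prod>k\<in>I - {i}. nat \<bar>x k\<bar>) = nat \<bar>x j\<bar> * (\<Prod>k\<in>I - {i} - {j}. nat \<bar>x k\<bar>)"
    using assms by (intro prod.remove) auto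
  also have "I - {i} - {j} = I - {i, j}" by auto
  finally show ?thesis by (simp add: absprod_def)
qed

lemma shares_primes_square_dvd:
  assumes "finite I" "shares_primes_off N I x" "prime p" "p dvd absprod I x" "\<not> p dvd N"
  shows "p ^ 2 dvd absprod I x"
proof -
  obtain i where i: "i \<in> I" "int p dvd x i" using prime_dvd_absprodD[OF assms(1,3,4)] by blast
  obtain j where j: "j \<in> I" "j \<noteq> i" "int p dvd x j" using assms i unfolding shares_primes_off_def by blast
  have "p dvd nat \<bar>x i\<bar>" "p dvd nat \<bar>x j\<bar>" using i j by auto
  then show ?thesis unfolding absprod_remove2[OF assms(1) i(1) j(1) j(2)[symmetric]] power2_eq_square
    by (intro mult_dvd_mono dvd_mult2) auto
qed

text \<open>\<open>K\<close> is chosen before \<open>H\<close>, \<open>I\<close>, \<open>A\<close>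
  and \<open>b\<close>: this is the uniformity. The index set is any set of \<open>n\<close>
  elements, so that deleting variables leads to an instance of the same statement. \<open>D\<close>
  separates arbitrary from nonzero right-hand sides.\<close>

definition Sol_bound :: "nat \<Rightarrow> nat \<Rightarrow> rat set \<Rightarrow> real \<Rightarrow> bool" where
  "Sol_bound n L D c \<longleftrightarrow> (\<forall>\<epsilon>>0. \<exists>K>0. \<forall>H\<ge>1. \<forall>I A b. admissible L H I A \<longrightarrow> card I = n \<longrightarrow> b \<in> D \<longrightarrow>
     real (card (Sol I A b H)) \<le> K * H powr (c + \<epsilon>))"

lemma modulus_powr_le:
  assumes "real N \<le> real L ^ n * H ^ (n * (L + 1))" "H \<ge> 1" "e > 0"
  shows "real N powr e \<le> (real L ^ n) powr e * H powr (e * real (n * (L + 1)))"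
proof -
  have "real N powr e \<le> (real L ^ n * H ^ (n * (L + 1))) powr e"
    using assms by (intro powr_mono2) auto
  also have "\<dots> = (real L ^ n) powr e * (H ^ (n * (L + 1))) powr e"
    using assms by (simp add: powr_mult)
  also have "(H ^ (n * (L + 1))) powr e = H powr (e * real (n * (L + 1)))"
    using assms by (simp add: powr_realpow[symmetric] powr_powr mult.commute del: of_nat_mult)
  finally show ?thesis .
qed

lemma Sol_bound_half: "Sol_bound n L UNIV (real n / 2)"
  unfolding Sol_bound_def
proof (intro allI impI)
  fix \<epsilon> :: real assume eps: "\<epsilon> > 0"
  \<comment> \<open>The losses are H^(e n), from the bound \<open>H ^ n\<close> for the product of
    the variables, and H^(e n (L + 1)), from the modulus.\<close>
  define e where "e = \<epsilon> / (real n + real (n * (L + 1)) + 1)"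
  have e: "e > 0" unfolding e_def using eps by (intro divide_pos_pos add_nonneg_pos) auto
  have e2: "e * (real n + real (n * (L + 1))) \<le> \<epsilon>"
  proof -
    define M where "M = real n + real (n * (L + 1))"
    have "M \<ge> 0" by (simp add: M_def)
    then have "\<epsilon> / (M + 1) * M \<le> \<epsilon>" using eps by (simp add: field_simps)
    then show ?thesis by (simp add: e_def M_def)
  qed
  obtain K where K: "K > 0" "\<And>N X. \<And>I::nat set. finite I \<Longrightarrow> card I = n \<Longrightarrow> N > 0 \<Longrightarrow> X \<ge> 0 \<Longrightarrow>
    real (card {x \<in> PiE I (\<lambda>_. UNIV). absprod I x \<in> full_off 2 N X})
      \<le> K * X powr (1 / real 2 + e) * real N powr e"
    using card_tuples_full_le[OF e, of 2 n] by auto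
  \<comment> \<open>The added 1 keeps \<open>K'\<close> positive even for
    \<open>L = 0\<close>.\<close>
  define K' where "K' = K * (real L ^ n) powr e + 1"
  show "\<exists>K>0. \<forall>H\<ge>1. \<forall>I A b. admissible L H I A \<longrightarrow> card I = n \<longrightarrow> b \<in> UNIV \<longrightarrow>
     real (card (Sol I A b H)) \<le> K * H powr (real n / 2 + \<epsilon>)"
  proof (intro exI conjI allI impI)
    show "K' > 0" unfolding K'_def using K(1) by (intro add_nonneg_pos mult_nonneg_nonneg) auto
    fix H :: real and I A and b :: rat
    assume H: "H \<ge> 1" and adm: "admissible L H I A" and cI: "card I = n"
    have fin: "finite I" using adm by (simp add: admissible_def)
    show "real (card (Sol I A b H)) \<le> K' * H powr (real n / 2 + \<epsilon>)"
    proof (cases "Sol I A b H = {}")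
      case True
      then show ?thesis using \<open>K' > 0\<close> by simp
    next
      case False
      obtain N where N: "N > 0" "real N \<le> real L ^ n * H ^ (n * (L + 1))"
        "\<And>x. x \<in> Sol I A b H \<Longrightarrow> shares_primes_off N I x"
        using Sol_modulus[OF adm H cI False] by blast
      have sub: "Sol I A b H \<subseteq> {x \<in> PiE I (\<lambda>_. UNIV). absprod I x \<in> full_off 2 N (H ^ n)}"
      proof
        fix x assume x: "x \<in> Sol I A b H"
        have "absprod I x \<in> full_off 2 N (H ^ n)"
          using shares_primes_square_dvd[OF fin N(3)[OF x]] absprod_Sol_le[OF fin x] cI
            absprod_pos[OF fin Sol_nonzero[OF x]] by (auto simp: full_off_def)
        then show "x \<in> {x \<in> PiE I (\<lambda>_. UNIV). absprod I x \<in> full_off 2 N (H ^ n)}"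
          using x by (auto simp: Sol_def PiE_def)
      qed
      have "card (Sol I A b H) \<le> card {x \<in> PiE I (\<lambda>_. UNIV). absprod I x \<in> full_off 2 N (H ^ n)}"
        by (intro card_mono[OF _ sub] finite_tuples fin finite_full_off) (simp add: full_off_def)
      also have "real \<dots> \<le> K * (H ^ n) powr (1 / real 2 + e) * real N powr e"
        using H N by (intro K(2) fin cI) auto
      also have "\<dots> \<le> K * (H ^ n) powr (1 / real 2 + e) * ((real L ^ n) powr e * H powr (e * real (n * (L + 1))))"
        using K H N e by (intro mult_left_mono modulus_powr_le) auto
      also have "(H ^ n) powr (1 / real 2 + e) = H powr (real n / 2 + e * real n)"
        using H by (simp add: powr_realpow[symmetric] powr_powr algebra_simps)
      also have "K * H powr (real n / 2 + e * real n) * ((real L ^ n) powr e * H powr (e * real (n * (L + 1))))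
         = (K * (real L ^ n) powr e) * H powr (real n / 2 + e * (real n + real (n * (L + 1))))"
        by (simp add: powr_add[symmetric] algebra_simps del: of_nat_mult)
      also have "\<dots> \<le> K' * H powr (real n / 2 + \<epsilon>)"
        using H K e2 by (intro mult_mono powr_mono) (auto simp: K'_def)
      finally show ?thesis by simp
    qed
  qed
qed

lemma Sol_boundE:
  assumes "Sol_bound n L D c" "\<epsilon> > 0"
  obtains K where "K > 0" "\<And>H I A b. H \<ge> 1 \<Longrightarrow> admissible L H I A \<Longrightarrow> card I = n \<Longrightarrow> b \<in> D \<Longrightarrow>
    real (card (Sol I A b H)) \<le> K * H powr (c + \<epsilon>)"
  using assms unfolding Sol_bound_def by meson

section \<open>Equations in two and three variables\<close>

lemma admissible_subset: "admissible L H I A \<Longrightarrow> J \<subseteq> I \<Longrightarrow> admissible L H J A"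
  by (auto simp: admissible_def intro: finite_subset)

text \<open>A fixed variable moves to the right-hand side, which then takes many values; bounds
  uniform in \<open>b\<close> are what makes the sum useful.\<close>

lemma card_Sol_remove:
  assumes "finite I" "i \<in> I"
  shows "card (Sol I A b H) \<le> (\<Sum>c\<in>nz H. card (Sol (I - {i}) A (b - of_int (A i) / of_int c) H))"
proof -
  let ?S = "SIGMA c:nz H. Sol (I - {i}) A (b - of_int (A i) / of_int c) H"
  let ?f = "\<lambda>x. (x i, restrict x (I - {i}))"
  have "inj_on ?f (Sol I A b H)"
  proof (rule inj_onI)
    fix x y assume x: "x \<in> Sol I A b H" and y: "y \<in> Sol I A b H" and eq: "?f x = ?f y"
    have "x k = y k" if "k \<in> I" for k
      using eq that by (cases "k = i") (auto dest!: fun_cong[where x=k])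
    then show "x = y" using x y by (intro PiE_ext[of x I "\<lambda>_. nz H" y]) (auto simp: Sol_def)
  qed
  moreover have "?f ` Sol I A b H \<subseteq> ?S"
  proof (rule image_subsetI)
    fix x assume x: "x \<in> Sol I A b H"
    have "(\<Sum>k\<in>I - {i}. of_int (A k) / of_int (restrict x (I - {i}) k)) =
          (\<Sum>k\<in>I - {i}. of_int (A k) / of_int (x k) :: rat)"
      by (intro sum.cong) auto
    also have "\<dots> = b - of_int (A i) / of_int (x i)"
      using x sum.remove[OF assms, of "\<lambda>k. of_int (A k) / of_int (x k) :: rat"] by (simp add: Sol_def)
    finally show "?f x \<in> ?S" using x assms by (auto simp: Sol_def)
  qed
  ultimately have "card (Sol I A b H) \<le> card ?S"
    using assms by (intro card_inj_on_le[of ?f]) auto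
  also have "card ?S = (\<Sum>c\<in>nz H. card (Sol (I - {i}) A (b - of_int (A i) / of_int c) H))"
    using assms by simp
  finally show ?thesis .
qed

text \<open>Clearing denominators in \<open>A\<^sub>i / x + A\<^sub>j / y = u / v\<close> and completing the product gives
  \<open>(u x - v A\<^sub>i) (u y - v A\<^sub>j) = v\<^sup>2 A\<^sub>i A\<^sub>j\<close>.\<close>

lemma Sol_bound_2: "Sol_bound 2 L (- {0}) 0"
  unfolding Sol_bound_def
proof (intro allI impI)
  fix \<epsilon> :: real assume eps: "\<epsilon> > 0"
  \<comment> \<open>Since \<open>v\<close> is at most H^2 and both coefficients are at most L H^L,
    the number \<open>m\<close> whose divisors are counted is at most L^2 H^(4 + 2 L).\<close>
  define e where "e = \<epsilon> / real (4 + 2 * L)"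
  have e: "e > 0" unfolding e_def using eps by simp
  have ee: "real (4 + 2 * L) * e = \<epsilon>" unfolding e_def by simp
  obtain K where K: "K > 0" "\<And>m::nat. m > 0 \<Longrightarrow> real (card {d. d dvd m}) \<le> K * real m powr e"
    using card_divisors_le[OF e] by blast
  define K' where "K' = 2 * K * (real L ^ 2) powr e + 1"
  show "\<exists>K>0. \<forall>H\<ge>1. \<forall>I A b. admissible L H I A \<longrightarrow> card I = 2 \<longrightarrow> b \<in> - {0} \<longrightarrow>
     real (card (Sol I A b H)) \<le> K * H powr (0 + \<epsilon>)"
  proof (intro exI conjI allI impI)
    show K': "K' > 0" unfolding K'_def using K(1) by (intro add_nonneg_pos mult_nonneg_nonneg) auto
    fix H :: real and I A and b :: rat
    assume H: "H \<ge> 1" and adm: "admissible L H I A" and cI: "card I = 2" and b: "b \<in> - {0}"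
    show "real (card (Sol I A b H)) \<le> K' * H powr (0 + \<epsilon>)"
    proof (cases "Sol I A b H = {}")
      case True
      then show ?thesis using K' by simp
    next
      case False
      then obtain x0 where x0: "x0 \<in> Sol I A b H" by blast
      have fin: "finite I" using adm by (simp add: admissible_def)
      define v where "v = int (absprod I x0)"
      have v: "v > 0" "real_of_int v \<le> H ^ 2"
        unfolding v_def using fin x0 Sol_nonzero absprod_Sol_le[OF fin x0] cI
        by (auto intro!: absprod_pos)
      obtain u where u: "of_int v * b = of_int u"
        using Sol_denominator[OF fin x0] by (auto simp: v_def elim!: Ints_cases)
      \<comment> \<open>Here \<open>b \<noteq> 0\<close> enters: for \<open>u = 0\<close> the
        divisor \<open>g x\<close> would be the same for all solutions and could not recover
        \<open>x i\<close>.\<close>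
      have u0: "u \<noteq> 0" using u v b by auto
      obtain i j where ij: "I = {i, j}" "i \<noteq> j" using cI by (auto simp: card_2_iff)
      have A: "A i \<noteq> 0" "A j \<noteq> 0" "real_of_int \<bar>A i\<bar> \<le> real L * H ^ L" "real_of_int \<bar>A j\<bar> \<le> real L * H ^ L"
        using adm ij by (auto simp: admissible_def)
      define m where "m = v\<^sup>2 * A i * A j"
      have m0: "m \<noteq> 0" using v A by (simp add: m_def)
      define g where "g = (\<lambda>x :: nat \<Rightarrow> int. u * x i - v * A i)"
      have dvd: "g x dvd m" if x: "x \<in> Sol I A b H" for x
      proof -
        have nz: "x i \<noteq> 0" "x j \<noteq> 0" using Sol_nonzero[OF x] ij by auto
        have "of_int (A i) / of_int (x i) + of_int (A j) / of_int (x j) = b"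
          using x ij by (simp add: Sol_def)
        then have "of_int v * (of_int (A i) * of_int (x j) + of_int (A j) * of_int (x i)) =
            of_int v * b * of_int (x i) * (of_int (x j) :: rat)"
          using nz by (auto simp: field_simps)
        then have "(of_int (v * (A i * x j + A j * x i)) :: rat) = of_int (u * x i * x j)"
          unfolding u by simp
        then have "v * (A i * x j + A j * x i) = u * x i * x j" by (simp only: of_int_eq_iff)
        then have "u * (v * (A i * x j + A j * x i)) = u * (u * x i * x j)" by simp
        then have "m = g x * (u * x j - v * A j)" unfolding m_def g_def
          by (simp add: algebra_simps power2_eq_square)
        then show ?thesis by simp
      qed
      have inj: "inj_on g (Sol I A b H)"
      proof (rule inj_onI)
        fix x y assume x: "x \<in> Sol I A b H" and y: "y \<in> Sol I A b H" and eq: "g x = g y"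
        have i: "x i = y i" using eq u0 by (simp add: g_def)
        have "of_int (A j) / of_int (x j) = (of_int (A j) / of_int (y j) :: rat)"
        proof -
          have "of_int (A i) / of_int (x i) + of_int (A j) / of_int (x j) = b"
            "of_int (A i) / of_int (y i) + of_int (A j) / of_int (y j) = b"
            using x y ij by (simp_all add: Sol_def)
          then show ?thesis unfolding i by (metis add_left_cancel)
        qed
        then have "x j = y j" using A Sol_nonzero[OF x, of j] Sol_nonzero[OF y, of j] ij
          by (simp add: field_simps)
        with i show "x = y" using x y ij
          by (intro PiE_ext[of x I "\<lambda>_. nz H" y]) (auto simp: Sol_def)
      qed
      have mpos: "nat \<bar>m\<bar> > 0" using m0 by simp
      have "card (Sol I A b H) \<le> card {a::int. a dvd int (nat \<bar>m\<bar>)}"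
        using inj dvd card_int_divisors_le[OF mpos] by (intro card_inj_on_le[of g]) auto
      also have "real \<dots> \<le> 2 * (K * real (nat \<bar>m\<bar>) powr e)"
        using card_int_divisors_le[OF mpos] K(2)[OF mpos] by linarith
      also have "real (nat \<bar>m\<bar>) = \<bar>real_of_int v\<bar>\<^sup>2 * \<bar>real_of_int (A i)\<bar> * \<bar>real_of_int (A j)\<bar>"
        by (simp add: m_def abs_mult power_abs)
      also have "\<dots> powr e \<le> ((H ^ 2)\<^sup>2 * (real L * H ^ L) * (real L * H ^ L)) powr e"
        using v A H e by (intro powr_mono2 mult_mono power_mono mult_nonneg_nonneg) auto
      also have "(H ^ 2)\<^sup>2 * (real L * H ^ L) * (real L * H ^ L) = real L ^ 2 * H ^ (4 + 2 * L)"
        by (simp add: power_add power_mult power2_eq_square mult_ac eval_nat_numeral)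
      also have "\<dots> powr e = (real L ^ 2) powr e * H powr \<epsilon>"
        using H by (simp add: powr_mult powr_realpow[symmetric] powr_powr ee del: of_nat_add of_nat_mult)
      finally have "real (card (Sol I A b H)) \<le> (2 * K * (real L ^ 2) powr e) * H powr \<epsilon>"
        using K by (simp add: mult_ac)
      also have "\<dots> \<le> K' * H powr \<epsilon>" by (intro mult_right_mono) (auto simp: K'_def)
      finally show ?thesis by simp
    qed
  qed
qed

text \<open>Fixing one variable costs H and leaves an equation with H^(o(1)) solutions, unless its
  right-hand side vanishes. That happens for at most one value of the fixed variable, and there the
  bound H^(1 + o(1)) for two variables is affordable.\<close>

lemma Sol_bound_3: "Sol_bound 3 L UNIV 1"
  unfolding Sol_bound_def
proof (intro allI impI)
  fix \<epsilon> :: real assume eps: "\<epsilon> > 0"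
  obtain K1 where K1: "K1 > 0" "\<And>H I A b. H \<ge> 1 \<Longrightarrow> admissible L H I A \<Longrightarrow> card I = 2 \<Longrightarrow> b \<in> - {0} \<Longrightarrow>
     real (card (Sol I A b H)) \<le> K1 * H powr (0 + \<epsilon>)"
    by (rule Sol_boundE[OF Sol_bound_2 eps]) (rule that)
  obtain K2 where K2: "K2 > 0" "\<And>H I A b. H \<ge> 1 \<Longrightarrow> admissible L H I A \<Longrightarrow> card I = 2 \<Longrightarrow> b \<in> UNIV \<Longrightarrow>
     real (card (Sol I A b H)) \<le> K2 * H powr (real 2 / 2 + \<epsilon>)"
    by (rule Sol_boundE[OF Sol_bound_half eps]) (rule that)
  show "\<exists>K>0. \<forall>H\<ge>1. \<forall>I A b. admissible L H I A \<longrightarrow> card I = 3 \<longrightarrow> b \<in> UNIV \<longrightarrow>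
     real (card (Sol I A b H)) \<le> K * H powr (1 + \<epsilon>)"
  proof (intro exI conjI allI impI)
    show "2 * K1 + K2 > 0" using K1 K2 by simp
    fix H :: real and I A and b :: rat
    assume H: "H \<ge> 1" and adm: "admissible L H I A" and cI: "card I = 3"
    have fin: "finite I" using adm by (simp add: admissible_def)
    obtain i where i: "i \<in> I" using cI by fastforce
    have adm': "admissible L H (I - {i}) A" using admissible_subset[OF adm] by blast
    have c2: "card (I - {i}) = 2" using cI i fin by simp
    have Ai: "A i \<noteq> 0" using adm i by (simp add: admissible_def)
    define Z where "Z = {c \<in> nz H. b = of_int (A i) / of_int c}"
    have "card Z \<le> 1"
    proof (rule card_le_Suc0_iff_eq[THEN iffD2, unfolded One_nat_def[symmetric]])
      show "finite Z" by (simp add: Z_def)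
      show "\<forall>c\<in>Z. \<forall>c'\<in>Z. c = c'"
        using Ai nz_nonzero by (auto simp: Z_def field_simps)
    qed
    then have cZ: "real (card Z) \<le> 1" by simp
    let ?s = "\<lambda>c. real (card (Sol (I - {i}) A (b - of_int (A i) / of_int c) H))"
    have "real (card (Sol I A b H)) \<le> (\<Sum>c\<in>nz H. ?s c)"
      using card_Sol_remove[OF fin i, of A b H] unfolding of_nat_sum[symmetric] of_nat_le_iff .
    also have "\<dots> = (\<Sum>c\<in>nz H - Z. ?s c) + (\<Sum>c\<in>Z. ?s c)"
      by (intro sum.subset_diff) (auto simp: Z_def)
    also have "\<dots> \<le> (\<Sum>c\<in>nz H - Z. K1 * H powr \<epsilon>) + (\<Sum>c\<in>Z. K2 * H powr (1 + \<epsilon>))"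
    proof (intro add_mono sum_mono)
      fix c assume "c \<in> nz H - Z"
      then have "b - of_int (A i) / of_int c \<in> - {0}" by (auto simp: Z_def)
      from K1(2)[OF H adm' c2 this] show "?s c \<le> K1 * H powr \<epsilon>" by simp
    next
      fix c
      show "?s c \<le> K2 * H powr (1 + \<epsilon>)" using K2(2)[OF H adm' c2 UNIV_I] by simp
    qed
    also have "\<dots> = real (card (nz H - Z)) * (K1 * H powr \<epsilon>) + real (card Z) * (K2 * H powr (1 + \<epsilon>))"
      by simp
    also have "\<dots> \<le> (2 * H) * (K1 * H powr \<epsilon>) + 1 * (K2 * H powr (1 + \<epsilon>))"
    proof (intro add_mono mult_right_mono cZ)
      have "card (nz H - Z) \<le> card (nz H)" by (intro card_mono) auto
      then show "real (card (nz H - Z)) \<le> 2 * H" using card_nz_le[of H] H by linarith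
    qed (use K1 K2 in auto)
    also have "\<dots> = (2 * K1 + K2) * H powr (1 + \<epsilon>)"
      using H by (simp add: powr_add algebra_simps)
    finally show "real (card (Sol I A b H)) \<le> (2 * K1 + K2) * H powr (1 + \<epsilon>)" .
  qed
qed

section \<open>Primes of exponent exactly two\<close>

lemma prime_prod_power_dvd:
  fixes m :: nat
  assumes "finite C" "\<And>p. p \<in> C \<Longrightarrow> prime p \<and> p ^ k dvd m"
  shows "(\<Prod>C) ^ k dvd m"
  using assms
proof (induction C rule: finite_induct)
  case (insert p C)
  have "coprime p (\<Prod>C)"
  proof (rule prod_coprime_right)
    fix q assume "q \<in> C"
    then show "coprime p q" using insert by (metis insert_iff primes_coprime)
  qed
  then have "coprime (p ^ k) ((\<Prod>C) ^ k)" by simp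
  moreover have "p ^ k dvd m" "(\<Prod>C) ^ k dvd m" using insert by auto
  ultimately have "p ^ k * (\<Prod>C) ^ k dvd m" by (intro divides_mult)
  then show ?case using insert.hyps by (simp add: power_mult_distrib)
qed simp

lemma prime_dvd_prod_primes:
  fixes p :: nat
  assumes "finite C" "\<And>q. q \<in> C \<Longrightarrow> prime q" "prime p" "p dvd \<Prod>C"
  shows "p \<in> C"
proof -
  obtain q where "q \<in> C" "p dvd q"
    using assms prime_dvd_prod_iff[OF assms(1), of p "\<lambda>x. x"] by auto
  then show ?thesis using assms primes_dvd_imp_eq by blast
qed

text \<open>When \<open>P\<close> is squareful off \<open>N\<close>, the condition on
  \<open>p ^ 3\<close> says that the exponent of \<open>p\<close> is exactly 2.\<close>

definition core :: "nat \<Rightarrow> nat \<Rightarrow> nat set" where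
  "core N P = {p. prime p \<and> p dvd P \<and> \<not> p dvd N \<and> \<not> p ^ 3 dvd P}"

lemma finite_core: "P > 0 \<Longrightarrow> finite (core N P)"
  by (rule finite_subset[of _ "{d. d dvd P}"]) (auto simp: core_def)

text \<open>Dividing by the square exhausts the primes of \<open>C\<close> outside \<open>N\<close>
  and leaves the other good exponents untouched, so conditions of fullness pass from
  \<open>P\<close> to the cofactor. \<open>C\<close> is a subset because it will be the whole core
  in one case and the part shared by one pair of variables in the other.\<close>

lemma core_divide_square:
  assumes P: "P > 0" "\<forall>p. prime p \<longrightarrow> p dvd P \<longrightarrow> \<not> p dvd N \<longrightarrow> p\<^sup>2 dvd P"
    and C: "C \<subseteq> core N P"
  shows "\<exists>R. P = (\<Prod>C)\<^sup>2 * R \<and> (\<forall>p. prime p \<longrightarrow> p dvd R \<longrightarrow> \<not> p dvd N \<longrightarrow>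
            p \<notin> C \<and> (\<forall>k. p ^ k dvd P \<longrightarrow> p ^ k dvd R))"
proof -
  have fin: "finite C" using finite_subset[OF C finite_core[OF P(1)]] .
  have pr: "prime p" if "p \<in> C" for p using C that by (auto simp: core_def)
  have "(\<Prod>C)\<^sup>2 dvd P"
    using C P by (intro prime_prod_power_dvd[OF fin]) (auto simp: core_def)
  then obtain R where R: "P = (\<Prod>C)\<^sup>2 * R" by blast
  show ?thesis
  proof (intro exI conjI allI impI)
    fix p assume p: "prime p" "p dvd R" "\<not> p dvd N"
    show pC: "p \<notin> C"
    proof
      assume "p \<in> C"
      then have "p dvd \<Prod>C" using fin by (intro dvd_prodI[of C p "\<lambda>x. x", simplified]) auto
      then have "p\<^sup>2 * p dvd P" unfolding R using p by (intro mult_dvd_mono dvd_power_same)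
      then have "p ^ 3 dvd P" by (simp add: power2_eq_square power3_eq_cube)
      then show False using \<open>p \<in> C\<close> C by (auto simp: core_def)
    qed
    fix k assume k: "p ^ k dvd P"
    have "\<not> p dvd \<Prod>C" using prime_dvd_prod_primes[OF fin pr p(1)] pC by blast
    then have "coprime (p ^ k) ((\<Prod>C)\<^sup>2)"
      using p(1) by (simp add: prime_imp_coprime)
    then show "p ^ k dvd R" using k unfolding R by (simp add: coprime_dvd_mult_right_iff)
  qed (fact R)
qed

lemma core_full_2:
  assumes "P > 0" "\<forall>p. prime p \<longrightarrow> p dvd P \<longrightarrow> \<not> p dvd N \<longrightarrow> p\<^sup>2 dvd P"
    "C \<subseteq> core N P" "real P \<le> X"
  shows "\<exists>R. P = (\<Prod>C)\<^sup>2 * R \<and> R \<in> full_off 2 N (X / (real (\<Prod>C))\<^sup>2)"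
proof -
  obtain R where R: "P = (\<Prod>C)\<^sup>2 * R" "\<forall>p. prime p \<longrightarrow> p dvd R \<longrightarrow> \<not> p dvd N \<longrightarrow>
            p \<notin> C \<and> (\<forall>k. p ^ k dvd P \<longrightarrow> p ^ k dvd R)"
    using core_divide_square[OF assms(1-3)] by (elim exE conjE) (rule that)
  have pos: "\<Prod>C > 0" "R > 0" using assms(1) R(1) by (auto intro!: Nat.gr0I)
  have "R \<in> full_off 2 N (X / (real (\<Prod>C))\<^sup>2)"
    unfolding full_off_def
  proof (safe)
    have "(real (\<Prod>C))\<^sup>2 * real R \<le> X" using assms(4) unfolding R(1) by simp
    then show "real R \<le> X / (real (\<Prod>C))\<^sup>2" using pos by (simp add: field_simps del: of_nat_prod)
    fix p assume p: "prime p" "p dvd R" "\<not> p dvd N"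
    then have "p dvd P" unfolding R(1) by simp
    then show "p\<^sup>2 dvd R" using R(2)[rule_format, OF p] assms(2) p by blast
  qed (fact pos)
  with R(1) show ?thesis by blast
qed

lemma core_full_3:
  assumes "P > 0" "\<forall>p. prime p \<longrightarrow> p dvd P \<longrightarrow> \<not> p dvd N \<longrightarrow> p\<^sup>2 dvd P" "real P \<le> X"
  shows "\<exists>Q. P = (\<Prod>(core N P))\<^sup>2 * Q \<and> Q \<in> full_off 3 N (X / (real (\<Prod>(core N P)))\<^sup>2)"
proof -
  let ?C = "core N P"
  obtain R where R: "P = (\<Prod>?C)\<^sup>2 * R" "\<forall>p. prime p \<longrightarrow> p dvd R \<longrightarrow> \<not> p dvd N \<longrightarrow>
            p \<notin> ?C \<and> (\<forall>k. p ^ k dvd P \<longrightarrow> p ^ k dvd R)"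
    using core_divide_square[OF assms(1,2) order.refl] by (elim exE conjE) (rule that)
  have pos: "\<Prod>?C > 0" "R > 0" using assms(1) R(1) by (auto intro!: Nat.gr0I)
  have "R \<in> full_off 3 N (X / (real (\<Prod>?C))\<^sup>2)"
    unfolding full_off_def
  proof (safe)
    have "real P \<le> X" by fact
    then have "(real (\<Prod>?C))\<^sup>2 * real R \<le> X" by (subst (asm) R(1)) simp
    then show "real R \<le> X / (real (\<Prod>?C))\<^sup>2" using pos by (simp add: field_simps del: of_nat_prod)
    fix p assume p: "prime p" "p dvd R" "\<not> p dvd N"
    then have "p dvd P" by (subst R(1)) simp
    then have "p ^ 3 dvd P" using R(2)[rule_format, OF p] p by (simp add: core_def)
    then show "p ^ 3 dvd R" using R(2)[rule_format, OF p] by blast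
  qed (fact pos)
  with R(1) show ?thesis by blast
qed

text \<open>A telescoping form of the comparison with the integral: if a and b are the cube roots of
  m + 1 and m, then 1 = a^3 - b^3 <= 3 (a - b) a^2.\<close>

lemma sum_powr_two_thirds_le:
  "(\<Sum>T=1..m. real T powr (-2/3)) \<le> 3 * real m powr (1/3)"
proof (induction m)
  case (Suc m)
  define a where "a = real (Suc m) powr (1/3)"
  define b where "b = real m powr (1/3)"
  have a: "a > 0" and b: "b \<ge> 0" and ba: "b \<le> a"
    by (auto simp: a_def b_def intro!: powr_mono2)
  have a3: "a ^ 3 = real (Suc m)" unfolding a_def
    using a by (simp add: powr_realpow[symmetric] powr_powr del: of_nat_Suc)
  have b3: "b ^ 3 = real m"
    unfolding b_def by (cases "m = 0") (simp_all add: powr_realpow[symmetric] powr_powr)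
  have a2: "real (Suc m) powr (-2/3) = 1 / a\<^sup>2" unfolding a_def
    by (simp add: powr_realpow[symmetric] powr_powr powr_minus_divide[symmetric] del: of_nat_Suc)
  have "1 = (a - b) * (a\<^sup>2 + a * b + b\<^sup>2)" using a3 b3 by (simp add: algebra_simps power2_eq_square power3_eq_cube)
  also have "\<dots> \<le> (a - b) * (a\<^sup>2 + a * a + a\<^sup>2)"
    using a b ba by (intro mult_left_mono add_mono power_mono) auto
  also have "\<dots> = 3 * (a - b) * a\<^sup>2" by (simp add: power2_eq_square)
  finally have "1 / a\<^sup>2 \<le> 3 * (a - b)" using a by (simp add: field_simps)
  then show ?case using Suc.IH a2 by (simp add: a_def b_def)
qed simp

text \<open>For fixed \<open>T\<close> the cubeful factor has about (X / T^2)^(1/3) values, and the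
  sum of T^(-2/3) over T <= Y is of order Y^(1/3).\<close>

lemma card_tuples_square_cube_le:
  fixes e :: real
  assumes "e > 0"
  shows "\<exists>K>0. \<forall>N X Y. \<forall>I::nat set. finite I \<longrightarrow> card I = n \<longrightarrow> N > 0 \<longrightarrow> X \<ge> 1 \<longrightarrow> Y \<ge> 1 \<longrightarrow>
    real (card {x \<in> PiE I (\<lambda>_. UNIV). \<exists>T Q. absprod I x = T\<^sup>2 * Q \<and> 0 < T \<and> real T \<le> Y \<and>
        Q \<in> full_off 3 N (X / (real T)\<^sup>2)})
      \<le> K * X powr (1 / 3 + e) * Y powr (1 / 3) * real N powr e"
proof -
  obtain K1 where K1: "K1 > 0" "\<And>F X. \<And>I::nat set. finite I \<Longrightarrow> card I = n \<Longrightarrow> finite F \<Longrightarrow>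
      (\<forall>m\<in>F. 0 < m \<and> real m \<le> X) \<Longrightarrow> X \<ge> 0 \<Longrightarrow>
      real (card {x \<in> PiE I (\<lambda>_. UNIV). absprod I x \<in> F}) \<le> K1 * real (card F) * X powr (e/2)"
    using card_tuples_le[of "e/2" n] assms by auto
  obtain K2 where K2: "K2 > 0" "\<And>N X. N > 0 \<Longrightarrow> X \<ge> 0 \<Longrightarrow>
      real (card (full_off 3 N X)) \<le> K2 * X powr (1 / 3 + e/2) * real N powr (e/2)"
    using card_full_off_le[of "e/2" 3] assms by auto
  show ?thesis
  proof (intro exI conjI allI impI)
    show "3 * K1 * K2 > 0" using K1 K2 by simp
    fix N :: nat and X Y :: real and I :: "nat set"
    assume I: "finite I" "card I = n" and N: "N > 0" and X: "X \<ge> 1" and Y: "Y \<ge> 1"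
    define F where "F = (\<Union>T\<in>{1..nat \<lfloor>Y\<rfloor>}. (\<lambda>Q. T\<^sup>2 * Q) ` full_off 3 N (X / (real T)\<^sup>2))"
    have fF: "finite F" unfolding F_def by auto
    have eq: "{x \<in> PiE I (\<lambda>_. UNIV). \<exists>T Q. absprod I x = T\<^sup>2 * Q \<and> 0 < T \<and> real T \<le> Y \<and>
        Q \<in> full_off 3 N (X / (real T)\<^sup>2)} = {x \<in> PiE I (\<lambda>_. UNIV). absprod I x \<in> F}" (is "?L = ?R")
    proof -
      have "0 < T \<and> real T \<le> Y \<longleftrightarrow> T \<in> {1..nat \<lfloor>Y\<rfloor>}" for T
        using Y by (auto simp: le_nat_floor) (metis of_nat_floor order_trans of_nat_le_iff order.trans zero_le_one)
      then show ?thesis unfolding F_def by blast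
    qed
    have t: "real (card (full_off 3 N (X / (real T)\<^sup>2))) \<le>
         K2 * X powr (1 / 3 + e/2) * real N powr (e/2) * real T powr (-2/3)" if T: "T \<in> {1..nat \<lfloor>Y\<rfloor>}" for T
    proof -
      have T1: "real T \<ge> 1" using T by simp
      have "real (card (full_off 3 N (X / (real T)\<^sup>2))) \<le> K2 * (X / (real T)\<^sup>2) powr (1 / 3 + e/2) * real N powr (e/2)"
        using N X by (intro K2(2)) auto
      also have "(X / (real T)\<^sup>2) powr (1 / 3 + e/2) = X powr (1/3 + e/2) * real T powr (- (2/3 + e))"
      proof -
        have "((real T)\<^sup>2) powr (1/3 + e/2) = real T powr (2 * (1/3 + e/2))"
          using T1 by (simp add: powr_powr flip: powr_numeral)
        also have "2 * (1/3 + e/2) = 2/3 + e" by simp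
        finally have T2: "((real T)\<^sup>2) powr (1/3 + e/2) = real T powr (2/3 + e)" .
        have "(X / (real T)\<^sup>2) powr (1 / 3 + e/2) = X powr (1/3 + e/2) / ((real T)\<^sup>2) powr (1/3 + e/2)"
          by (rule powr_divide)
        then show ?thesis unfolding T2 powr_minus by (simp only: divide_inverse)
      qed
      also have "K2 * (X powr (1/3 + e/2) * real T powr (- (2/3 + e))) * real N powr (e/2) \<le>
          K2 * (X powr (1/3 + e/2) * real T powr (-2/3)) * real N powr (e/2)"
        using T1 K2 assms by (intro mult_left_mono mult_right_mono powr_mono) auto
      finally show ?thesis by (simp add: mult_ac)
    qed
    have "card F \<le> (\<Sum>T\<in>{1..nat \<lfloor>Y\<rfloor>}. card ((\<lambda>Q. T\<^sup>2 * Q) ` full_off 3 N (X / (real T)\<^sup>2)))"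
      unfolding F_def by (intro card_UN_le) auto
    also have "\<dots> \<le> (\<Sum>T\<in>{1..nat \<lfloor>Y\<rfloor>}. card (full_off 3 N (X / (real T)\<^sup>2)))"
      by (intro sum_mono card_image_le) auto
    finally have "real (card F) \<le> (\<Sum>T\<in>{1..nat \<lfloor>Y\<rfloor>}. real (card (full_off 3 N (X / (real T)\<^sup>2))))"
      unfolding of_nat_sum[symmetric] of_nat_le_iff .
    also have "\<dots> \<le> (\<Sum>T\<in>{1..nat \<lfloor>Y\<rfloor>}. K2 * X powr (1 / 3 + e/2) * real N powr (e/2) * real T powr (-2/3))"
      by (intro sum_mono t)
    also have "\<dots> = K2 * X powr (1 / 3 + e/2) * real N powr (e/2) * (\<Sum>T\<in>{1..nat \<lfloor>Y\<rfloor>}. real T powr (-2/3))"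
      by (simp only: sum_distrib_left)
    also have "\<dots> \<le> K2 * X powr (1 / 3 + e/2) * real N powr (e/2) * (3 * Y powr (1/3))"
    proof (intro mult_left_mono order.trans[OF sum_powr_two_thirds_le] powr_mono2)
      show "real (nat \<lfloor>Y\<rfloor>) \<le> Y" using Y by simp
    qed (use K2 in auto)
    finally have cF: "real (card F) \<le> K2 * X powr (1 / 3 + e/2) * real N powr (e/2) * (3 * Y powr (1/3))" .
    have "real (card {x \<in> PiE I (\<lambda>_. UNIV). absprod I x \<in> F}) \<le> K1 * real (card F) * X powr (e/2)"
    proof (intro K1(2) I fF ballI)
      fix m assume "m \<in> F"
      then obtain T Q where m: "m = T\<^sup>2 * Q" "T \<ge> 1" "Q \<in> full_off 3 N (X / (real T)\<^sup>2)"
        by (auto simp: F_def)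
      then show "0 < m \<and> real m \<le> X" by (auto simp: full_off_def field_simps)
    qed (use X in auto)
    also have "\<dots> \<le> K1 * (K2 * X powr (1 / 3 + e/2) * real N powr (e/2) * (3 * Y powr (1/3))) * X powr (e/2)"
      using K1 cF by (intro mult_right_mono mult_left_mono) auto
    also have "\<dots> = 3 * K1 * K2 * (X powr (1 / 3 + e/2) * X powr (e/2)) * Y powr (1/3) * real N powr (e/2)"
      by (simp add: mult_ac)
    also have "X powr (1 / 3 + e/2) * X powr (e/2) = X powr (1/3 + e)"
      by (simp add: powr_add[symmetric] add.commute)
    also have "3 * K1 * K2 * X powr (1/3 + e) * Y powr (1/3) * real N powr (e/2) \<le>
       3 * K1 * K2 * X powr (1/3 + e) * Y powr (1/3) * real N powr e"
      using K1 K2 N assms by (intro mult_left_mono powr_mono) auto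
    finally show "real (card {x \<in> PiE I (\<lambda>_. UNIV). \<exists>T Q. absprod I x = T\<^sup>2 * Q \<and> 0 < T \<and> real T \<le> Y \<and>
        Q \<in> full_off 3 N (X / (real T)\<^sup>2)}) \<le> 3 * K1 * K2 * X powr (1 / 3 + e) * Y powr (1 / 3) * real N powr e"
      unfolding eq .
  qed
qed

lemma prod_UN_le:
  fixes S :: "'b \<Rightarrow> nat set"
  assumes "finite B" "\<And>b. b \<in> B \<Longrightarrow> finite (S b) \<and> 0 \<notin> S b"
  shows "\<Prod>(\<Union>b\<in>B. S b) \<le> (\<Prod>b\<in>B. \<Prod>(S b))"
  using assms
proof (induction B rule: finite_induct)
  case (insert b B)
  let ?U = "\<Union>b\<in>B. S b"
  have fin: "finite (S b)" "finite ?U" using insert by auto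
  have "\<Prod>(S b \<inter> ?U) > 0" using insert.prems fin by (intro prod_pos) (auto intro!: Nat.gr0I)
  then have "\<Prod>(S b \<union> ?U) \<le> \<Prod>(S b \<union> ?U) * \<Prod>(S b \<inter> ?U)" by simp
  also have "\<dots> = \<Prod>(S b) * \<Prod>?U" by (rule prod.union_inter[OF fin])
  also have "\<dots> \<le> \<Prod>(S b) * (\<Prod>b\<in>B. \<Prod>(S b))" using insert by (intro mult_left_mono) auto
  finally show ?case using insert.hyps by simp
qed simp

section \<open>Saving for a nonzero right-hand side\<close>

text \<open>\<open>B\<close> stands for an unordered pair of indices. Encoding it as a two-element
  set makes the number of pairs \<open>n choose 2\<close> rather than twice as large, and that
  number becomes an exponent in the saving.\<close>

definition pair_core :: "nat \<Rightarrow> nat set \<Rightarrow> (nat \<Rightarrow> int) \<Rightarrow> nat set \<Rightarrow> nat set" where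
  "pair_core N I x B = {p \<in> core N (absprod I x). \<forall>i\<in>B. int p dvd x i}"

lemma core_subset_pair_core:
  assumes "finite I" "shares_primes_off N I x"
  shows "core N (absprod I x) \<subseteq> (\<Union>B\<in>{B. B \<subseteq> I \<and> card B = 2}. pair_core N I x B)"
proof
  fix p assume p: "p \<in> core N (absprod I x)"
  then have "prime p" "p dvd absprod I x" "\<not> p dvd N" by (auto simp: core_def)
  then obtain i where i: "i \<in> I" "int p dvd x i" using prime_dvd_absprodD[OF assms(1)] by blast
  then obtain j where j: "j \<in> I" "j \<noteq> i" "int p dvd x j"
    using assms(2) \<open>prime p\<close> \<open>\<not> p dvd N\<close> unfolding shares_primes_off_def by blast
  have "{i, j} \<in> {B. B \<subseteq> I \<and> card B = 2}" using i j by auto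
  moreover have "p \<in> pair_core N I x {i, j}" using p i j by (auto simp: pair_core_def)
  ultimately show "p \<in> (\<Union>B\<in>{B. B \<subseteq> I \<and> card B = 2}. pair_core N I x B)" by blast
qed

lemma pair_core_prod_dvd:
  assumes "absprod I x > 0" "i \<in> B"
  shows "int (\<Prod>(pair_core N I x B)) dvd x i"
proof -
  have fin: "finite (pair_core N I x B)"
    by (rule finite_subset[OF _ finite_core[OF assms(1)]]) (auto simp: pair_core_def)
  have "(\<Prod>(pair_core N I x B)) ^ 1 dvd nat \<bar>x i\<bar>"
    using assms(2) by (intro prime_prod_power_dvd[OF fin]) (auto simp: pair_core_def core_def nat_abs_dvd_iff)
  then show ?thesis by simp
qed

text \<open>A pigeonhole argument over pairs: every core prime divides two of the variables, so the
  core product is at most the product of the parts belonging to the \<open>n choose 2\<close>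
  pairs.\<close>

lemma exists_large_pair_core:
  assumes "finite I" "card I = n" "shares_primes_off N I x" "absprod I x > 0"
    "D > 0" "D ^ (n choose 2) < real (\<Prod>(core N (absprod I x)))"
  shows "\<exists>i\<in>I. \<exists>j\<in>I. i \<noteq> j \<and> D \<le> real (\<Prod>(pair_core N I x {i, j}))"
proof (rule ccontr)
  assume neg: "\<not> ?thesis"
  let ?B = "{B. B \<subseteq> I \<and> card B = 2}"
  have finB: "finite ?B" using assms(1) by simp
  have fin: "finite (pair_core N I x B)" for B
    by (rule finite_subset[OF _ finite_core[OF assms(4)]]) (auto simp: pair_core_def)
  have no0: "0 \<notin> pair_core N I x B" for B by (auto simp: pair_core_def core_def)
  have small: "real (\<Prod>(pair_core N I x B)) \<le> D" if B: "B \<in> ?B" for B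
  proof -
    obtain i j where "B = {i, j}" "i \<noteq> j" using B by (auto simp: card_2_iff)
    then show ?thesis using neg B by (auto simp: not_le intro: less_imp_le)
  qed
  have pos: "\<Prod>(\<Union>B\<in>?B. pair_core N I x B) > 0"
    using fin finB no0 by (intro prod_pos) (auto intro!: Nat.gr0I)
  have "\<Prod>(core N (absprod I x)) dvd \<Prod>(\<Union>B\<in>?B. pair_core N I x B)"
    using fin finB by (intro prod_dvd_prod_subset core_subset_pair_core assms) auto
  then have "\<Prod>(core N (absprod I x)) \<le> \<Prod>(\<Union>B\<in>?B. pair_core N I x B)"
    using pos by (rule dvd_imp_le)
  also have "\<dots> \<le> (\<Prod>B\<in>?B. \<Prod>(pair_core N I x B))"
    using fin no0 by (intro prod_UN_le finB) auto
  finally have "real (\<Prod>(core N (absprod I x))) \<le> (\<Prod>B\<in>?B. real (\<Prod>(pair_core N I x B)))"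
    unfolding of_nat_prod[symmetric] of_nat_le_iff .
  also have "\<dots> \<le> (\<Prod>B\<in>?B. D)" using small by (intro prod_mono) (auto intro: prod_nonneg)
  also have "\<dots> = D ^ (n choose 2)" using n_subsets[OF assms(1), of 2] assms(2) by simp
  finally show False using assms(6) by simp
qed

lemma sum_remove2:
  fixes f :: "nat \<Rightarrow> 'a::comm_monoid_add"
  assumes "finite I" "i \<in> I" "j \<in> I" "i \<noteq> j"
  shows "sum f I = (f i + f j) + sum f (I - {i, j})"
proof -
  have "sum f I = f i + sum f (I - {i})" using assms by (simp add: sum.remove)
  also have "sum f (I - {i}) = f j + sum f (I - {i} - {j})" using assms by (intro sum.remove) auto
  also have "I - {i} - {j} = I - {i, j}" by auto
  finally show ?thesis by (simp add: add.assoc)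
qed

text \<open>In a cancelling pair \<open>x i\<close> is free and determines \<open>x j\<close>; the
  other variables solve the equation with the same right-hand side, which therefore stays nonzero if
  it was.\<close>

lemma card_Sol_degenerate_le:
  assumes "finite I" "i \<in> I" "j \<in> I" "i \<noteq> j" "A j \<noteq> 0"
  shows "card {x \<in> Sol I A b H. of_int (A i) / of_int (x i) + of_int (A j) / of_int (x j) = (0::rat)}
    \<le> card (nz H) * card (Sol (I - {i, j}) A b H)" (is "card ?S \<le> _")
proof -
  let ?f = "\<lambda>x. (x i, restrict x (I - {i, j}))"
  have "inj_on ?f ?S"
  proof (rule inj_onI)
    fix x y assume x: "x \<in> ?S" and y: "y \<in> ?S" and eq: "?f x = ?f y"
    have i: "x i = y i" using eq by simp
    have "of_int (A i) / of_int (x i) + of_int (A j) / of_int (x j) =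
          (of_int (A i) / of_int (y i) + of_int (A j) / of_int (y j) :: rat)"
      using x y by simp
    then have "of_int (A j) / of_int (x j) = (of_int (A j) / of_int (y j) :: rat)"
      unfolding i by (metis add_left_cancel)
    moreover have "x j \<noteq> 0" "y j \<noteq> 0" using x y assms Sol_nonzero by blast+
    ultimately have j: "x j = y j" using assms(5) by (simp add: field_simps)
    have "x k = y k" if "k \<in> I" for k
      using eq that i j by (cases "k = i"; cases "k = j") (auto dest!: fun_cong[where x=k])
    then show "x = y" using x y by (intro PiE_ext[of x I "\<lambda>_. nz H" y]) (auto simp: Sol_def)
  qed
  moreover have "?f ` ?S \<subseteq> nz H \<times> Sol (I - {i, j}) A b H"
  proof (rule image_subsetI)
    fix x assume x: "x \<in> ?S"
    have "(\<Sum>k\<in>I - {i, j}. of_int (A k) / of_int (restrict x (I - {i, j}) k)) =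
          (\<Sum>k\<in>I - {i, j}. of_int (A k) / of_int (x k) :: rat)"
      by (intro sum.cong) auto
    also have "\<dots> = b"
      using x sum_remove2[OF assms(1-4), of "\<lambda>k. of_int (A k) / of_int (x k) :: rat"] by (simp add: Sol_def)
    finally show "?f x \<in> nz H \<times> Sol (I - {i, j}) A b H" using x assms(2) by (auto simp: Sol_def)
  qed
  ultimately have "card ?S \<le> card (nz H \<times> Sol (I - {i, j}) A b H)"
    using assms(1) by (intro card_inj_on_le[of ?f]) auto
  then show ?thesis by (simp add: card_cartesian_product)
qed

text \<open>Dividing \<open>x\<^sub>i\<close> and \<open>x\<^sub>j\<close> by their common part \<open>d\<close> loses no information: the equation
  \<open>(A\<^sub>i / y\<^sub>i + A\<^sub>j / y\<^sub>j) / d + \<dots> = b\<close> determines \<open>d\<close>.\<close>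

lemma card_Sol_nondegenerate_le:
  assumes "finite I" "i \<in> I" "j \<in> I" "i \<noteq> j" "N > 0" "D > 0" "H \<ge> 1"
    "\<And>x. x \<in> Sol I A b H \<Longrightarrow> shares_primes_off N I x"
  shows "card {x \<in> Sol I A b H. of_int (A i) / of_int (x i) + of_int (A j) / of_int (x j) \<noteq> (0::rat)
             \<and> D \<le> real (\<Prod>(pair_core N I x {i, j}))}
    \<le> card {y \<in> PiE I (\<lambda>_. UNIV). absprod I y \<in> full_off 2 N (H ^ card I / D\<^sup>2)}" (is "card ?S \<le> card ?T")
proof (rule card_inj_on_le)
  define d where "d x = int (\<Prod>(pair_core N I x {i, j}))" for x
  \<comment> \<open>Dividing both variables by the common part removes its square from the product.
    The image keeps a product that is squareful off \<open>N\<close>, now of size at most H^n / D^2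
    for n variables, and is counted through that product alone.\<close>
  define f where "f x = x(i := x i div d x, j := x j div d x)" for x
  have pos: "absprod I x > 0" if "x \<in> ?S" for x
    using that Sol_nonzero by (intro absprod_pos assms(1)) blast
  have di: "d x dvd x i" "d x dvd x j" if "x \<in> ?S" for x
    unfolding d_def using pair_core_prod_dvd[OF pos[OF that]] by auto
  have d0: "d x > 0" if "x \<in> ?S" for x
    using that assms(6) by (auto simp: d_def simp del: of_nat_prod intro!: Nat.gr0I)
  have nz: "x i \<noteq> 0" "x j \<noteq> 0" if "x \<in> ?S" for x
    using that assms(2,3) Sol_nonzero by blast+
  have fi: "f x i = x i div d x" "f x j = x j div d x" "x i = d x * f x i" "x j = d x * f x j"
    if "x \<in> ?S" for x
    using di[OF that] assms(4) by (auto simp: f_def)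
  have fk: "f x k = x k" if "k \<noteq> i" "k \<noteq> j" for x k using that by (simp add: f_def)
  show "inj_on f ?S"
  proof (rule inj_onI)
    fix x y assume x: "x \<in> ?S" and y: "y \<in> ?S" and eq: "f x = f y"
    \<comment> \<open>\<open>\<kappa>\<close> depends on the image only, and
      \<open>\<kappa> / d\<close> is what the pair contributes to the equation. This contribution is
      nonzero for solutions in the set, so the equation can be solved for the divisor.\<close>
    define \<kappa> where "\<kappa> = (of_int (A i) / of_int (f x i) + of_int (A j) / of_int (f x j) :: rat)"
    define R where "R = (\<Sum>k\<in>I - {i, j}. of_int (A k) / of_int (f x k) :: rat)"
    have e: "of_int (A i) / of_int (z i) + of_int (A j) / of_int (z j) = \<kappa> / of_int (d z)"
       "\<kappa> / of_int (d z) + R = b" if z: "z \<in> ?S" and fz: "f z = f x" for z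
    proof -
      show 1: "of_int (A i) / of_int (z i) + of_int (A j) / of_int (z j) = \<kappa> / of_int (d z)"
        unfolding \<kappa>_def fz[symmetric] using d0[OF z] nz[OF z]
        by (subst fi(3)[OF z], subst fi(4)[OF z]) (simp add: add_divide_distrib divide_divide_eq_left mult.commute)
      have "R = (\<Sum>k\<in>I - {i, j}. of_int (A k) / of_int (z k))"
        unfolding R_def fz[symmetric] by (intro sum.cong) (auto simp: fk)
      then show "\<kappa> / of_int (d z) + R = b"
        using z sum_remove2[OF assms(1-4), of "\<lambda>k. of_int (A k) / of_int (z k) :: rat"] 1 by (simp add: Sol_def)
    qed
    have "\<kappa> / of_int (d x) + R = \<kappa> / of_int (d y) + R" using e(2)[OF x] e(2)[OF y] eq by simp
    then have "\<kappa> / of_int (d x) = \<kappa> / of_int (d y)" by simp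
    moreover have "\<kappa> / of_int (d x) \<noteq> 0" using e(1)[OF x] x by auto
    ultimately have dd: "d x = d y" using d0[OF x] d0[OF y] by (simp add: field_simps)
    have "x k = y k" if "k \<in> I" for k
    proof -
      consider "k = i" | "k = j" | "k \<noteq> i" "k \<noteq> j" by blast
      then show ?thesis
      proof cases
        case 1 then show ?thesis using fi(3)[OF x] fi(3)[OF y] dd eq by simp
      next
        case 2 then show ?thesis using fi(4)[OF x] fi(4)[OF y] dd eq by simp
      next
        case 3 then show ?thesis using fk[OF 3, of x] fk[OF 3, of y] eq by simp
      qed
    qed
    then show "x = y" using x y by (intro PiE_ext[of x I "\<lambda>_. nz H" y]) (auto simp: Sol_def)
  qed
  show "f ` ?S \<subseteq> ?T"
  proof (rule image_subsetI)
    fix x assume x: "x \<in> ?S"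
    define C where "C = pair_core N I x {i, j}"
    have xS: "x \<in> Sol I A b H" using x by simp
    have "absprod I x = nat \<bar>d x * f x i\<bar> * (nat \<bar>d x * f x j\<bar> * absprod (I - {i, j}) x)"
      using absprod_remove2[OF assms(1-4), of x] fi(3,4)[OF x] by simp
    also have "\<dots> = (\<Prod>C)\<^sup>2 * (nat \<bar>f x i\<bar> * (nat \<bar>f x j\<bar> * absprod (I - {i, j}) x))"
      by (simp add: d_def C_def abs_mult nat_mult_distrib power2_eq_square mult_ac del: of_nat_prod)
    also have "absprod (I - {i, j}) x = absprod (I - {i, j}) (f x)"
      unfolding absprod_def by (intro prod.cong) (auto simp: fk)
    also have "nat \<bar>f x i\<bar> * (nat \<bar>f x j\<bar> * absprod (I - {i, j}) (f x)) = absprod I (f x)"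
      by (rule absprod_remove2[OF assms(1-4), symmetric])
    finally have P: "absprod I x = (\<Prod>C)\<^sup>2 * absprod I (f x)" .
    have "\<exists>R. absprod I x = (\<Prod>C)\<^sup>2 * R \<and> R \<in> full_off 2 N (H ^ card I / (real (\<Prod>C))\<^sup>2)"
      using shares_primes_square_dvd[OF assms(1) assms(8)[OF xS]] absprod_Sol_le[OF assms(1) xS] pos[OF x]
      by (intro core_full_2) (auto simp: C_def pair_core_def)
    then obtain R where R: "absprod I x = (\<Prod>C)\<^sup>2 * R" "R \<in> full_off 2 N (H ^ card I / (real (\<Prod>C))\<^sup>2)"
      by blast
    have "\<Prod>C > 0" using d0[OF x] by (simp add: d_def C_def del: of_nat_prod)
    then have "R = absprod I (f x)" using P R(1) by simp
    \<comment> \<open>The size bound coming from \<open>C\<close> varies with \<open>x\<close>;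
      weakening it to \<open>D\<close> gives one target set for all solutions.\<close>
    moreover have "real R \<le> H ^ card I / D\<^sup>2"
    proof -
      have "D \<le> real (\<Prod>C)" using x by (simp add: C_def)
      then have "H ^ card I / (real (\<Prod>C))\<^sup>2 \<le> H ^ card I / D\<^sup>2"
        using assms(6,7) by (intro divide_left_mono power_mono mult_pos_pos zero_less_power) auto
      then show ?thesis using R(2) by (auto simp: full_off_def)
    qed
    ultimately have "absprod I (f x) \<in> full_off 2 N (H ^ card I / D\<^sup>2)"
      using R(2) by (simp add: full_off_def)
    moreover have "f x \<in> PiE I (\<lambda>_. UNIV)"
      using xS assms(2,3) by (auto simp: f_def Sol_def PiE_def extensional_def)
    ultimately show "f x \<in> ?T" by simp
  qed
  show "finite ?T" by (intro finite_tuples assms(1) finite_full_off) (simp add: full_off_def)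
qed

lemma Sol_bound_mono: "Sol_bound n L D c \<Longrightarrow> D' \<subseteq> D \<Longrightarrow> Sol_bound n L D' c"
  unfolding Sol_bound_def by (meson subsetD)

definition saved_exponent :: "nat \<Rightarrow> real" where
  "saved_exponent n = real n / 2 - 1 / (2 * real n - 2)"

text \<open>The hypothesis on \<open>c\<close> prices the cancelling pairs: H choices for one
  variable of the pair and H^c for the remaining \<open>n - 2\<close> variables. The other two cases
  reach the saved exponent without induction.\<close>

lemma Sol_bound_step:
  assumes n: "n \<ge> 4" and IH: "Sol_bound (n - 2) L (- {0}) c" and c: "1 + c \<le> saved_exponent n"
  shows "Sol_bound n L (- {0}) (saved_exponent n)"
  unfolding Sol_bound_def
proof (intro allI impI)
  fix \<epsilon> :: real assume eps: "\<epsilon> > 0"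
  define M where "M = real n + real (n * (L + 1))"
  define e where "e = \<epsilon> / (M + 1)"
  have M: "M \<ge> 0" by (simp add: M_def)
  have e: "e > 0" unfolding e_def using eps M by simp
  have eM: "e * M \<le> \<epsilon>" unfolding e_def using eps M by (simp add: field_simps)
  define s where "s = saved_exponent n"
  obtain K1 where K1: "K1 > 0" "\<And>N X Y. \<And>I::nat set. finite I \<Longrightarrow> card I = n \<Longrightarrow> N > 0 \<Longrightarrow> X \<ge> 1 \<Longrightarrow> Y \<ge> 1 \<Longrightarrow>
    real (card {x \<in> PiE I (\<lambda>_. UNIV). \<exists>T Q. absprod I x = T\<^sup>2 * Q \<and> 0 < T \<and> real T \<le> Y \<and>
        Q \<in> full_off 3 N (X / (real T)\<^sup>2)})
      \<le> K1 * X powr (1 / 3 + e) * Y powr (1 / 3) * real N powr e"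
    using card_tuples_square_cube_le[OF e, of n] by blast
  obtain K2 where K2: "K2 > 0" "\<And>H I A b. H \<ge> 1 \<Longrightarrow> admissible L H I A \<Longrightarrow> card I = n - 2 \<Longrightarrow> b \<in> - {0} \<Longrightarrow>
     real (card (Sol I A b H)) \<le> K2 * H powr (c + \<epsilon>)"
    by (rule Sol_boundE[OF IH eps]) (rule that)
  obtain K3 where K3: "K3 > 0" "\<And>N X. \<And>I::nat set. finite I \<Longrightarrow> card I = n \<Longrightarrow> N > 0 \<Longrightarrow> X \<ge> 0 \<Longrightarrow>
    real (card {x \<in> PiE I (\<lambda>_. UNIV). absprod I x \<in> full_off 2 N X})
      \<le> K3 * X powr (1 / real 2 + e) * real N powr e"
    using card_tuples_full_le[OF e, of 2 n] by auto
  define l where "l = (real L ^ n) powr e"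
  have l: "l \<ge> 0" by (simp add: l_def)
  define K where "K = K1 * l + real (n * n) * (2 * K2 + K3 * l) + 1"
  have K: "K > 0" unfolding K_def using K1 K2 K3 l by (intro add_nonneg_pos add_nonneg_nonneg mult_nonneg_nonneg) auto
  show "\<exists>K>0. \<forall>H\<ge>1. \<forall>I A b. admissible L H I A \<longrightarrow> card I = n \<longrightarrow> b \<in> - {0} \<longrightarrow>
     real (card (Sol I A b H)) \<le> K * H powr (saved_exponent n + \<epsilon>)"
  proof (intro exI conjI allI impI)
    fix H :: real and I A and b :: rat
    assume H: "H \<ge> 1" and adm: "admissible L H I A" and cI: "card I = n" and b: "b \<in> - {0}"
    have fin: "finite I" using adm by (simp add: admissible_def)
    show "real (card (Sol I A b H)) \<le> K * H powr (saved_exponent n + \<epsilon>)"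
    proof (cases "Sol I A b H = {}")
      case True
      then show ?thesis using K by simp
    next
      case False
      obtain N where N: "N > 0" "real N \<le> real L ^ n * H ^ (n * (L + 1))"
        "\<And>x. x \<in> Sol I A b H \<Longrightarrow> shares_primes_off N I x"
        using Sol_modulus[OF adm H cI False] by blast
      have Ne: "real N powr e \<le> l * H powr (e * real (n * (L + 1)))"
        unfolding l_def by (rule modulus_powr_le[OF N(2) H e])
      \<comment> \<open>\<open>D\<close> is the saving aimed at. The pigeonhole argument then forces
        the threshold \<open>Y\<close>, as D^(n choose 2) has exponent n (n - 1) / 2 divided by 2 n
        - 2, which is n / 4.\<close>
      define D where "D = H powr (1 / (2 * real n - 2))"
      define Y where "Y = H powr (real n / 4)"
      have D1: "D \<ge> 1" unfolding D_def using H n by (intro ge_one_powr_ge_zero) auto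
      have Y1: "Y \<ge> 1" unfolding Y_def using H by (intro ge_one_powr_ge_zero) auto
      have ch: "real (n choose 2) = real n * (real n - 1) / 2"
      proof -
        have "even (n * (n - 1))" by (cases n) auto
        then have "2 * (n choose 2) = n * (n - 1)" unfolding choose_two by (rule dvd_mult_div_cancel)
        then have "2 * real (n choose 2) = real (n * (n - 1))" by (metis of_nat_mult of_nat_numeral)
        then show ?thesis using n by (simp add: of_nat_diff)
      qed
      have DY: "D ^ (n choose 2) = Y"
      proof -
        have "D ^ (n choose 2) = D powr real (n choose 2)" using D1 by (simp add: powr_realpow)
        also have "\<dots> = H powr (1 / (2 * real n - 2) * (real n * (real n - 1) / 2))"
          unfolding D_def ch powr_powr ..
        also have "1 / (2 * real n - 2) * (real n * (real n - 1) / 2) = real n / 4"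
          using n by (simp add: field_simps)
        finally show ?thesis by (simp add: Y_def)
      qed
      define S1 where "S1 = {x \<in> PiE I (\<lambda>_. UNIV). \<exists>T Q. absprod I x = T\<^sup>2 * Q \<and> 0 < T \<and> real T \<le> Y \<and>
        Q \<in> full_off 3 N (H ^ n / (real T)\<^sup>2)} \<inter> Sol I A b H"
      define S2 where "S2 i j = {x \<in> Sol I A b H. of_int (A i) / of_int (x i) + of_int (A j) / of_int (x j) = (0::rat)}" for i j
      define S3 where "S3 i j = {x \<in> Sol I A b H. of_int (A i) / of_int (x i) + of_int (A j) / of_int (x j) \<noteq> (0::rat)
             \<and> D \<le> real (\<Prod>(pair_core N I x {i, j}))}" for i j
      have cover: "Sol I A b H \<subseteq> S1 \<union> (\<Union>i\<in>I. \<Union>j\<in>I - {i}. S2 i j \<union> S3 i j)"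
      proof
        fix x assume x: "x \<in> Sol I A b H"
        have pos: "absprod I x > 0" using Sol_nonzero[OF x] by (intro absprod_pos fin)
        show "x \<in> S1 \<union> (\<Union>i\<in>I. \<Union>j\<in>I - {i}. S2 i j \<union> S3 i j)"
        proof (cases "real (\<Prod>(core N (absprod I x))) \<le> Y")
          case True
          have T0: "\<Prod>(core N (absprod I x)) > 0"
            by (intro prod_pos) (auto simp: core_def prime_gt_0_nat)
          have "real (absprod I x) \<le> H ^ n" using absprod_Sol_le[OF fin x] cI by simp
          then obtain Q where "absprod I x = (\<Prod>(core N (absprod I x)))\<^sup>2 * Q"
             "Q \<in> full_off 3 N (H ^ n / (real (\<Prod>(core N (absprod I x))))\<^sup>2)"
            using core_full_3[OF pos, of N "H ^ n"] shares_primes_square_dvd[OF fin N(3)[OF x]] by blast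
          then have "\<exists>T Q. absprod I x = T\<^sup>2 * Q \<and> 0 < T \<and> real T \<le> Y \<and> Q \<in> full_off 3 N (H ^ n / (real T)\<^sup>2)"
            using True T0 by blast
          then have "x \<in> S1" using x by (auto simp: S1_def Sol_def PiE_def)
          then show ?thesis by blast
        next
          case False
          then obtain i j where "i \<in> I" "j \<in> I" "i \<noteq> j" "D \<le> real (\<Prod>(pair_core N I x {i, j}))"
            using exists_large_pair_core[OF fin cI N(3)[OF x] pos, of D] D1 DY by auto
          moreover from this have "x \<in> S2 i j \<union> S3 i j" using x unfolding S2_def S3_def by blast
          ultimately show ?thesis by blast
        qed
      qed
      have finS: "finite S1" "finite (S2 i j)" "finite (S3 i j)" for i j
        using fin by (auto simp: S1_def S2_def S3_def)
      have c1: "real (card S1) \<le> K1 * l * H powr (s + \<epsilon>)"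
      proof -
        have "{x \<in> PiE I (\<lambda>_. UNIV). \<exists>T Q. absprod I x = T\<^sup>2 * Q \<and> 0 < T \<and> real T \<le> Y \<and>
        Q \<in> full_off 3 N (H ^ n / (real T)\<^sup>2)} \<subseteq> {x \<in> PiE I (\<lambda>_. UNIV). absprod I x \<in> {m. 0 < m \<and> real m \<le> H ^ n}}"
          by (auto simp: full_off_def field_simps)
        moreover have "finite {x \<in> PiE I (\<lambda>_. UNIV). absprod I x \<in> {m. 0 < m \<and> real m \<le> H ^ n}}"
          by (intro finite_tuples fin finite_subset[OF _ finite_bounded_nat[of "H ^ n"]]) auto
        ultimately have "card S1 \<le> card {x \<in> PiE I (\<lambda>_. UNIV). \<exists>T Q. absprod I x = T\<^sup>2 * Q \<and> 0 < T \<and> real T \<le> Y \<and>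
           Q \<in> full_off 3 N (H ^ n / (real T)\<^sup>2)}"
          unfolding S1_def by (intro card_mono) (auto intro: finite_subset)
        also have "real \<dots> \<le> K1 * (H ^ n) powr (1 / 3 + e) * Y powr (1 / 3) * real N powr e"
          using H Y1 by (intro K1(2) fin cI N) auto
        also have "\<dots> \<le> K1 * (H ^ n) powr (1 / 3 + e) * Y powr (1 / 3) * (l * H powr (e * real (n * (L + 1))))"
          using K1 Ne by (intro mult_left_mono) auto
        also have "(H ^ n) powr (1 / 3 + e) = H powr (real n * (1 / 3 + e))"
          using H by (simp add: powr_realpow[symmetric] powr_powr)
        also have "Y powr (1 / 3) = H powr (real n / 12)" by (simp add: Y_def powr_powr)
        also have "K1 * H powr (real n * (1 / 3 + e)) * H powr (real n / 12) * (l * H powr (e * real (n * (L + 1))))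
          = K1 * l * H powr (real n * (1 / 3 + e) + real n / 12 + e * real (n * (L + 1)))"
          by (simp add: powr_add del: of_nat_mult)
        also have "\<dots> \<le> K1 * l * H powr (s + \<epsilon>)"
        proof (intro mult_left_mono powr_mono H)
          have "real n * (1 / 3 + e) + real n / 12 + e * real (n * (L + 1)) = 5 * real n / 12 + e * M"
            by (simp add: M_def algebra_simps)
          \<comment> \<open>A core product up to \<open>Y\<close> costs n/3 + n/12 = 5 n/12. This is
            n/12 below n/2 and covers the saving as soon as n (n - 1) >= 6.\<close>
          moreover have "1 / (2 * real n - 2) \<le> real n / 12"
          proof -
            have "6 \<le> real n * (real n - 1)" using n mult_mono[of 4 "real n" 3 "real n - 1"] by auto
            then show ?thesis using n by (simp add: field_simps)
          qed
          ultimately show "real n * (1 / 3 + e) + real n / 12 + e * real (n * (L + 1)) \<le> s + \<epsilon>"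
            using eM by (simp add: s_def saved_exponent_def)
        qed (use K1 l in auto)
        finally show ?thesis by simp
      qed
      have c2: "real (card (S2 i j)) \<le> 2 * K2 * H powr (s + \<epsilon>)" if ij: "i \<in> I" "j \<in> I - {i}" for i j
      proof -
        have Aj: "A j \<noteq> 0" using adm ij by (auto simp: admissible_def)
        have c2': "card (I - {i, j}) = n - 2" using ij cI fin by (simp add: card_Diff_subset)
        have adm': "admissible L H (I - {i, j}) A" using admissible_subset[OF adm] by blast
        have "card (S2 i j) \<le> card (nz H) * card (Sol (I - {i, j}) A b H)"
          unfolding S2_def using ij by (intro card_Sol_degenerate_le fin Aj) auto
        then have "real (card (S2 i j)) \<le> real (card (nz H)) * real (card (Sol (I - {i, j}) A b H))"
          unfolding of_nat_mult[symmetric] of_nat_le_iff .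
        also have "\<dots> \<le> (2 * H) * (K2 * H powr (c + \<epsilon>))"
          using card_nz_le[of H] K2(2)[OF H adm' c2' b] H by (intro mult_mono) auto
        also have "\<dots> = 2 * K2 * H powr (1 + (c + \<epsilon>))" using H by (simp add: powr_add)
        also have "\<dots> \<le> 2 * K2 * H powr (s + \<epsilon>)"
          using c H K2 by (intro mult_left_mono powr_mono) (auto simp: s_def)
        finally show ?thesis .
      qed
      have c3: "real (card (S3 i j)) \<le> K3 * l * H powr (s + \<epsilon>)" if ij: "i \<in> I" "j \<in> I - {i}" for i j
      proof -
        have D0: "D > 0" using D1 by simp
        have "card (S3 i j) \<le> card {y \<in> PiE I (\<lambda>_. UNIV). absprod I y \<in> full_off 2 N (H ^ card I / D\<^sup>2)}"
          unfolding S3_def using ij by (intro card_Sol_nondegenerate_le fin N D0 H) auto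
        also have "real \<dots> \<le> K3 * (H ^ card I / D\<^sup>2) powr (1 / real 2 + e) * real N powr e"
          using H by (intro K3(2) fin cI N) auto
        also have "\<dots> \<le> K3 * H powr (real n / 2 - 1 / (2 * real n - 2) + e * real n) * (l * H powr (e * real (n * (L + 1))))"
        proof (intro mult_mono Ne mult_left_mono)
          \<comment> \<open>The square root of H^n / D^2 is H^(n/2) / D, so the full factor
            \<open>D\<close> is saved.\<close>
          have "H ^ card I / D\<^sup>2 = H powr (real n - 2 * (1 / (2 * real n - 2)))"
            using H by (simp add: cI D_def powr_diff powr_realpow[symmetric] powr_powr mult.commute)
          then have "(H ^ card I / D\<^sup>2) powr (1 / real 2 + e) =
              H powr ((real n - 2 * (1 / (2 * real n - 2))) * (1 / 2 + e))"
            by (simp add: powr_powr)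
          also have "\<dots> \<le> H powr (real n / 2 - 1 / (2 * real n - 2) + e * real n)"
          proof (intro powr_mono H)
            define t where "t = 1 / (2 * real n - 2)"
            have "t \<ge> 0" using n by (simp add: t_def)
            then have "e * t \<ge> 0" using e by simp
            then have "(real n - 2 * t) * (1 / 2 + e) \<le> real n / 2 - t + e * real n"
              by (simp add: algebra_simps)
            then show "(real n - 2 * (1 / (2 * real n - 2))) * (1 / 2 + e)
               \<le> real n / 2 - 1 / (2 * real n - 2) + e * real n" by (simp add: t_def)
          qed
          finally show "(H ^ card I / D\<^sup>2) powr (1 / real 2 + e) \<le>
             H powr (real n / 2 - 1 / (2 * real n - 2) + e * real n)" .
        qed (use K3 in auto)
        also have "\<dots> = K3 * l * H powr (s + e * M)"
          by (simp add: powr_add[symmetric] s_def saved_exponent_def M_def algebra_simps del: of_nat_mult of_nat_add)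
        also have "\<dots> \<le> K3 * l * H powr (s + \<epsilon>)"
          using eM H K3 l by (intro mult_left_mono powr_mono) auto
        finally show ?thesis by simp
      qed
      have "card (Sol I A b H) \<le> card S1 + (\<Sum>i\<in>I. \<Sum>j\<in>I - {i}. card (S2 i j) + card (S3 i j))"
      proof -
        have "card (\<Union>i\<in>I. \<Union>j\<in>I - {i}. S2 i j \<union> S3 i j) \<le> (\<Sum>i\<in>I. \<Sum>j\<in>I - {i}. card (S2 i j) + card (S3 i j))"
          using fin by (intro order.trans[OF card_UN_le] sum_mono card_Un_le) auto
        moreover have "card (Sol I A b H) \<le> card S1 + card (\<Union>i\<in>I. \<Union>j\<in>I - {i}. S2 i j \<union> S3 i j)"
          using fin finS by (intro order.trans[OF card_mono[OF _ cover] card_Un_le]) auto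
        ultimately show ?thesis by linarith
      qed
      then have "real (card (Sol I A b H)) \<le> real (card S1 + (\<Sum>i\<in>I. \<Sum>j\<in>I - {i}. card (S2 i j) + card (S3 i j)))"
        unfolding of_nat_le_iff .
      also have "\<dots> = real (card S1) + (\<Sum>i\<in>I. \<Sum>j\<in>I - {i}. real (card (S2 i j)) + real (card (S3 i j)))"
        by simp
      also have "\<dots> \<le> K1 * l * H powr (s + \<epsilon>) + (\<Sum>i\<in>I. \<Sum>j\<in>I - {i}. 2 * K2 * H powr (s + \<epsilon>) + K3 * l * H powr (s + \<epsilon>))"
        using c1 c2 c3 by (intro add_mono sum_mono)
      also have "\<dots> \<le> K1 * l * H powr (s + \<epsilon>) + (\<Sum>i\<in>I. \<Sum>j\<in>I. 2 * K2 * H powr (s + \<epsilon>) + K3 * l * H powr (s + \<epsilon>))"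
        using fin K2 K3 l by (intro add_left_mono sum_mono sum_mono2) auto
      also have "\<dots> = (K1 * l + real (n * n) * (2 * K2 + K3 * l)) * H powr (s + \<epsilon>)"
        by (simp add: cI algebra_simps)
      also have "\<dots> \<le> K * H powr (s + \<epsilon>)" by (intro mult_right_mono) (auto simp: K_def)
      finally show ?thesis by (simp add: s_def)
    qed
  qed (fact K)
qed

text \<open>Cancelling pairs remove two variables, so the induction has two starting points: n = 4
  rests on two variables with exponent 0 and n = 5 on three variables with exponent 1. Afterwards
  the step is allowed because n/2 grows by exactly 1 from n - 2 to n while the saving
  decreases.\<close>

lemma Sol_bound_saved: "n \<ge> 4 \<Longrightarrow> Sol_bound n L (- {0}) (saved_exponent n)"
proof (induction n rule: less_induct)
  case (less n)
  consider "n = 4" | "n = 5" | "n \<ge> 6" using less.prems by linarith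
  then show ?case
  proof cases
    case 1
    then show ?thesis using Sol_bound_2[of L]
      by (intro Sol_bound_step[where c = 0]) (auto simp: saved_exponent_def)
  next
    case 2
    have "Sol_bound 3 L (- {0}) 1" using Sol_bound_3[of L] by (rule Sol_bound_mono) simp
    then show ?thesis using 2
      by (intro Sol_bound_step[where c = 1]) (auto simp: saved_exponent_def)
  next
    case 3
    show ?thesis
    proof (rule Sol_bound_step[where c = "saved_exponent (n - 2)"])
      show "Sol_bound (n - 2) L (- {0}) (saved_exponent (n - 2))" using 3 by (intro less.IH) auto
      have "1 / (2 * real n - 2) \<le> 1 / (2 * real (n - 2) - 2)"
        using 3 by (intro divide_left_mono) (auto simp: of_nat_diff)
      then show "1 + saved_exponent (n - 2) \<le> saved_exponent n"
        using 3 by (simp add: saved_exponent_def of_nat_diff field_simps)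
    qed (use 3 in auto)
  qed
qed

section \<open>Relations between the rows of a singular matrix\<close>

text \<open>The minor of \<open>E\<close> on rows \<open>f\<close> and columns \<open>g\<close>.
  Repeated columns are allowed in the selection; they merely make the minor zero.\<close>

definition sub_det :: "nat \<Rightarrow> (nat \<Rightarrow> nat) \<Rightarrow> (nat \<Rightarrow> nat) \<Rightarrow> (nat \<Rightarrow> nat \<Rightarrow> rat) \<Rightarrow> rat" where
  "sub_det s f g E = det (mat s s (\<lambda>(i, j). E (f i) (g j)))"

text \<open>The cofactor at row \<open>k\<close> of the last column of a \<open>t\<close> by
  \<open>t\<close> matrix on the rows \<open>f\<close>. It sees only the first \<open>t - 1\<close>
  columns, so \<open>g\<close> matters only below \<open>t - 1\<close>.\<close>

definition kernel_coeff :: "nat \<Rightarrow> (nat \<Rightarrow> nat) \<Rightarrow> (nat \<Rightarrow> nat) \<Rightarrow> (nat \<Rightarrow> nat \<Rightarrow> rat) \<Rightarrow> nat \<Rightarrow> rat" where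
  "kernel_coeff t f g E k = (-1) ^ (k + (t - 1)) * sub_det (t - 1) (f \<circ> insert_index k) g E"

lemma det_zero_iff_left_kernel:
  fixes B :: "nat \<Rightarrow> nat \<Rightarrow> rat"
  shows "det (mat t t (\<lambda>(i, j). B i j)) = 0 \<longleftrightarrow>
    (\<exists>c. (\<exists>i<t. c i \<noteq> 0) \<and> (\<forall>j<t. (\<Sum>i<t. c i * B i j) = 0))"
proof -
  define M where "M = mat t t (\<lambda>(i, j). B i j)"
  have M: "M \<in> carrier_mat t t" "M\<^sup>T \<in> carrier_mat t t" by (auto simp: M_def)
  have prod: "M\<^sup>T *\<^sub>v v = 0\<^sub>v t \<longleftrightarrow> (\<forall>j<t. (\<Sum>i<t. v $ i * B i j) = 0)" if v: "v \<in> carrier_vec t" for v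
  proof -
    have "(M\<^sup>T *\<^sub>v v) $ j = (\<Sum>i<t. v $ i * B i j)" if "j < t" for j
      using that v by (simp add: M_def scalar_prod_def mult.commute lessThan_atLeast0)
    moreover have "dim_vec (M\<^sup>T *\<^sub>v v) = t" by (simp add: M_def)
    ultimately show ?thesis by (auto simp: vec_eq_iff)
  qed
  have nz: "v \<noteq> 0\<^sub>v t \<longleftrightarrow> (\<exists>i<t. v $ i \<noteq> 0)" if v: "v \<in> carrier_vec t" for v
    using v by (auto simp: vec_eq_iff)
  have "det M = 0 \<longleftrightarrow> (\<exists>v. v \<in> carrier_vec t \<and> v \<noteq> 0\<^sub>v t \<and> M\<^sup>T *\<^sub>v v = 0\<^sub>v t)"
    using det_0_iff_vec_prod_zero[OF M(2)] det_transpose[OF M(1)] by simp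
  also have "\<dots> \<longleftrightarrow> (\<exists>c. (\<exists>i<t. c i \<noteq> 0) \<and> (\<forall>j<t. (\<Sum>i<t. c i * B i j) = 0))" (is "?l = ?r")
  proof
    assume ?l
    then obtain v where "v \<in> carrier_vec t" "\<exists>i<t. v $ i \<noteq> 0" "\<forall>j<t. (\<Sum>i<t. v $ i * B i j) = 0"
      using nz prod by blast
    then show ?r by (intro exI[of _ "\<lambda>i. v $ i"]) simp
  next
    assume ?r
    then obtain c where c: "\<exists>i<t. c i \<noteq> 0" "\<forall>j<t. (\<Sum>i<t. c i * B i j) = 0" by blast
    have v: "vec t c \<in> carrier_vec t" by simp
    have "vec t c \<noteq> 0\<^sub>v t" unfolding nz[OF v] using c(1) by auto
    moreover have "M\<^sup>T *\<^sub>v vec t c = 0\<^sub>v t" unfolding prod[OF v] using c(2) by simp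
    moreover note v
    ultimately have "vec t c \<in> carrier_vec t" "vec t c \<noteq> 0\<^sub>v t" "M\<^sup>T *\<^sub>v vec t c = 0\<^sub>v t" by auto
    then show ?l by blast
  qed
  finally show ?thesis by (simp add: M_def)
qed

lemma sum_insert_index:
  fixes h :: "nat \<Rightarrow> rat"
  assumes "k < t"
  shows "(\<Sum>i<t. h i) = h k + (\<Sum>i<t - 1. h (insert_index k i))"
proof -
  obtain s where s: "t = Suc s" using assms by (cases t) auto
  have im: "insert_index k ` {..<s} = {..<t} - {k}"
    using insert_index_image[of k s] assms s by (simp add: lessThan_atLeast0)
  have inj: "inj_on (insert_index k) {..<s}"
    by (rule inj_on_inverseI[of _ "delete_index k"]) simp
  have "(\<Sum>i<t. h i) = h k + (\<Sum>i\<in>{..<t} - {k}. h i)" using assms by (intro sum.remove) auto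
  also have "(\<Sum>i\<in>{..<t} - {k}. h i) = (\<Sum>i<s. h (insert_index k i))"
    unfolding im[symmetric] by (simp add: sum.reindex[OF inj])
  finally show ?thesis by (simp add: s)
qed

text \<open>The coefficients do not depend on the column \<open>l\<close> put in last place, so one
  list of cofactors serves all columns at once. Vanishing minors thus turn into a relation between
  entire rows.\<close>

lemma sub_det_expand_last:
  assumes "t > 0"
  shows "sub_det t f (g(t - 1 := l)) E = (\<Sum>k<t. kernel_coeff t f g E k * E (f k) l)"
proof -
  define M where "M = mat t t (\<lambda>(i, j). E (f i) ((g(t - 1 := l)) j))"
  have M: "M \<in> carrier_mat t t" by (simp add: M_def)
  have "det M = (\<Sum>k<t. M $$ (k, t - 1) * cofactor M k (t - 1))"
    using assms by (intro laplace_expansion_column[OF M]) auto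
  also have "\<dots> = (\<Sum>k<t. kernel_coeff t f g E k * E (f k) l)"
  proof (intro sum.cong refl)
    fix k assume k: "k \<in> {..<t}"
    have "mat_delete M k (t - 1) = mat (t - 1) (t - 1) (\<lambda>(i, j). E ((f \<circ> insert_index k) i) (g j))"
      by (rule eq_matI) (auto simp: mat_delete_def M_def insert_index_def)
    then have "cofactor M k (t - 1) = kernel_coeff t f g E k"
      by (simp add: cofactor_def kernel_coeff_def sub_det_def)
    moreover have "M $$ (k, t - 1) = E (f k) l" using k assms by (simp add: M_def)
    ultimately show "M $$ (k, t - 1) * cofactor M k (t - 1) = kernel_coeff t f g E k * E (f k) l"
      by (simp add: mult.commute)
  qed
  finally show ?thesis by (simp add: sub_det_def M_def)
qed

text \<open>A minimal dependent set of \<open>t\<close> rows: minimality makes the first \<open>t - 1\<close> rows independent, so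
  some \<open>t - 1\<close> columns \<open>g\<close> give a nonzero minor, and the cofactors along \<open>g\<close> form a relation
  between the \<open>t\<close> rows, none of whose coefficients vanishes, again by minimality.\<close>

lemma singular_relation:
  fixes E :: "nat \<Rightarrow> nat \<Rightarrow> rat"
  assumes "det (mat n n (\<lambda>(i, j). E i j)) = 0" "\<And>i j. i < n \<Longrightarrow> j < n \<Longrightarrow> E i j \<noteq> 0"
  shows "\<exists>t f g. 2 \<le> t \<and> t \<le> n \<and> inj_on f {..<t} \<and> f ` {..<t} \<subseteq> {..<n} \<and> g ` {..<t - 1} \<subseteq> {..<n} \<and>
    (\<forall>k<t. kernel_coeff t f g E k \<noteq> 0) \<and>
    (\<forall>l<n. (\<Sum>k<t. kernel_coeff t f g E k * E (f k) l) = 0)"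
proof -
  \<comment> \<open>Dependence is phrased through minors rather than through relations, so that its
    failure for fewer rows immediately supplies the columns \<open>g\<close> of a nonzero
    minor.\<close>
  define dep where "dep t f \<longleftrightarrow> inj_on f {..<t} \<and> f ` {..<t} \<subseteq> {..<n} \<and>
     (\<forall>g. g ` {..<t} \<subseteq> {..<n} \<longrightarrow> sub_det t f g E = 0)" for t f
  have depI: "dep t f" if "inj_on f {..<t}" "f ` {..<t} \<subseteq> {..<n}" "\<exists>i<t. c i \<noteq> 0"
    "\<forall>l<n. (\<Sum>i<t. c i * E (f i) l) = 0" for t f c
    unfolding dep_def sub_det_def
  proof (intro conjI that allI impI)
    fix g :: "nat \<Rightarrow> nat" assume g: "g ` {..<t} \<subseteq> {..<n}"
    show "det (mat t t (\<lambda>(i, j). E (f i) (g j))) = 0"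
      using that(3,4) g det_zero_iff_left_kernel[of t "\<lambda>i j. E (f i) (g j)"] by blast
  qed
  obtain c where "\<exists>i<n. c i \<noteq> 0" "\<forall>j<n. (\<Sum>i<n. c i * E i j) = 0"
    using assms(1) det_zero_iff_left_kernel[of n E] by blast
  then have depn: "\<exists>f. dep n f" using depI[of id n c] by auto
  define t where "t = (LEAST t. \<exists>f. dep t f)"
  obtain f where f: "dep t f" using LeastI_ex[of "\<lambda>t. \<exists>f. dep t f"] depn unfolding t_def by blast
  have tn: "t \<le> n" unfolding t_def using depn by (rule Least_le)
  have least: "\<not> dep s f'" if "s < t" for s f'
    using not_less_Least[of s "\<lambda>t. \<exists>f. dep t f"] that unfolding t_def by blast
  have inj: "inj_on f {..<t}" and fn: "f ` {..<t} \<subseteq> {..<n}" using f by (auto simp: dep_def)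
  \<comment> \<open>The empty determinant is 1, so the empty family is not dependent.\<close>
  have t0: "t \<noteq> 0"
  proof
    assume "t = 0"
    then have "sub_det 0 f id E = 0" using f by (simp add: dep_def)
    then show False by (simp add: sub_det_def)
  qed
  \<comment> \<open>A single dependent row would be zero; the entries, however, are nonzero.\<close>
  have t1: "t \<noteq> 1"
  proof
    assume t: "t = 1"
    then have f0: "f 0 < n" using fn by auto
    have "sub_det 1 f (\<lambda>_. f 0) E = 0" using f t f0 by (simp add: dep_def)
    moreover have "sub_det 1 f (\<lambda>_. f 0) E = E (f 0) (f 0)"
      unfolding sub_det_def by (subst det_single) auto
    ultimately show False using assms(2)[OF f0 f0] by simp
  qed
  have "\<not> dep (t - 1) f" using t0 by (intro least) auto
  moreover have "inj_on f {..<t - 1}" using inj by (rule inj_on_subset) auto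
  moreover have "f ` {..<t - 1} \<subseteq> {..<n}" using fn by (auto simp: image_subset_iff)
  ultimately have "\<not> (\<forall>g. g ` {..<t - 1} \<subseteq> {..<n} \<longrightarrow> sub_det (t - 1) f g E = 0)"
    unfolding dep_def by simp
  then obtain g where g: "g ` {..<t - 1} \<subseteq> {..<n}" "sub_det (t - 1) f g E \<noteq> 0" by blast
  have rel: "(\<Sum>k<t. kernel_coeff t f g E k * E (f k) l) = 0" if l: "l < n" for l
  proof -
    have "(g(t - 1 := l)) ` {..<t} \<subseteq> {..<n}"
    proof (rule image_subsetI)
      fix j assume "j \<in> {..<t}"
      then have "j = t - 1 \<or> j \<in> {..<t - 1}" using t0 by auto
      then show "(g(t - 1 := l)) j \<in> {..<n}" using g(1) l by auto
    qed
    then have "sub_det t f (g(t - 1 := l)) E = 0" using f by (simp add: dep_def)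
    then show ?thesis using sub_det_expand_last[of t f g l E] t0 by simp
  qed
  have last: "kernel_coeff t f g E (t - 1) \<noteq> 0"
  proof -
    have "mat (t - 1) (t - 1) (\<lambda>(i, j). E ((f \<circ> insert_index (t - 1)) i) (g j)) =
          mat (t - 1) (t - 1) (\<lambda>(i, j). E (f i) (g j))"
      by (rule eq_matI) auto
    then show ?thesis using g(2) by (simp add: kernel_coeff_def sub_det_def)
  qed
  have nz: "kernel_coeff t f g E k \<noteq> 0" if k: "k < t" for k
  proof
    assume 0: "kernel_coeff t f g E k = 0"
    then have kt: "k < t - 1" using last k by (cases "k = t - 1") auto
    have ins: "insert_index k i < t" if "i < t - 1" for i using that by (auto simp: insert_index_def)
    have "dep (t - 1) (f \<circ> insert_index k)"
    proof (rule depI[where c = "\<lambda>i. kernel_coeff t f g E (insert_index k i)"])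
      have "inj_on (insert_index k) {..<t - 1}"
        by (rule inj_on_inverseI[of _ "delete_index k"]) simp
      then show "inj_on (f \<circ> insert_index k) {..<t - 1}"
        using ins by (intro comp_inj_on inj_on_subset[OF inj]) auto
      show "(f \<circ> insert_index k) ` {..<t - 1} \<subseteq> {..<n}" using fn ins by auto
      \<comment> \<open>After deletion of a row \<open>k < t - 1\<close>, the old last row, whose
        coefficient is nonzero, sits at position \<open>t - 2\<close>; this makes the shorter
        relation nontrivial.\<close>
      have "insert_index k (t - 2) = t - 1" "t - 2 < t - 1" using kt by auto
      then show "\<exists>i<t - 1. kernel_coeff t f g E (insert_index k i) \<noteq> 0" using last by metis
      show "\<forall>l<n. (\<Sum>i<t - 1. kernel_coeff t f g E (insert_index k i) * E ((f \<circ> insert_index k) i) l) = 0"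
      proof (intro allI impI)
        fix l assume "l < n"
        then show "(\<Sum>i<t - 1. kernel_coeff t f g E (insert_index k i) * E ((f \<circ> insert_index k) i) l) = 0"
          using rel[of l] sum_insert_index[OF k, of "\<lambda>k. kernel_coeff t f g E k * E (f k) l"] 0 by simp
      qed
    qed
    then show False using least[of "t - 1"] t0 by simp
  qed
  show ?thesis using t0 t1 tn inj fn g(1) nz rel by (intro exI[of _ t] exI[of _ f] exI[of _ g]) auto
qed

text \<open>A Leibniz term takes one entry from each row. As \<open>\<phi>\<close> separates the
  rows, its denominators sit at distinct positions of \<open>Z\<close>, and their product divides
  the product over \<open>Z\<close>. Columns are not separated, in keeping with selections that may
  repeat them. Each of the \<open>fact s\<close> terms has absolute value at most 1.\<close>

lemma minor_scaled_int:
  fixes a :: "'z \<Rightarrow> int"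
  assumes "finite Z" "\<And>i j. i < s \<Longrightarrow> j < s \<Longrightarrow> \<phi> i j \<in> Z"
    "\<And>i j i' j'. i < s \<Longrightarrow> i' < s \<Longrightarrow> \<phi> i j = \<phi> i' j' \<Longrightarrow> i = i'"
    "\<And>z. z \<in> Z \<Longrightarrow> a z \<noteq> 0"
  shows "of_int (\<Prod>z\<in>Z. a z) * det (mat s s (\<lambda>(i, j). 1 / of_int (a (\<phi> i j)))) \<in> (\<int> :: rat set)"
    and "\<bar>det (mat s s (\<lambda>(i, j). 1 / of_int (a (\<phi> i j))))\<bar> \<le> (of_nat (fact s) :: rat)"
proof -
  define P where "P = {p. p permutes {0..<s}}"
  define T where "T p = (\<Prod>i = 0..<s. 1 / of_int (a (\<phi> i (p i))) :: rat)" for p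
  have det: "det (mat s s (\<lambda>(i, j). 1 / of_int (a (\<phi> i j)))) = (\<Sum>p\<in>P. signof p * T p)"
  proof (subst det_def'[of _ s])
    show "(\<Sum>p | p permutes {0..<s}. signof p * (\<Prod>i = 0..<s. mat s s (\<lambda>(i, j). 1 / of_int (a (\<phi> i j))) $$ (i, p i))) =
      (\<Sum>p\<in>P. signof p * T p)"
      unfolding P_def T_def
    proof (intro sum.cong refl arg_cong2[of _ _ _ _ "(*)"] prod.cong)
      fix p i assume "p \<in> {p. p permutes {0..<s}}" "i \<in> {0..<s}"
      then have "i < s" "p i < s" using permutes_in_image[of p "{0..<s}" i] by auto
      then show "mat s s (\<lambda>(i, j). 1 / of_int (a (\<phi> i j))) $$ (i, p i) = (1 / of_int (a (\<phi> i (p i))) :: rat)"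
        by simp
    qed
  qed simp
  have mem: "\<phi> i (p i) \<in> Z" if "p \<in> P" "i < s" for p i
    using that permutes_in_image[of p "{0..<s}" i] by (intro assms(2)) (auto simp: P_def)
  have "of_int (\<Prod>z\<in>Z. a z) * T p \<in> (\<int> :: rat set)" if p: "p \<in> P" for p
  proof -
    let ?W = "(\<lambda>i. \<phi> i (p i)) ` {0..<s}"
    have W: "?W \<subseteq> Z" using mem[OF p] by auto
    have inj: "inj_on (\<lambda>i. \<phi> i (p i)) {0..<s}"
    proof (rule inj_onI)
      fix i j assume "i \<in> {0..<s}" "j \<in> {0..<s}" "\<phi> i (p i) = \<phi> j (p j)"
      then show "i = j" using assms(3)[of i j "p i" "p j"] by simp
    qed
    have "(\<Prod>z\<in>Z. a z) = (\<Prod>z\<in>Z - ?W. a z) * (\<Prod>z\<in>?W. a z)"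
      by (rule prod.subset_diff[OF W assms(1)])
    also have "(\<Prod>z\<in>?W. a z) = (\<Prod>i = 0..<s. a (\<phi> i (p i)))" by (simp add: prod.reindex[OF inj])
    finally have "of_int (\<Prod>z\<in>Z. a z) * T p =
      of_int (\<Prod>z\<in>Z - ?W. a z) * ((\<Prod>i = 0..<s. of_int (a (\<phi> i (p i)))) * (\<Prod>i = 0..<s. 1 / of_int (a (\<phi> i (p i)))) :: rat)"
      by (simp add: T_def)
    also have "(\<Prod>i = 0..<s. of_int (a (\<phi> i (p i)))) * (\<Prod>i = 0..<s. 1 / of_int (a (\<phi> i (p i)))) = (1 :: rat)"
      unfolding prod.distrib[symmetric] using mem[OF p] assms(4) by (intro prod.neutral) auto
    finally have "of_int (\<Prod>z\<in>Z. a z) * T p = (of_int (\<Prod>z\<in>Z - ?W. a z) :: rat)" by simp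
    then show ?thesis by (metis Ints_of_int)
  qed
  then show "of_int (\<Prod>z\<in>Z. a z) * det (mat s s (\<lambda>(i, j). 1 / of_int (a (\<phi> i j)))) \<in> (\<int> :: rat set)"
    unfolding det sum_distrib_left
  proof (intro Ints_sum)
    fix p assume "p \<in> P" and *: "\<And>p. p \<in> P \<Longrightarrow> of_int (\<Prod>z\<in>Z. a z) * T p \<in> (\<int> :: rat set)"
    have "signof p \<in> (\<int> :: rat set)" by (auto simp: sign_def)
    then have "signof p * (of_int (\<Prod>z\<in>Z. a z) * T p) \<in> (\<int> :: rat set)"
      by (rule Ints_mult[OF _ *[OF \<open>p \<in> P\<close>]])
    then show "of_int (\<Prod>z\<in>Z. a z) * (signof p * T p) \<in> (\<int> :: rat set)" by (simp add: mult_ac)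
  qed
  have "\<bar>T p\<bar> \<le> 1" if p: "p \<in> P" for p
  proof -
    have "\<bar>T p\<bar> = (\<Prod>i = 0..<s. \<bar>1 / of_int (a (\<phi> i (p i)))\<bar>)" unfolding T_def by (rule abs_prod)
    also have "\<dots> \<le> (\<Prod>i = 0..<s. 1)"
    proof (intro prod_mono conjI)
      fix i assume "i \<in> {0..<s}"
      then have "a (\<phi> i (p i)) \<noteq> 0" using mem[OF p] assms(4) by auto
      then have "1 \<le> \<bar>a (\<phi> i (p i))\<bar>" by linarith
      then have "(1 :: rat) \<le> of_int \<bar>a (\<phi> i (p i))\<bar>" by linarith
      then show "\<bar>1 / of_int (a (\<phi> i (p i)))\<bar> \<le> (1 :: rat)" by (simp add: divide_le_eq_1)
    qed auto
    finally show ?thesis by simp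
  qed
  then have "\<bar>\<Sum>p\<in>P. signof p * T p\<bar> \<le> (\<Sum>p\<in>P. (1 :: rat))"
    by (intro order.trans[OF sum_abs] sum_mono) (auto simp: abs_mult sign_def)
  also have "card P = fact s" unfolding P_def by (intro card_permutations) auto
  then have "(\<Sum>p\<in>P. (1 :: rat)) = of_nat (fact s)" by simp
  finally show "\<bar>det (mat s s (\<lambda>(i, j). 1 / of_int (a (\<phi> i j))))\<bar> \<le> (of_nat (fact s) :: rat)"
    unfolding det .
qed

section \<open>Equations with rational coefficients\<close>

definition rat_Sol :: "nat set \<Rightarrow> (nat \<Rightarrow> rat) \<Rightarrow> rat \<Rightarrow> real \<Rightarrow> (nat \<Rightarrow> int) set" where
  "rat_Sol I \<alpha> b H = {x \<in> PiE I (\<lambda>_. nz H). (\<Sum>i\<in>I. \<alpha> i / of_int (x i)) = b}"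

text \<open>One denominator \<open>m\<close> common to all coefficients allows the whole equation to
  be scaled with the variables unchanged. The bounds H^L for \<open>m\<close> and \<open>L\<close>
  for the coefficients multiply to the one in \<open>admissible\<close>.\<close>

definition rat_admissible :: "nat \<Rightarrow> real \<Rightarrow> nat set \<Rightarrow> (nat \<Rightarrow> rat) \<Rightarrow> bool" where
  "rat_admissible L H I \<alpha> \<longleftrightarrow> finite I \<and> (\<exists>m::int. m \<noteq> 0 \<and> real_of_int \<bar>m\<bar> \<le> H ^ L \<and>
     (\<forall>i\<in>I. \<alpha> i \<noteq> 0 \<and> of_int m * \<alpha> i \<in> \<int> \<and> \<bar>\<alpha> i\<bar> \<le> of_nat L))"

lemma rat_Sol_subset_Sol:
  assumes "rat_admissible L H I \<alpha>"
  obtains A m where "m \<noteq> 0" "admissible L H I A" "rat_Sol I \<alpha> b H \<subseteq> Sol I A (of_int m * b) H"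
proof -
  obtain m where m: "m \<noteq> 0" "real_of_int \<bar>m\<bar> \<le> H ^ L"
     "\<And>i. i \<in> I \<Longrightarrow> \<alpha> i \<noteq> 0 \<and> of_int m * \<alpha> i \<in> \<int> \<and> \<bar>\<alpha> i\<bar> \<le> of_nat L"
    using assms unfolding rat_admissible_def by blast
  have "\<forall>i\<in>I. \<exists>k. of_int k = of_int m * \<alpha> i" using m(3) by (metis Ints_cases)
  then obtain A where A: "\<And>i. i \<in> I \<Longrightarrow> of_int (A i) = of_int m * \<alpha> i" by metis
  show ?thesis
  proof (rule that[OF m(1)])
    show "admissible L H I A" unfolding admissible_def
    proof (intro conjI ballI)
      show "finite I" using assms by (simp add: rat_admissible_def)
      fix i assume i: "i \<in> I"
      show "A i \<noteq> 0" using A[OF i] m(1) m(3)[OF i] by auto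
      have "of_int \<bar>A i\<bar> = \<bar>of_int m * \<alpha> i\<bar>" using A[OF i] by (metis of_int_abs)
      also have "\<dots> \<le> (of_int \<bar>m\<bar> * of_nat L :: rat)"
        unfolding abs_mult of_int_abs using m(3)[OF i] by (intro mult_left_mono) auto
      also have "\<dots> = of_int (\<bar>m\<bar> * int L)" by simp
      finally have "\<bar>A i\<bar> \<le> \<bar>m\<bar> * int L" unfolding of_int_le_iff .
      then have "real_of_int \<bar>A i\<bar> \<le> real_of_int (\<bar>m\<bar> * int L)" unfolding of_int_le_iff .
      also have "\<dots> = real_of_int \<bar>m\<bar> * real L" by simp
      also have "\<dots> \<le> H ^ L * real L" using m(2) by (intro mult_right_mono) auto
      finally show "real_of_int \<bar>A i\<bar> \<le> real L * H ^ L" by (simp add: mult.commute)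
    qed
    show "rat_Sol I \<alpha> b H \<subseteq> Sol I A (of_int m * b) H"
    proof
      fix x assume x: "x \<in> rat_Sol I \<alpha> b H"
      have "(\<Sum>i\<in>I. of_int (A i) / of_int (x i)) = of_int m * (\<Sum>i\<in>I. \<alpha> i / of_int (x i))"
        unfolding sum_distrib_left by (intro sum.cong) (auto simp: A)
      then show "x \<in> Sol I A (of_int m * b) H" using x by (simp add: rat_Sol_def Sol_def)
    qed
  qed
qed

lemma finite_rat_Sol [simp]: "finite I \<Longrightarrow> finite (rat_Sol I \<alpha> b H)"
  unfolding rat_Sol_def by (intro finite_Collect_conjI disjI1) (simp add: finite_PiE)

text \<open>Clearing denominators multiplies the right-hand side by an integer, hence the closure
  condition on \<open>D\<close>. Both the set of all rationals and that of the nonzero ones satisfy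
  it.\<close>

lemma card_rat_Sol_le:
  assumes "Sol_bound n L D c" "\<And>q b. q \<noteq> 0 \<Longrightarrow> b \<in> D \<Longrightarrow> of_int q * b \<in> D" "\<epsilon> > 0"
  obtains K where "K \<ge> 1" "\<And>H I \<alpha> b. H \<ge> 1 \<Longrightarrow> rat_admissible L H I \<alpha> \<Longrightarrow> card I = n \<Longrightarrow> b \<in> D \<Longrightarrow>
    real (card (rat_Sol I \<alpha> b H)) \<le> K * H powr (c + \<epsilon>)"
proof -
  obtain K where K: "K > 0" "\<And>H I A b. H \<ge> 1 \<Longrightarrow> admissible L H I A \<Longrightarrow> card I = n \<Longrightarrow> b \<in> D \<Longrightarrow>
    real (card (Sol I A b H)) \<le> K * H powr (c + \<epsilon>)"
    by (rule Sol_boundE[OF assms(1,3)]) (rule that)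
  show ?thesis
  proof (rule that[of "max 1 K"])
    fix H :: real and I and \<alpha> :: "nat \<Rightarrow> rat" and b
    assume H: "H \<ge> 1" and adm: "rat_admissible L H I \<alpha>" and cI: "card I = n" and b: "b \<in> D"
    obtain A m where Am: "m \<noteq> 0" "admissible L H I A" "rat_Sol I \<alpha> b H \<subseteq> Sol I A (of_int m * b) H"
      by (rule rat_Sol_subset_Sol[OF adm])
    have "card (rat_Sol I \<alpha> b H) \<le> card (Sol I A (of_int m * b) H)"
      using Am by (intro card_mono finite_Sol) (auto simp: admissible_def)
    also have "real \<dots> \<le> K * H powr (c + \<epsilon>)"
      using Am assms(2) b by (intro K(2) H cI) auto
    also have "\<dots> \<le> max 1 K * H powr (c + \<epsilon>)" by (intro mult_right_mono) auto
    finally show "real (card (rat_Sol I \<alpha> b H)) \<le> max 1 K * H powr (c + \<epsilon>)" by simp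
  qed simp
qed

lemma card_le_fibers:
  assumes "finite B" "h ` S \<subseteq> B" "\<And>b. b \<in> B \<Longrightarrow> real (card {x \<in> S. h x = b}) \<le> r"
  shows "real (card S) \<le> real (card B) * r"
proof (cases "finite S")
  case True
  have "S = (\<Union>b\<in>B. {x \<in> S. h x = b})" using assms(2) by auto
  then have "card S \<le> (\<Sum>b\<in>B. card {x \<in> S. h x = b})" using card_UN_le[OF assms(1), of "\<lambda>b. {x \<in> S. h x = b}"] by simp
  then have "real (card S) \<le> (\<Sum>b\<in>B. real (card {x \<in> S. h x = b}))"
    unfolding of_nat_sum[symmetric] of_nat_le_iff .
  also have "\<dots> \<le> (\<Sum>b\<in>B. r)" using assms(3) by (intro sum_mono)
  finally show ?thesis by simp
next
  \<comment> \<open>An infinite \<open>S\<close> has cardinality 0 by convention, so only the sign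
    of the right-hand side is at issue.\<close>
  case False
  have "0 \<le> real (card B) * r"
  proof (cases "B = {}")
    case False
    then obtain b where "b \<in> B" by blast
    then have "0 \<le> r" using assms(3)[of b] of_nat_0_le_iff order.trans by blast
    then show ?thesis by simp
  qed simp
  then show ?thesis using False by simp
qed

section \<open>Counting matrices\<close>

text \<open>Matrices are counted through their integer denominators. As extensional functions on the
  positions, these can be split by restriction into entries that are fixed and entries that are
  counted.\<close>

definition int_arrays :: "nat \<Rightarrow> real \<Rightarrow> (nat \<times> nat \<Rightarrow> int) set" where
  "int_arrays n H = PiE ({..<n} \<times> {..<n}) (\<lambda>_. nz H)"

definition recip :: "(nat \<times> nat \<Rightarrow> int) \<Rightarrow> nat \<Rightarrow> nat \<Rightarrow> rat" where
  "recip a i j = 1 / of_int (a (i, j))"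

definition recip_mat :: "nat \<Rightarrow> (nat \<times> nat \<Rightarrow> int) \<Rightarrow> rat mat" where
  "recip_mat n a = mat n n (\<lambda>(i, j). recip a i j)"

definition det_arrays :: "nat \<Rightarrow> real \<Rightarrow> rat \<Rightarrow> (nat \<times> nat \<Rightarrow> int) set" where
  "det_arrays n H \<delta> = {a \<in> int_arrays n H. det (recip_mat n a) = \<delta>}"

text \<open>A constant valid for all \<open>H \<ge> 1\<close> replaces the threshold, so that
  estimates can be multiplied and summed over finitely many cases without adjusting the range of
  \<open>H\<close>.\<close>

definition det_bound :: "nat \<Rightarrow> rat set \<Rightarrow> real \<Rightarrow> bool" where
  "det_bound n D c \<longleftrightarrow> (\<forall>\<epsilon>>0. \<exists>K\<ge>1. \<forall>H\<ge>1. \<forall>\<delta>\<in>D.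
     real (card (det_arrays n H \<delta>)) \<le> K * H powr (c + \<epsilon>))"

lemma finite_int_arrays [simp]: "finite (int_arrays n H)"
  unfolding int_arrays_def by (intro finite_PiE) auto

lemma finite_det_arrays [simp]: "finite (det_arrays n H \<delta>)"
  unfolding det_arrays_def by simp

lemma int_arrays_nz: "a \<in> int_arrays n H \<Longrightarrow> i < n \<Longrightarrow> j < n \<Longrightarrow> a (i, j) \<in> nz H"
  by (auto simp: int_arrays_def)

lemma restrict_int_arrays:
  "a \<in> int_arrays n H \<Longrightarrow> U \<subseteq> {..<n} \<times> {..<n} \<Longrightarrow> restrict a U \<in> PiE U (\<lambda>_. nz H)"
  by (rule restrict_PiE_iff[THEN iffD2]) (auto simp: int_arrays_def)

lemma card_egyptian_det_mats_le:
  "card (egyptian_det_mats n H \<delta>) \<le> card (det_arrays n H \<delta>)"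
proof -
  have "egyptian_det_mats n H \<delta> \<subseteq> recip_mat n ` det_arrays n H \<delta>"
  proof
    fix A assume A: "A \<in> egyptian_det_mats n H \<delta>"
    then have car: "A \<in> carrier_mat n n" and det: "det A = \<delta>"
      and ent: "\<And>i j. i < n \<Longrightarrow> j < n \<Longrightarrow> A $$ (i, j) \<in> egyptian H"
      by (auto simp: egyptian_det_mats_def egyptian_mats_def)
    have "\<forall>z\<in>{..<n} \<times> {..<n}. \<exists>k\<in>nz H. A $$ z = 1 / of_int k"
      using ent by (fastforce simp: egyptian_def nz_def)
    then obtain f where f: "\<And>z. z \<in> {..<n} \<times> {..<n} \<Longrightarrow> f z \<in> nz H \<and> A $$ z = 1 / of_int (f z)"
      by metis
    define a where "a = restrict f ({..<n} \<times> {..<n})"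
    have "a \<in> int_arrays n H" using f by (auto simp: a_def int_arrays_def)
    moreover have "recip_mat n a = A"
      using car f by (intro eq_matI) (auto simp: recip_mat_def recip_def a_def)
    ultimately show "A \<in> recip_mat n ` det_arrays n H \<delta>" using det by (auto simp: det_arrays_def)
  qed
  then show ?thesis by (intro surj_card_le) auto
qed

lemma power_bound_uniform_if_det_bound:
  assumes "det_bound n D c"
  shows "power_bound_uniform (\<lambda>H \<delta>. card (egyptian_det_mats n H \<delta>)) D c"
  unfolding power_bound_uniform_def
proof (intro allI impI)
  fix \<epsilon> :: real assume eps: "\<epsilon> > 0"
  then have e2: "\<epsilon> / 2 > 0" by simp
  obtain K where K: "K \<ge> 1" "\<forall>H\<ge>1. \<forall>\<delta>\<in>D. real (card (det_arrays n H \<delta>)) \<le> K * H powr (c + \<epsilon> / 2)"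
    using assms e2 unfolding det_bound_def by blast
  show "\<exists>H0\<ge>1. \<forall>H\<ge>H0. \<forall>\<delta>\<in>D. real (card (egyptian_det_mats n H \<delta>)) \<le> H powr (c + \<epsilon>)"
  proof (intro exI conjI allI impI ballI)
    \<comment> \<open>Beyond this threshold \<open>K\<close> is at most H^(\<epsilon>/2) and
      disappears into the exponent; \<open>K \<ge> 1\<close> keeps the threshold at least 1.\<close>
    show "1 \<le> K powr (2 / \<epsilon>)" using K(1) eps by (intro ge_one_powr_ge_zero) auto
    fix H \<delta> assume H: "H \<ge> K powr (2 / \<epsilon>)" and \<delta>: "\<delta> \<in> D"
    have H1: "H \<ge> 1" using H \<open>1 \<le> K powr (2 / \<epsilon>)\<close> by linarith
    have "K = (K powr (2 / \<epsilon>)) powr (\<epsilon> / 2)" using K(1) eps by (simp add: powr_powr)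
    also have "\<dots> \<le> H powr (\<epsilon> / 2)" using H eps by (intro powr_mono2) auto
    finally have KH: "K \<le> H powr (\<epsilon> / 2)" .
    have "real (card (egyptian_det_mats n H \<delta>)) \<le> K * H powr (c + \<epsilon> / 2)"
      using card_egyptian_det_mats_le[of n H \<delta>] K(2) H1 \<delta> by (meson of_nat_mono order.trans)
    also have "\<dots> \<le> H powr (\<epsilon> / 2) * H powr (c + \<epsilon> / 2)" using KH by (intro mult_right_mono) auto
    also have "\<dots> = H powr (c + \<epsilon>)" by (simp add: powr_add[symmetric] add.commute)
    finally show "real (card (egyptian_det_mats n H \<delta>)) \<le> H powr (c + \<epsilon>)" .
  qed
qed

section \<open>Singular matrices\<close>

definition row_exponent :: "nat \<Rightarrow> real" where
  "row_exponent t = (if t = 3 then 1 else real t / 2)"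

lemma Sol_bound_row_exponent: "Sol_bound t L UNIV (row_exponent t)"
  using Sol_bound_3[of L] Sol_bound_half[of t L] by (auto simp: row_exponent_def)

lemma kernel_coeff_cong:
  assumes "\<And>i j. i < t \<Longrightarrow> j < t - 1 \<Longrightarrow> E (f i) (g j) = E' (f' i) (g' j)" "k < t"
  shows "kernel_coeff t f g E k = kernel_coeff t f' g' E' k"
proof -
  have "mat (t - 1) (t - 1) (\<lambda>(i, j). E ((f \<circ> insert_index k) i) (g j)) =
        mat (t - 1) (t - 1) (\<lambda>(i, j). E' ((f' \<circ> insert_index k) i) (g' j))"
    using assms by (intro eq_matI) (auto simp: insert_index_def)
  then show ?thesis by (simp add: kernel_coeff_def sub_det_def)
qed

lemma abs_prod_nz_le:
  assumes "finite Z" "\<And>z. z \<in> Z \<Longrightarrow> a z \<in> nz H"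
  shows "real_of_int \<bar>\<Prod>z\<in>Z. a z\<bar> \<le> H ^ card Z"
proof -
  have "real_of_int \<bar>\<Prod>z\<in>Z. a z\<bar> = (\<Prod>z\<in>Z. real_of_int \<bar>a z\<bar>)" by (simp add: abs_prod)
  also have "\<dots> \<le> (\<Prod>z\<in>Z. H)" using assms(2) by (intro prod_mono) (auto simp: nz_def)
  finally show ?thesis by simp
qed

text \<open>Both families of coefficients used below, those of a row relation and the cofactors of
  the last row, are signed minors of the array. \<open>\<phi>\<close> tells at which positions their
  entries lie, and a single product over the common set \<open>Z\<close> clears all
  denominators.\<close>

lemma rat_admissible_minors:
  fixes a :: "nat \<times> nat \<Rightarrow> int"
  assumes "finite Z" "\<And>z. z \<in> Z \<Longrightarrow> a z \<in> nz H" "H \<ge> 1" "finite I"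
    "card Z \<le> L" "fact s \<le> L"
    "\<And>k. k \<in> I \<Longrightarrow> \<alpha> k \<noteq> 0"
    "\<And>k. k \<in> I \<Longrightarrow> \<alpha> k = (-1) ^ u k * det (mat s s (\<lambda>(i, j). 1 / of_int (a (\<phi> k i j))))"
    "\<And>k i j. k \<in> I \<Longrightarrow> i < s \<Longrightarrow> j < s \<Longrightarrow> \<phi> k i j \<in> Z"
    "\<And>k i j i' j'. k \<in> I \<Longrightarrow> i < s \<Longrightarrow> i' < s \<Longrightarrow> \<phi> k i j = \<phi> k i' j' \<Longrightarrow> i = i'"
  shows "rat_admissible L H I \<alpha>"
  unfolding rat_admissible_def
proof (intro conjI exI ballI)
  have nz: "a z \<noteq> 0" if "z \<in> Z" for z using assms(2)[OF that] by (rule nz_nonzero)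
  show "(\<Prod>z\<in>Z. a z) \<noteq> 0" using nz assms(1) by simp
  have "real_of_int \<bar>\<Prod>z\<in>Z. a z\<bar> \<le> H ^ card Z" by (rule abs_prod_nz_le[OF assms(1,2)])
  also have "\<dots> \<le> H ^ L" using assms(3,5) by (intro power_increasing) auto
  finally show "real_of_int \<bar>\<Prod>z\<in>Z. a z\<bar> \<le> H ^ L" .
  fix k assume k: "k \<in> I"
  define d where "d = (det (mat s s (\<lambda>(i, j). 1 / of_int (a (\<phi> k i j)))) :: rat)"
  have d: "of_int (\<Prod>z\<in>Z. a z) * d \<in> \<int>" "\<bar>d\<bar> \<le> of_nat (fact s)"
    unfolding d_def using assms(9,10)[OF k] nz
    by (intro minor_scaled_int[OF assms(1)], blast+)+
  have \<alpha>: "\<alpha> k = (-1) ^ u k * d" using assms(8)[OF k] by (simp add: d_def)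
  show "\<alpha> k \<noteq> 0" using assms(7)[OF k] .
  have "(-1) ^ u k * (of_int (\<Prod>z\<in>Z. a z) * d) \<in> \<int>" by (rule Ints_mult[OF _ d(1)]) simp
  then show "of_int (\<Prod>z\<in>Z. a z) * \<alpha> k \<in> \<int>" unfolding \<alpha> by (simp only: mult.left_commute)
  have "\<bar>\<alpha> k\<bar> = \<bar>d\<bar>" unfolding \<alpha> by (simp add: abs_mult power_abs)
  also have "\<dots> \<le> of_nat (fact s)" by (rule d(2))
  also have "\<dots> \<le> of_nat L" using assms(6) unfolding of_nat_le_iff .
  finally show "\<bar>\<alpha> k\<bar> \<le> of_nat L" .
qed (fact assms(4))

definition kernel_arrays :: "nat \<Rightarrow> nat \<Rightarrow> (nat \<Rightarrow> nat) \<Rightarrow> (nat \<Rightarrow> nat) \<Rightarrow> real \<Rightarrow> (nat \<times> nat \<Rightarrow> int) set" where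
  "kernel_arrays n t f g H = {a \<in> int_arrays n H. (\<forall>k<t. kernel_coeff t f g (recip a) k \<noteq> 0) \<and>
     (\<forall>l<n. (\<Sum>k<t. kernel_coeff t f g (recip a) k * recip a (f k) l) = 0)}"

lemma card_PiE_nz_le:
  assumes "finite U" "H \<ge> 1"
  shows "real (card (PiE U (\<lambda>_. nz H))) \<le> (2 * H) ^ card U"
proof -
  have "real (card (PiE U (\<lambda>_. nz H))) = real (card (nz H)) ^ card U"
    using assms(1) by (simp add: card_PiE)
  also have "\<dots> \<le> (2 * H) ^ card U" using assms card_nz_le[of H] by (intro power_mono) auto
  finally show ?thesis .
qed

text \<open>Fix all entries outside the block of rows \<open>f\<close> and columns \<open>J\<close>.
  The coefficients are then fixed, and the columns of the block become independent of each other,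
  each solving the same homogeneous equation in \<open>t\<close> variables. With q such columns the
  exponent is n^2 - (t - \<kappa>) q.\<close>

lemma card_kernel_arrays_le:
  assumes t: "2 \<le> t" "t \<le> n" and eps: "\<epsilon> > 0"
  shows "\<exists>K\<ge>1. \<forall>H\<ge>1. \<forall>f g. inj_on f {..<t} \<longrightarrow> f ` {..<t} \<subseteq> {..<n} \<longrightarrow> g ` {..<t - 1} \<subseteq> {..<n} \<longrightarrow>
    real (card (kernel_arrays n t f g H)) \<le>
      K * H powr ((real n)\<^sup>2 - (real t - row_exponent t) * (real n - real t + 1) + \<epsilon>)"
proof -
  \<comment> \<open>One factor H^e is lost for each of at most \<open>n\<close> columns. In
    \<open>L\<close>, the factorial bounds the minors and \<open>n * n\<close> the number of entries
    in their common denominator.\<close>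
  define e where "e = \<epsilon> / real n"
  define L where "L = (fact n :: nat) + n * n"
  define \<kappa> where "\<kappa> = row_exponent t"
  have e: "e > 0" "e * real n = \<epsilon>" using eps t by (auto simp: e_def)
  have \<kappa>t: "\<kappa> \<le> real t" using t by (auto simp: \<kappa>_def row_exponent_def)
  obtain K where K: "K \<ge> 1" "\<And>H I \<alpha> b. H \<ge> 1 \<Longrightarrow> rat_admissible L H I \<alpha> \<Longrightarrow> card I = t \<Longrightarrow> b \<in> UNIV \<Longrightarrow>
    real (card (rat_Sol I \<alpha> b H)) \<le> K * H powr (\<kappa> + e)"
    unfolding \<kappa>_def by (rule card_rat_Sol_le[OF Sol_bound_row_exponent _ e(1)]) (auto intro: that)
  show ?thesis
  proof (intro exI[of _ "2 ^ (n * n) * K ^ n"] conjI allI impI)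
    show "1 \<le> 2 ^ (n * n) * K ^ n" using K(1) mult_mono[of 1 "2 ^ (n * n)" 1 "K ^ n"] by simp
    fix H :: real and f g :: "nat \<Rightarrow> nat"
    assume H: "H \<ge> 1" and inj: "inj_on f {..<t}" and fn: "f ` {..<t} \<subseteq> {..<n}" and gn: "g ` {..<t - 1} \<subseteq> {..<n}"
    define J where "J = {..<n} - g ` {..<t - 1}"
    define q where "q = card J"
    define U where "U = {..<n} \<times> {..<n} - f ` {..<t} \<times> J"
    define Z where "Z = f ` {..<t} \<times> g ` {..<t - 1}"
    have ZU: "Z \<subseteq> U" using fn gn by (auto simp: Z_def U_def J_def)
    have finU: "finite U" "finite J" "finite Z" by (auto simp: U_def J_def Z_def)
    have cg: "card (g ` {..<t - 1}) \<le> t - 1" using card_image_le[of "{..<t - 1}" g] by simp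
    have q: "q = n - card (g ` {..<t - 1})" unfolding q_def J_def using gn by (simp add: card_Diff_subset)
    \<comment> \<open>The selection \<open>g\<close> may repeat columns, so at least
      \<open>n - t + 1\<close> columns remain outside it. A larger number only helps, because
      \<open>\<kappa> \<le> t\<close>.\<close>
    have qn: "q \<le> n" and qt: "real q \<ge> real n - real t + 1" using q cg t by (auto simp: of_nat_diff)
    have FJ: "f ` {..<t} \<times> J \<subseteq> {..<n} \<times> {..<n}" using fn by (auto simp: J_def)
    have cFJ: "card (f ` {..<t} \<times> J) = t * q" by (simp add: card_cartesian_product card_image[OF inj] q_def)
    have tq: "t * q \<le> n * n" using t qn by (intro mult_mono) auto
    have cU: "card U = n * n - t * q" unfolding U_def using FJ finU(2) cFJ
      by (subst card_Diff_subset) (auto simp: card_cartesian_product)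
    have Zn: "Z \<subseteq> {..<n} \<times> {..<n}" using fn gn by (auto simp: Z_def)
    have cZ: "card Z \<le> n * n" using card_mono[OF _ Zn] by (simp add: card_cartesian_product)
    let ?S = "kernel_arrays n t f g H"
    define r where "r = (K * H powr (\<kappa> + e)) ^ q"
    have r0: "r \<ge> 0" using K(1) by (simp add: r_def)
    have "real (card ?S) \<le> real (card (PiE U (\<lambda>_. nz H))) * r"
    proof (rule card_le_fibers[where h = "\<lambda>a. restrict a U"])
      show "finite (PiE U (\<lambda>_. nz H))" using finU by (intro finite_PiE) auto
      show "(\<lambda>a. restrict a U) ` ?S \<subseteq> PiE U (\<lambda>_. nz H)"
        by (intro image_subsetI restrict_int_arrays) (auto simp: kernel_arrays_def U_def)
      fix b
      show "real (card {a \<in> ?S. restrict a U = b}) \<le> r" (is "real (card ?R) \<le> r")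
      proof (cases "?R = {}")
        case True
        show ?thesis using r0 by (simp only: True card.empty of_nat_0)
      next
        case False
        then obtain a0 where a0: "a0 \<in> ?S" "restrict a0 U = b" by auto
        define \<alpha> where "\<alpha> = kernel_coeff t f g (recip a0)"
        have nz0: "a0 z \<in> nz H" if "z \<in> {..<n} \<times> {..<n}" for z
          using a0 that int_arrays_nz by (auto simp: kernel_arrays_def)
        have adm: "rat_admissible L H {..<t} \<alpha>"
        proof (rule rat_admissible_minors[where Z = Z and a = a0 and s = "t - 1" and u = "\<lambda>k. k + (t - 1)"
              and \<phi> = "\<lambda>k i j. (f (insert_index k i), g j)"])
          show "a0 z \<in> nz H" if "z \<in> Z" for z using nz0 that Zn by blast
          show "card Z \<le> L" using cZ by (simp add: L_def)
          have "fact (t - 1) \<le> (fact n :: nat)" using t by (intro fact_mono) auto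
          then show "fact (t - 1) \<le> L" by (simp add: L_def)
          show "\<alpha> k \<noteq> 0" if "k \<in> {..<t}" for k using a0 that by (auto simp: \<alpha>_def kernel_arrays_def)
          show "\<alpha> k = (- 1) ^ (k + (t - 1)) * det (mat (t - 1) (t - 1)
             (\<lambda>(i, j). 1 / of_int (a0 (f (insert_index k i), g j))))" for k
            by (simp add: \<alpha>_def kernel_coeff_def sub_det_def recip_def)
          have ins: "insert_index k i < t" if "i < t - 1" for k i using that by (auto simp: insert_index_def)
          show "(f (insert_index k i), g j) \<in> Z" if "i < t - 1" "j < t - 1" for k i j
            using that ins by (auto simp: Z_def)
          fix k i j i' j' assume "i < t - 1" "i' < t - 1"
            "(f (insert_index k i), g j) = (f (insert_index k i'), g j')"
          then have "insert_index k i = insert_index k i'" using ins by (auto dest: inj_onD[OF inj])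
          then show "i = i'" by (metis delete_insert_index)
        qed (use finU H in auto)
        define X where "X = rat_Sol {..<t} \<alpha> 0 H"
        define \<psi> where "\<psi> a = (\<lambda>l\<in>J. \<lambda>k\<in>{..<t}. a (f k, l))" for a :: "nat \<times> nat \<Rightarrow> int"
        have "card ?R \<le> card (PiE J (\<lambda>_. X))"
        proof (rule card_inj_on_le)
          show "inj_on \<psi> ?R"
          proof (rule inj_onI)
            fix a a' assume a: "a \<in> ?R" and a': "a' \<in> ?R" and eq: "\<psi> a = \<psi> a'"
            have "a z = a' z" if z: "z \<in> {..<n} \<times> {..<n}" for z
            proof (cases "z \<in> U")
              case True
              have "restrict a U z = restrict a' U z" using a a' by simp
              then show ?thesis using True by simp
            next
              case False
              then obtain k l where kl: "z = (f k, l)" "k < t" "l \<in> J" using z by (auto simp: U_def)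
              have "\<psi> a l k = \<psi> a' l k" using eq by simp
              then show ?thesis using kl by (simp add: \<psi>_def)
            qed
            then show "a = a'" using a a'
              by (intro PiE_ext[of a "{..<n} \<times> {..<n}" "\<lambda>_. nz H" a']) (auto simp: kernel_arrays_def int_arrays_def)
          qed
          show "\<psi> ` ?R \<subseteq> PiE J (\<lambda>_. X)"
          proof (rule image_subsetI)
            fix a assume a: "a \<in> ?R"
            have agree: "a z = a0 z" if "z \<in> U" for z
            proof -
              have "restrict a U z = restrict a0 U z" using a a0 by simp
              then show ?thesis using that by simp
            qed
            have \<alpha>: "kernel_coeff t f g (recip a) k = \<alpha> k" if "k < t" for k
              unfolding \<alpha>_def
            proof (rule kernel_coeff_cong[OF _ that])
              fix i j assume "i < t" "j < t - 1"
              then have "(f i, g j) \<in> U" using ZU by (auto simp: Z_def)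
              then show "recip a (f i) (g j) = recip a0 (f i) (g j)" by (simp add: recip_def agree)
            qed
            have "(\<lambda>k\<in>{..<t}. a (f k, l)) \<in> X" if l: "l \<in> J" for l
            proof -
              have ln: "l < n" using l by (simp add: J_def)
              have "(\<Sum>k<t. \<alpha> k / of_int ((\<lambda>k\<in>{..<t}. a (f k, l)) k)) =
                    (\<Sum>k<t. kernel_coeff t f g (recip a) k * recip a (f k) l)"
                by (intro sum.cong) (auto simp: recip_def \<alpha>)
              also have "\<dots> = 0" using a ln by (simp add: kernel_arrays_def)
              finally show ?thesis unfolding X_def rat_Sol_def
                using a fn ln by (auto simp: kernel_arrays_def intro!: int_arrays_nz)
            qed
            then show "\<psi> a \<in> PiE J (\<lambda>_. X)" by (auto simp: \<psi>_def)
          qed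
          show "finite (PiE J (\<lambda>_. X))" using finU by (intro finite_PiE) (auto simp: X_def)
        qed
        then have "real (card ?R) \<le> real (card (PiE J (\<lambda>_. X)))" unfolding of_nat_le_iff .
        also have "\<dots> = real (card X) ^ q" using finU by (simp add: card_PiE q_def)
        also have "\<dots> \<le> r" unfolding r_def X_def
          by (intro power_mono K(2) H adm) auto
        finally show ?thesis .
      qed
    qed
    also have "\<dots> \<le> (2 * H) ^ card U * r" using r0 by (intro mult_right_mono card_PiE_nz_le finU H) auto
    also have "\<dots> = 2 ^ card U * K ^ q * (H powr real (card U) * H powr ((\<kappa> + e) * real q))"
      using H by (simp add: r_def power_mult_distrib powr_realpow[symmetric] powr_powr)
    also have "\<dots> = 2 ^ card U * K ^ q * H powr (real (card U) + (\<kappa> + e) * real q)"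
      by (simp add: powr_add)
    also have "\<dots> \<le> 2 ^ (n * n) * K ^ n * H powr ((real n)\<^sup>2 - (real t - \<kappa>) * (real n - real t + 1) + \<epsilon>)"
    proof (intro mult_mono powr_mono H power_increasing qn K)
      show "card U \<le> n * n" unfolding cU by simp
      have "real (card U) = (real n)\<^sup>2 - real t * real q"
        unfolding cU using tq by (simp add: of_nat_diff power2_eq_square)
      moreover have "(real t - \<kappa>) * (real n - real t + 1) \<le> (real t - \<kappa>) * real q"
        using qt \<kappa>t by (intro mult_left_mono) auto
      moreover have "e * real q \<le> \<epsilon>" using e qn by (metis less_imp_le mult_left_mono of_nat_mono)
      ultimately show "real (card U) + (\<kappa> + e) * real q \<le> (real n)\<^sup>2 - (real t - \<kappa>) * (real n - real t + 1) + \<epsilon>"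
        by (simp add: algebra_simps)
    qed (use K in auto)
    finally show "real (card ?S) \<le> 2 ^ (n * n) * K ^ n *
      H powr ((real n)\<^sup>2 - (real t - row_exponent t) * (real n - real t + 1) + \<epsilon>)"
      by (simp add: \<kappa>_def)
  qed
qed

text \<open>For \<open>n = 2\<close> this gives 3, one more than the true exponent; that order is
  treated by a direct factorisation.\<close>

definition singular_exponent :: "nat \<Rightarrow> real" where
  "singular_exponent n = (if n = 3 then 7 else (real n)\<^sup>2 - real n / 2)"

text \<open>Expanding (t - 1)(n - t) >= 0 gives t (n - t + 1) >= n, with equality at t = n, so the
  relation between all rows is the worst one. For n = 3 both t = 2 and t = 3 give 7, the latter
  because \<open>row_exponent 3\<close> is 1 and not 3/2.\<close>

lemma kernel_exponent_le:
  assumes "2 \<le> t" "t \<le> n"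
  shows "(real n)\<^sup>2 - (real t - row_exponent t) * (real n - real t + 1) \<le> singular_exponent n"
proof (cases "n = 3")
  case True
  then have "t = 2 \<or> t = 3" using assms by linarith
  then show ?thesis using True by (auto simp: singular_exponent_def row_exponent_def)
next
  case False
  have "0 \<le> (real t - 1) * (real n - real t)" using assms by (intro mult_nonneg_nonneg) auto
  then have "real n / 2 \<le> real t / 2 * (real n - real t + 1)" by (simp add: algebra_simps)
  also have "\<dots> \<le> (real t - row_exponent t) * (real n - real t + 1)"
    using assms by (intro mult_right_mono) (auto simp: row_exponent_def)
  finally show ?thesis using False by (simp add: singular_exponent_def)
qed

lemma det_arrays_zero_subset:
  "det_arrays n H 0 \<subseteq> (\<Union>(t, f, g) \<in> (SIGMA t:{2..n}. {f \<in> PiE {..<t} (\<lambda>_. {..<n}). inj_on f {..<t}} \<times>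
      PiE {..<t - 1} (\<lambda>_. {..<n})). kernel_arrays n t f g H)" (is "_ \<subseteq> (\<Union>(t, f, g)\<in>?T. _)")
proof
  fix a assume a: "a \<in> det_arrays n H 0"
  have "recip a i j \<noteq> 0" if "i < n" "j < n" for i j
    using a that int_arrays_nz[of a n H i j] by (auto simp: det_arrays_def recip_def nz_def)
  moreover have "det (mat n n (\<lambda>(i, j). recip a i j)) = 0"
    using a by (simp add: det_arrays_def recip_mat_def)
  ultimately obtain t f g where tfg: "2 \<le> t" "t \<le> n" "inj_on f {..<t}" "f ` {..<t} \<subseteq> {..<n}"
    "g ` {..<t - 1} \<subseteq> {..<n}" "\<forall>k<t. kernel_coeff t f g (recip a) k \<noteq> 0"
    "\<forall>l<n. (\<Sum>k<t. kernel_coeff t f g (recip a) k * recip a (f k) l) = 0"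
    using singular_relation[of n "recip a"] by blast
  \<comment> \<open>Restriction puts the selections into a finite set that depends on
    \<open>n\<close> only, so the union bound costs a constant.\<close>
  define f' where "f' = restrict f {..<t}"
  define g' where "g' = restrict g {..<t - 1}"
  have "kernel_coeff t f g (recip a) k = kernel_coeff t f' g' (recip a) k" if "k < t" for k
    by (rule kernel_coeff_cong[OF _ that]) (auto simp: f'_def g'_def)
  then have "a \<in> kernel_arrays n t f' g' H"
    using tfg(6,7) a by (auto simp: kernel_arrays_def det_arrays_def f'_def)
  moreover have "inj_on f' {..<t}" using tfg(3) by (auto simp: f'_def inj_on_def)
  then have "(t, f', g') \<in> ?T" using tfg(1,2,4,5) by (auto simp: f'_def g'_def)
  ultimately show "a \<in> (\<Union>(t, f, g)\<in>?T. kernel_arrays n t f g H)" by blast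
qed

lemma det_bound_singular: "det_bound n {0} (singular_exponent n)"
  unfolding det_bound_def
proof (intro allI impI)
  fix \<epsilon> :: real assume eps: "\<epsilon> > 0"
  define T where "T = (SIGMA t:{2..n}. {f \<in> PiE {..<t} (\<lambda>_. {..<n}). inj_on f {..<t}} \<times>
      PiE {..<t - 1} (\<lambda>_. {..<n}))"
  have "finite {f \<in> PiE {..<t} (\<lambda>_. {..<n}). inj_on f {..<t}}" for t :: nat
    by (rule finite_subset[of _ "PiE {..<t} (\<lambda>_. {..<n})"]) (auto intro!: finite_PiE)
  then have finT: "finite T" unfolding T_def
    by (intro finite_SigmaI finite_cartesian_product finite_PiE finite_atLeastAtMost finite_lessThan)
  define bounds where "bounds t K \<longleftrightarrow> K \<ge> 1 \<and> (\<forall>H\<ge>1. \<forall>f g. inj_on f {..<t} \<longrightarrow> f ` {..<t} \<subseteq> {..<n} \<longrightarrow> g ` {..<t - 1} \<subseteq> {..<n} \<longrightarrow>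
    real (card (kernel_arrays n t f g H)) \<le>
      K * H powr ((real n)\<^sup>2 - (real t - row_exponent t) * (real n - real t + 1) + \<epsilon>))" for t K
  have "\<exists>K. bounds t K" if "t \<in> {2..n}" for t
    unfolding bounds_def using card_kernel_arrays_le[of t n \<epsilon>] eps that by simp
  then obtain K where bK: "\<And>t. t \<in> {2..n} \<Longrightarrow> bounds t (K t)" by metis
  have K1: "K t \<ge> 1" if "t \<in> {2..n}" for t using bK[OF that] by (simp add: bounds_def)
  have K2: "real (card (kernel_arrays n t f g H)) \<le>
      K t * H powr ((real n)\<^sup>2 - (real t - row_exponent t) * (real n - real t + 1) + \<epsilon>)"
    if "t \<in> {2..n}" "H \<ge> 1" "inj_on f {..<t}" "f ` {..<t} \<subseteq> {..<n}" "g ` {..<t - 1} \<subseteq> {..<n}" for t H f g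
    using bK[OF that(1)] that(2-) by (simp add: bounds_def)
  define C where "C = (\<Sum>(t, f, g)\<in>T. K t) + 1"
  show "\<exists>K\<ge>1. \<forall>H\<ge>1. \<forall>\<delta>\<in>{0}. real (card (det_arrays n H \<delta>)) \<le> K * H powr (singular_exponent n + \<epsilon>)"
  proof (intro exI[of _ C] conjI allI impI ballI)
    have "0 \<le> (\<Sum>(t, f, g)\<in>T. K t)"
    proof (intro sum_nonneg)
      fix z assume "z \<in> T"
      then show "0 \<le> (case z of (t, f, g) \<Rightarrow> K t)" using K1[of "fst z"] by (auto simp: T_def)
    qed
    then show "1 \<le> C" by (simp add: C_def)
    fix H :: real and \<delta> :: rat assume H: "H \<ge> 1" and \<delta>: "\<delta> \<in> {0}"
    have one: "real (card (case z of (t, f, g) \<Rightarrow> kernel_arrays n t f g H)) \<le>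
       (case z of (t, f, g) \<Rightarrow> K t) * H powr (singular_exponent n + \<epsilon>)" if z: "z \<in> T" for z
    proof -
      obtain t f g where tfg: "z = (t, f, g)" by (cases z)
      have t: "t \<in> {2..n}" "inj_on f {..<t}" "f ` {..<t} \<subseteq> {..<n}" "g ` {..<t - 1} \<subseteq> {..<n}"
        using z unfolding tfg T_def by auto
      have "real (card (kernel_arrays n t f g H)) \<le>
        K t * H powr ((real n)\<^sup>2 - (real t - row_exponent t) * (real n - real t + 1) + \<epsilon>)"
        by (rule K2[OF t(1) H t(2-4)])
      also have "\<dots> \<le> K t * H powr (singular_exponent n + \<epsilon>)"
        using K1[OF t(1)] H kernel_exponent_le[of t n] t(1) by (intro mult_left_mono powr_mono) auto
      finally show ?thesis by (simp add: tfg)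
    qed
    have "card (det_arrays n H 0) \<le> card (\<Union>(t, f, g) \<in> T. kernel_arrays n t f g H)"
      unfolding T_def
      by (intro card_mono det_arrays_zero_subset finite_UN_I finT[unfolded T_def])
         (auto simp: kernel_arrays_def)
    also have "\<dots> \<le> (\<Sum>z\<in>T. card (case z of (t, f, g) \<Rightarrow> kernel_arrays n t f g H))"
      by (rule card_UN_le[OF finT])
    finally have "real (card (det_arrays n H 0)) \<le> (\<Sum>z\<in>T. real (card (case z of (t, f, g) \<Rightarrow> kernel_arrays n t f g H)))"
      unfolding of_nat_sum[symmetric] of_nat_le_iff .
    also have "\<dots> \<le> (\<Sum>z\<in>T. (case z of (t, f, g) \<Rightarrow> K t) * H powr (singular_exponent n + \<epsilon>))"
      by (intro sum_mono one)
    also have "\<dots> = (\<Sum>(t, f, g)\<in>T. K t) * H powr (singular_exponent n + \<epsilon>)"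
      by (simp only: sum_distrib_right)
    also have "\<dots> \<le> C * H powr (singular_exponent n + \<epsilon>)"
      by (intro mult_right_mono) (auto simp: C_def)
    finally show "real (card (det_arrays n H \<delta>)) \<le> C * H powr (singular_exponent n + \<epsilon>)" using \<delta> by simp
  qed
qed

section \<open>Matrices of nonzero determinant\<close>

definition last_cofactor :: "nat \<Rightarrow> (nat \<times> nat \<Rightarrow> int) \<Rightarrow> nat \<Rightarrow> rat" where
  "last_cofactor n a j = (-1) ^ (n - 1 + j) *
     det (mat (n - 1) (n - 1) (\<lambda>(i, k). 1 / of_int (a (i, insert_index j k))))"

lemma det_recip_mat_expand:
  assumes "n > 0"
  shows "det (recip_mat n a) = (\<Sum>j<n. last_cofactor n a j / of_int (a (n - 1, j)))"
proof -
  have M: "recip_mat n a \<in> carrier_mat n n" by (simp add: recip_mat_def)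
  have "det (recip_mat n a) = (\<Sum>j<n. recip_mat n a $$ (n - 1, j) * cofactor (recip_mat n a) (n - 1) j)"
    using assms by (intro laplace_expansion_row[OF M]) auto
  also have "\<dots> = (\<Sum>j<n. last_cofactor n a j / of_int (a (n - 1, j)))"
  proof (intro sum.cong refl)
    fix j assume j: "j \<in> {..<n}"
    have "mat_delete (recip_mat n a) (n - 1) j =
        mat (n - 1) (n - 1) (\<lambda>(i, k). 1 / of_int (a (i, insert_index j k)))"
      using j by (intro eq_matI) (auto simp: mat_delete_def recip_mat_def recip_def insert_index_def)
    then show "recip_mat n a $$ (n - 1, j) * cofactor (recip_mat n a) (n - 1) j = last_cofactor n a j / of_int (a (n - 1, j))"
      using j assms by (simp add: cofactor_def last_cofactor_def recip_mat_def recip_def)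
  qed
  finally show ?thesis .
qed

lemma last_cofactor_cong:
  assumes "\<And>z. z \<in> {..<n - 1} \<times> {..<n} \<Longrightarrow> a z = a' z" "j < n"
  shows "last_cofactor n a j = last_cofactor n a' j"
proof -
  have "mat (n - 1) (n - 1) (\<lambda>(i, k). 1 / of_int (a (i, insert_index j k))) =
        mat (n - 1) (n - 1) (\<lambda>(i, k). 1 / of_int (a' (i, insert_index j k)) :: rat)"
    using assms by (intro eq_matI) (auto simp: insert_index_def)
  then show ?thesis by (simp add: last_cofactor_def)
qed

text \<open>The first \<open>n - 1\<close> rows are arbitrary and determine the cofactors; the last
  row is then a solution of the equation with right-hand side \<delta>.\<close>

lemma card_nonzero_cofactors_le:
  assumes n: "n \<ge> 1" and SB: "\<And>L. Sol_bound n L (- {0}) c" and eps: "\<epsilon> > 0"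
  shows "\<exists>K\<ge>1. \<forall>H\<ge>1. \<forall>\<delta>. \<delta> \<noteq> 0 \<longrightarrow>
    real (card {a \<in> det_arrays n H \<delta>. \<forall>j<n. last_cofactor n a j \<noteq> 0}) \<le> K * H powr (real (n * (n - 1)) + c + \<epsilon>)"
proof -
  define L where "L = (fact n :: nat) + n * n"
  obtain K where K: "K \<ge> 1" "\<And>H I \<alpha> b. H \<ge> 1 \<Longrightarrow> rat_admissible L H I \<alpha> \<Longrightarrow> card I = n \<Longrightarrow> b \<in> - {0} \<Longrightarrow>
    real (card (rat_Sol I \<alpha> b H)) \<le> K * H powr (c + \<epsilon>)"
    by (rule card_rat_Sol_le[OF SB _ eps]) (auto intro: that)
  define U where "U = {..<n - 1} \<times> {..<n}"
  have U: "finite U" "U \<subseteq> {..<n} \<times> {..<n}" "card U = n * (n - 1)"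
    by (auto simp: U_def card_cartesian_product)
  show ?thesis
  proof (intro exI[of _ "2 ^ (n * (n - 1)) * K"] conjI allI impI)
    show "1 \<le> 2 ^ (n * (n - 1)) * K" using K(1) mult_mono[of 1 "2 ^ (n * (n - 1))" 1 K] by simp
    fix H :: real and \<delta> :: rat assume H: "H \<ge> 1" and \<delta>: "\<delta> \<noteq> 0"
    let ?S = "{a \<in> det_arrays n H \<delta>. \<forall>j<n. last_cofactor n a j \<noteq> 0}"
    have "real (card ?S) \<le> real (card (PiE U (\<lambda>_. nz H))) * (K * H powr (c + \<epsilon>))"
    proof (rule card_le_fibers[where h = "\<lambda>a. restrict a U"])
      show "finite (PiE U (\<lambda>_. nz H))" using U by (intro finite_PiE) auto
      show "(\<lambda>a. restrict a U) ` ?S \<subseteq> PiE U (\<lambda>_. nz H)"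
        using U by (intro image_subsetI restrict_int_arrays) (auto simp: det_arrays_def)
      fix b
      show "real (card {a \<in> ?S. restrict a U = b}) \<le> K * H powr (c + \<epsilon>)" (is "real (card ?R) \<le> _")
      proof (cases "?R = {}")
        case True
        have "0 \<le> K * H powr (c + \<epsilon>)" using K(1) by simp
        then show ?thesis by (simp only: True card.empty of_nat_0)
      next
        case False
        then obtain a0 where a0: "a0 \<in> ?S" "restrict a0 U = b" by auto
        define \<alpha> where "\<alpha> = last_cofactor n a0"
        have nz0: "a0 z \<in> nz H" if "z \<in> {..<n} \<times> {..<n}" for z
          using a0 that int_arrays_nz by (auto simp: det_arrays_def)
        have adm: "rat_admissible L H {..<n} \<alpha>"
        proof (rule rat_admissible_minors[where Z = U and a = a0 and s = "n - 1" and u = "\<lambda>j. n - 1 + j"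
              and \<phi> = "\<lambda>j i k. (i, insert_index j k)"])
          show "a0 z \<in> nz H" if "z \<in> U" for z using nz0 that U(2) by blast
          show "card U \<le> L" using U(3) by (simp add: L_def trans_le_add2)
          show "fact (n - 1) \<le> L" using fact_mono[of "n - 1" n, where 'a = nat] by (simp add: L_def)
          show "\<alpha> j \<noteq> 0" if "j \<in> {..<n}" for j using a0 that by (auto simp: \<alpha>_def)
          show "\<alpha> j = (- 1) ^ (n - 1 + j) * det (mat (n - 1) (n - 1)
             (\<lambda>(i, k). 1 / of_int (a0 (i, insert_index j k))))" for j
            by (simp add: \<alpha>_def last_cofactor_def)
          show "(i, insert_index j k) \<in> U" if "i < n - 1" "k < n - 1" for j i k
            using that by (auto simp: U_def insert_index_def)
        qed (use U H in auto)
        define \<psi> where "\<psi> a = (\<lambda>j\<in>{..<n}. a (n - 1, j))" for a :: "nat \<times> nat \<Rightarrow> int"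
        have agree: "a z = a' z" if "a \<in> ?R" "a' \<in> ?R" "z \<in> U" for a a' z
        proof -
          have "restrict a U z = restrict a' U z" using that by simp
          then show ?thesis using that by simp
        qed
        have "card ?R \<le> card (rat_Sol {..<n} \<alpha> \<delta> H)"
        proof (rule card_inj_on_le)
          show "inj_on \<psi> ?R"
          proof (rule inj_onI)
            fix a a' assume a: "a \<in> ?R" and a': "a' \<in> ?R" and eq: "\<psi> a = \<psi> a'"
            have "a z = a' z" if z: "z \<in> {..<n} \<times> {..<n}" for z
            proof (cases "z \<in> U")
              case True
              then show ?thesis by (rule agree[OF a a'])
            next
              case False
              obtain i j where ij: "z = (i, j)" "i < n" "j < n" using z by auto
              then have "i = n - 1" using False by (simp add: U_def)
              with ij have j: "z = (n - 1, j)" "j < n" by auto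
              have "\<psi> a j = \<psi> a' j" using eq by simp
              then show ?thesis using j by (simp add: \<psi>_def)
            qed
            then show "a = a'" using a a'
              by (intro PiE_ext[of a "{..<n} \<times> {..<n}" "\<lambda>_. nz H" a']) (auto simp: det_arrays_def int_arrays_def)
          qed
          show "\<psi> ` ?R \<subseteq> rat_Sol {..<n} \<alpha> \<delta> H"
          proof (rule image_subsetI)
            fix a assume a: "a \<in> ?R"
            have "a0 \<in> ?R" using a0 by simp
            then have \<alpha>: "\<alpha> j = last_cofactor n a j" if "j < n" for j
              unfolding \<alpha>_def using agree[OF _ a] that by (intro last_cofactor_cong) (auto simp: U_def)
            have "(\<Sum>j<n. \<alpha> j / of_int (\<psi> a j)) = (\<Sum>j<n. last_cofactor n a j / of_int (a (n - 1, j)))"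
              by (intro sum.cong) (auto simp: \<psi>_def \<alpha>)
            also have "\<dots> = \<delta>" using a n det_recip_mat_expand[of n a] by (simp add: det_arrays_def)
            finally show "\<psi> a \<in> rat_Sol {..<n} \<alpha> \<delta> H"
              unfolding rat_Sol_def using a n by (auto simp: \<psi>_def det_arrays_def intro!: int_arrays_nz)
          qed
        qed simp
        then have "real (card ?R) \<le> real (card (rat_Sol {..<n} \<alpha> \<delta> H))" unfolding of_nat_le_iff .
        also have "\<dots> \<le> K * H powr (c + \<epsilon>)" using \<delta> by (intro K(2) H adm) auto
        finally show ?thesis .
      qed
    qed
    also have "\<dots> \<le> (2 * H) ^ card U * (K * H powr (c + \<epsilon>))"
      using K(1) by (intro mult_right_mono card_PiE_nz_le U H) auto
    also have "\<dots> = 2 ^ (n * (n - 1)) * K * (H powr real (n * (n - 1)) * H powr (c + \<epsilon>))"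
      unfolding U(3) using H by (simp add: power_mult_distrib powr_realpow[symmetric] del: of_nat_mult)
    also have "\<dots> = 2 ^ (n * (n - 1)) * K * H powr (real (n * (n - 1)) + c + \<epsilon>)"
      by (simp add: powr_add[symmetric] add.assoc del: of_nat_mult)
    finally show "real (card ?S) \<le> 2 ^ (n * (n - 1)) * K * H powr (real (n * (n - 1)) + c + \<epsilon>)" .
  qed
qed

text \<open>Deleting the last row and the column \<open>j0\<close> leaves a singular matrix. Of the
  2 n - 1 deleted entries, the one at \<open>(n - 1, j1)\<close> is determined by the expansion of
  the determinant, since its cofactor is nonzero; the other 2 (n - 1) are free and make up
  \<open>W\<close>.\<close>

lemma card_zero_cofactor_le:
  assumes n: "n \<ge> 1" and H: "H \<ge> 1" and j: "j0 < n" "j1 < n"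
  shows "real (card {a \<in> det_arrays n H \<delta>. last_cofactor n a j0 = 0 \<and> last_cofactor n a j1 \<noteq> 0})
    \<le> real (card (det_arrays (n - 1) H 0)) * (2 * H) ^ (2 * (n - 1))"
proof -
  let ?S = "{a \<in> det_arrays n H \<delta>. last_cofactor n a j0 = 0 \<and> last_cofactor n a j1 \<noteq> 0}"
  define W where "W = {..<n - 1} \<times> {j0} \<union> {n - 1} \<times> ({..<n} - {j1})"
  have W: "finite W" "W \<subseteq> {..<n} \<times> {..<n}" using j n by (auto simp: W_def)
  have cW: "card W = 2 * (n - 1)"
    unfolding W_def using j by (subst card_Un_disjoint) (auto simp: card_cartesian_product)
  define \<psi> where "\<psi> a = (\<lambda>z\<in>{..<n - 1} \<times> {..<n - 1}. a (fst z, insert_index j0 (snd z)))" for a :: "nat \<times> nat \<Rightarrow> int"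
  have "card ?S \<le> card (det_arrays (n - 1) H 0 \<times> PiE W (\<lambda>_. nz H))"
  proof (rule card_inj_on_le[of "\<lambda>a. (\<psi> a, restrict a W)"])
    show "inj_on (\<lambda>a. (\<psi> a, restrict a W)) ?S"
    proof (rule inj_onI)
      fix a a' assume a: "a \<in> ?S" and a': "a' \<in> ?S" and eq: "(\<psi> a, restrict a W) = (\<psi> a', restrict a' W)"
      have agW: "a z = a' z" if "z \<in> W" for z
      proof -
        have "restrict a W z = restrict a' W z" using eq by simp
        then show ?thesis using that by simp
      qed
      have agU: "a z = a' z" if z: "z \<in> {..<n - 1} \<times> {..<n}" for z
      proof -
        obtain i l where il: "z = (i, l)" "i < n - 1" "l < n" using z by auto
        show ?thesis
        proof (cases "l = j0")
          case True
          then show ?thesis using il by (intro agW) (auto simp: W_def)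
        next
          case False
          have "delete_index j0 l < n - 1" using False il(3) j by (auto simp: delete_index_def)
          moreover have "\<psi> a (i, delete_index j0 l) = \<psi> a' (i, delete_index j0 l)" using eq by simp
          ultimately show ?thesis using il by (simp add: \<psi>_def insert_delete_index[OF False])
        qed
      qed
      have "last_cofactor n a l = last_cofactor n a' l" if "l < n" for l
        by (rule last_cofactor_cong[OF agU that])
      then have cof: "last_cofactor n a' l = last_cofactor n a l" if "l < n" for l using that by simp
      have "(\<Sum>l<n. last_cofactor n a l / of_int (a (n - 1, l))) = (\<Sum>l<n. last_cofactor n a l / of_int (a' (n - 1, l)))"
        using a a' n det_recip_mat_expand[of n a] det_recip_mat_expand[of n a'] cof by (simp add: det_arrays_def)
      moreover have "(\<Sum>l\<in>{..<n} - {j1}. last_cofactor n a l / of_int (a (n - 1, l))) =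
          (\<Sum>l\<in>{..<n} - {j1}. last_cofactor n a l / of_int (a' (n - 1, l)))"
      proof (intro sum.cong refl)
        fix l assume "l \<in> {..<n} - {j1}"
        then have "a (n - 1, l) = a' (n - 1, l)" by (intro agW) (auto simp: W_def)
        then show "last_cofactor n a l / of_int (a (n - 1, l)) = last_cofactor n a l / of_int (a' (n - 1, l))" by simp
      qed
      ultimately have "last_cofactor n a j1 / of_int (a (n - 1, j1)) = last_cofactor n a j1 / of_int (a' (n - 1, j1))"
        using j(2) by (simp add: sum.remove[of "{..<n}" j1])
      moreover have "a (n - 1, j1) \<in> nz H" "a' (n - 1, j1) \<in> nz H"
        using a a' n j by (auto simp: det_arrays_def intro!: int_arrays_nz)
      ultimately have ag1: "a (n - 1, j1) = a' (n - 1, j1)"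
        using a nz_nonzero by (auto simp: field_simps)
      have "a z = a' z" if z: "z \<in> {..<n} \<times> {..<n}" for z
      proof -
        consider "z \<in> {..<n - 1} \<times> {..<n}" | "z \<in> W" | "z = (n - 1, j1)" using z by (force simp: W_def)
        then show ?thesis using agU agW ag1 by cases auto
      qed
      then show "a = a'" using a a'
        by (intro PiE_ext[of a "{..<n} \<times> {..<n}" "\<lambda>_. nz H" a']) (auto simp: det_arrays_def int_arrays_def)
    qed
    show "(\<lambda>a. (\<psi> a, restrict a W)) ` ?S \<subseteq> det_arrays (n - 1) H 0 \<times> PiE W (\<lambda>_. nz H)"
    proof (rule image_subsetI, rule SigmaI)
      fix a assume a: "a \<in> ?S"
      then have aI: "a \<in> int_arrays n H" by (simp add: det_arrays_def)
      show "restrict a W \<in> PiE W (\<lambda>_. nz H)" by (rule restrict_int_arrays[OF aI W(2)])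
      have "\<psi> a \<in> int_arrays (n - 1) H"
        unfolding int_arrays_def \<psi>_def using j
        by (auto intro!: int_arrays_nz[OF aI] simp: insert_index_def)
      moreover have "recip_mat (n - 1) (\<psi> a) =
          mat (n - 1) (n - 1) (\<lambda>(i, k). 1 / of_int (a (i, insert_index j0 k)))"
        by (intro eq_matI) (auto simp: recip_mat_def recip_def \<psi>_def)
      ultimately show "\<psi> a \<in> det_arrays (n - 1) H 0"
        using a by (auto simp: det_arrays_def last_cofactor_def)
    qed
    show "finite (det_arrays (n - 1) H 0 \<times> PiE W (\<lambda>_. nz H))"
      using W by (intro finite_cartesian_product finite_PiE) auto
  qed
  then have "real (card ?S) \<le> real (card (det_arrays (n - 1) H 0) * card (PiE W (\<lambda>_. nz H)))"
    unfolding of_nat_le_iff by (simp add: card_cartesian_product)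
  also have "\<dots> \<le> real (card (det_arrays (n - 1) H 0)) * (2 * H) ^ card W"
    unfolding of_nat_mult by (intro mult_left_mono card_PiE_nz_le W H) auto
  finally show ?thesis by (simp only: cW)
qed

text \<open>A nonzero determinant has a nonzero cofactor in the last row. If another cofactor
  vanishes, the pair of them yields the count through singular matrices of order
  \<open>n - 1\<close>. The two inequalities are the prices of the two cases.\<close>

lemma det_bound_nonzero:
  assumes n: "n \<ge> 1" and SB: "\<And>L. Sol_bound n L (- {0}) c" and DB: "det_bound (n - 1) {0} s'"
    and le: "real (n * (n - 1)) + c \<le> s" "s' + real (2 * (n - 1)) \<le> s"
  shows "det_bound n (- {0}) s"
  unfolding det_bound_def
proof (intro allI impI)
  fix \<epsilon> :: real assume eps: "\<epsilon> > 0"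
  obtain K1 where K1: "K1 \<ge> 1" "\<forall>H\<ge>1. \<forall>\<delta>. \<delta> \<noteq> 0 \<longrightarrow>
    real (card {a \<in> det_arrays n H \<delta>. \<forall>j<n. last_cofactor n a j \<noteq> 0}) \<le> K1 * H powr (real (n * (n - 1)) + c + \<epsilon>)"
    using card_nonzero_cofactors_le[OF n SB eps] by blast
  obtain K2 where K2: "K2 \<ge> 1" "\<forall>H\<ge>1. real (card (det_arrays (n - 1) H 0)) \<le> K2 * H powr (s' + \<epsilon>)"
    using DB eps unfolding det_bound_def by blast
  define q where "q = 2 * (n - 1)"
  show "\<exists>K\<ge>1. \<forall>H\<ge>1. \<forall>\<delta>\<in>- {0}. real (card (det_arrays n H \<delta>)) \<le> K * H powr (s + \<epsilon>)"
  proof (intro exI[of _ "K1 + real (n * n) * (K2 * 2 ^ q)"] conjI allI impI ballI)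
    have "0 \<le> real (n * n) * (K2 * 2 ^ q)" using K2(1) by (intro mult_nonneg_nonneg) auto
    then show "1 \<le> K1 + real (n * n) * (K2 * 2 ^ q)" using K1(1) by linarith
    fix H :: real and \<delta> :: rat assume H: "H \<ge> 1" and \<delta>: "\<delta> \<in> - {0}"
    define S0 where "S0 = {a \<in> det_arrays n H \<delta>. \<forall>j<n. last_cofactor n a j \<noteq> 0}"
    define S where "S j0 j1 = {a \<in> det_arrays n H \<delta>. last_cofactor n a j0 = 0 \<and> last_cofactor n a j1 \<noteq> 0}" for j0 j1
    have cover: "det_arrays n H \<delta> \<subseteq> S0 \<union> (\<Union>j0\<in>{..<n}. \<Union>j1\<in>{..<n}. S j0 j1)"
    proof
      fix a assume a: "a \<in> det_arrays n H \<delta>"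
      have "(\<Sum>j<n. last_cofactor n a j / of_int (a (n - 1, j))) \<noteq> 0"
        using a n \<delta> det_recip_mat_expand[of n a] by (simp add: det_arrays_def)
      then obtain j1 where "j1 < n" "last_cofactor n a j1 \<noteq> 0"
        by (metis (no_types, lifting) div_0 lessThan_iff sum.neutral)
      then show "a \<in> S0 \<union> (\<Union>j0\<in>{..<n}. \<Union>j1\<in>{..<n}. S j0 j1)"
        using a by (auto simp: S0_def S_def)
    qed
    have fin: "finite S0" "finite (S i j)" for i j by (auto simp: S0_def S_def)
    have c0: "real (card S0) \<le> K1 * H powr (s + \<epsilon>)"
    proof -
      have "real (card S0) \<le> K1 * H powr (real (n * (n - 1)) + c + \<epsilon>)"
        unfolding S0_def using K1(2) H \<delta> by simp
      also have "\<dots> \<le> K1 * H powr (s + \<epsilon>)"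
        using le(1) K1(1) H by (intro mult_left_mono powr_mono) auto
      finally show ?thesis .
    qed
    have c1: "real (card (S j0 j1)) \<le> K2 * 2 ^ q * H powr (s + \<epsilon>)" if "j0 \<in> {..<n}" "j1 \<in> {..<n}" for j0 j1
    proof -
      have "real (card (S j0 j1)) \<le> real (card (det_arrays (n - 1) H 0)) * (2 * H) ^ q"
        unfolding S_def q_def using that by (intro card_zero_cofactor_le n H) auto
      also have "\<dots> \<le> (K2 * H powr (s' + \<epsilon>)) * (2 * H) ^ q"
        using K2(2) H by (intro mult_right_mono) auto
      also have "\<dots> = K2 * 2 ^ q * (H powr (s' + \<epsilon>) * H powr real q)"
        using H by (simp add: power_mult_distrib powr_realpow)
      also have "\<dots> = K2 * 2 ^ q * H powr (s' + \<epsilon> + real q)" by (simp add: powr_add)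
      also have "\<dots> \<le> K2 * 2 ^ q * H powr (s + \<epsilon>)"
        using le(2) K2(1) H by (intro mult_left_mono powr_mono) (auto simp: q_def)
      finally show ?thesis .
    qed
    have "card (det_arrays n H \<delta>) \<le> card S0 + (\<Sum>j0\<in>{..<n}. \<Sum>j1\<in>{..<n}. card (S j0 j1))"
    proof -
      have "card (\<Union>j0\<in>{..<n}. \<Union>j1\<in>{..<n}. S j0 j1) \<le> (\<Sum>j0\<in>{..<n}. \<Sum>j1\<in>{..<n}. card (S j0 j1))"
        by (intro order.trans[OF card_UN_le] sum_mono) auto
      moreover have "card (det_arrays n H \<delta>) \<le> card S0 + card (\<Union>j0\<in>{..<n}. \<Union>j1\<in>{..<n}. S j0 j1)"
        using fin by (intro order.trans[OF card_mono[OF _ cover] card_Un_le]) auto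
      ultimately show ?thesis by linarith
    qed
    then have "real (card (det_arrays n H \<delta>)) \<le> real (card S0 + (\<Sum>j0\<in>{..<n}. \<Sum>j1\<in>{..<n}. card (S j0 j1)))"
      unfolding of_nat_le_iff .
    also have "\<dots> = real (card S0) + (\<Sum>j0\<in>{..<n}. \<Sum>j1\<in>{..<n}. real (card (S j0 j1)))" by simp
    also have "\<dots> \<le> K1 * H powr (s + \<epsilon>) + (\<Sum>j0\<in>{..<n}. \<Sum>j1\<in>{..<n}. K2 * 2 ^ q * H powr (s + \<epsilon>))"
      by (intro add_mono sum_mono c0 c1)
    also have "\<dots> = (K1 + real (n * n) * (K2 * 2 ^ q)) * H powr (s + \<epsilon>)" by (simp add: algebra_simps)
    finally show "real (card (det_arrays n H \<delta>)) \<le> (K1 + real (n * n) * (K2 * 2 ^ q)) * H powr (s + \<epsilon>)" .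
  qed
qed

section \<open>Matrices of order two\<close>

lemma det_recip_mat_2:
  "det (recip_mat 2 a) = 1 / of_int (a (0, 0) * a (1, 1)) - 1 / of_int (a (0, 1) * a (1, 0))"
proof -
  have "det (mat 1 1 (\<lambda>(i, k). 1 / of_int (a (i, insert_index j k))) :: rat mat) = 1 / of_int (a (0, insert_index j 0))" for j
    by (subst det_single) auto
  then show ?thesis
    using det_recip_mat_expand[of 2 a]
    by (simp add: last_cofactor_def numeral_2_eq_2 insert_index_def mult.commute)
qed

lemma int_arrays_2_ext:
  assumes "a \<in> int_arrays 2 H" "a' \<in> int_arrays 2 H"
    "a (0, 0) = a' (0, 0)" "a (0, 1) = a' (0, 1)" "a (1, 0) = a' (1, 0)" "a (1, 1) = a' (1, 1)"
  shows "a = a'"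
proof (rule PiE_ext[OF assms(1,2)[unfolded int_arrays_def]])
  fix z assume "z \<in> {..<2::nat} \<times> {..<2::nat}"
  then have "z \<in> {(0, 0), (0, 1), (1, 0), (1, 1)}" by (auto simp: less_2_cases_iff)
  then show "a z = a' z" using assms(3-) by auto
qed

lemma mult_in_nz:
  assumes "x \<in> nz H" "y \<in> nz H"
  shows "x * y \<in> nz (H\<^sup>2)"
proof -
  have "real_of_int \<bar>x\<bar> * real_of_int \<bar>y\<bar> \<le> H * H" using assms by (intro mult_mono) (auto simp: nz_def)
  moreover have "x * y \<noteq> 0" using assms nz_nonzero by simp
  then have "1 \<le> \<bar>x * y\<bar>" by linarith
  ultimately show ?thesis by (simp add: nz_def abs_mult power2_eq_square)
qed

lemma card_int_divisors_nz_le: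
  assumes "\<epsilon> > 0"
  shows "\<exists>K\<ge>1. \<forall>H\<ge>1. \<forall>m\<in>nz (H\<^sup>2). finite {d. d dvd m} \<and> real (card {d. d dvd m}) \<le> K * H powr \<epsilon>"
proof -
  have e: "\<epsilon> / 2 > 0" using assms by simp
  obtain K where K: "K > 0" "\<And>m::nat. m > 0 \<Longrightarrow> real (card {d. d dvd m}) \<le> K * real m powr (\<epsilon> / 2)"
    using card_divisors_le[OF e] by blast
  show ?thesis
  proof (intro exI[of _ "max 1 (2 * K)"] conjI allI impI ballI)
    fix H :: real and m :: int assume H: "H \<ge> 1" and m: "m \<in> nz (H\<^sup>2)"
    have m0: "nat \<bar>m\<bar> > 0" using nz_nonzero[OF m] by simp
    have eq: "{d. d dvd m} = {d. d dvd int (nat \<bar>m\<bar>)}" by auto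
    show "finite {d. d dvd m}" unfolding eq using card_int_divisors_le[OF m0] by blast
    have "real (card {d. d dvd m}) \<le> 2 * real (card {d. d dvd nat \<bar>m\<bar>})"
      unfolding eq using card_int_divisors_le[OF m0] by linarith
    also have "\<dots> \<le> 2 * (K * real (nat \<bar>m\<bar>) powr (\<epsilon> / 2))" using K(2)[OF m0] by simp
    also have "\<dots> \<le> 2 * (K * (H\<^sup>2) powr (\<epsilon> / 2))"
      using m K(1) e by (intro mult_left_mono powr_mono2) (auto simp: nz_def)
    also have "(H\<^sup>2) powr (\<epsilon> / 2) = H powr \<epsilon>"
      using H by (simp add: powr_realpow[symmetric] powr_powr flip: powr_numeral)
    also have "2 * (K * H powr \<epsilon>) \<le> max 1 (2 * K) * H powr \<epsilon>"
      unfolding mult.assoc[symmetric] by (intro mult_right_mono) auto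
    finally show "real (card {d. d dvd m}) \<le> max 1 (2 * K) * H powr \<epsilon>" .
  qed simp
qed

text \<open>The determinant vanishes when the products of the two diagonals agree. The main diagonal
  is free, and the other entries form a factorisation of its product, of which there are
  H^(o(1)).\<close>

lemma det_bound_2_zero: "det_bound 2 {0} 2"
  unfolding det_bound_def
proof (intro allI impI)
  fix \<epsilon> :: real assume eps: "\<epsilon> > 0"
  obtain K where K: "K \<ge> 1" "\<forall>H\<ge>1. \<forall>m\<in>nz (H\<^sup>2). finite {d. d dvd m} \<and> real (card {d. d dvd m}) \<le> K * H powr \<epsilon>"
    using card_int_divisors_nz_le[OF eps] by blast
  show "\<exists>K\<ge>1. \<forall>H\<ge>1. \<forall>\<delta>\<in>{0}. real (card (det_arrays 2 H \<delta>)) \<le> K * H powr (2 + \<epsilon>)"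
  proof (intro exI[of _ "4 * K"] conjI allI impI ballI)
    show "1 \<le> 4 * K" using K(1) by simp
    fix H :: real and \<delta> :: rat assume H: "H \<ge> 1" and \<delta>: "\<delta> \<in> {0}"
    have rel: "a (0, 1) * a (1, 0) = a (0, 0) * a (1, 1)" and nz: "a (0, 0) \<in> nz H" "a (0, 1) \<in> nz H" "a (1, 0) \<in> nz H" "a (1, 1) \<in> nz H"
      if "a \<in> det_arrays 2 H 0" for a
    proof -
      show nz: "a (0, 0) \<in> nz H" "a (0, 1) \<in> nz H" "a (1, 0) \<in> nz H" "a (1, 1) \<in> nz H"
        using that by (auto simp: det_arrays_def intro!: int_arrays_nz)
      have "(1 / of_int (a (0, 0) * a (1, 1)) :: rat) = 1 / of_int (a (0, 1) * a (1, 0))"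
        using that by (simp add: det_arrays_def det_recip_mat_2)
      then have "(of_int (a (0, 1) * a (1, 0)) :: rat) = of_int (a (0, 0) * a (1, 1))"
        using nz[THEN nz_nonzero] by (simp add: field_simps)
      then show "a (0, 1) * a (1, 0) = a (0, 0) * a (1, 1)" by (simp only: of_int_eq_iff)
    qed
    have "real (card (det_arrays 2 H 0)) \<le> real (card (nz H \<times> nz H)) * (K * H powr \<epsilon>)"
    proof (rule card_le_fibers[where h = "\<lambda>a. (a (0, 0), a (1, 1))"])
      show "(\<lambda>a. (a (0, 0), a (1, 1))) ` det_arrays 2 H 0 \<subseteq> nz H \<times> nz H" using nz by auto
      fix b assume b: "b \<in> nz H \<times> nz H"
      define m where "m = fst b * snd b"
      have m: "m \<in> nz (H\<^sup>2)" unfolding m_def using b by (intro mult_in_nz) auto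
      let ?R = "{a \<in> det_arrays 2 H 0. (a (0, 0), a (1, 1)) = b}"
      have "card ?R \<le> card {d. d dvd m}"
      proof (rule card_inj_on_le[of "\<lambda>a. a (0, 1)"])
        show "inj_on (\<lambda>a. a (0, 1)) ?R"
        proof (rule inj_onI)
          fix a a' assume a: "a \<in> ?R" and a': "a' \<in> ?R" and eq: "a (0, 1) = a' (0, 1)"
          have d: "a (0, 0) = a' (0, 0)" "a (1, 1) = a' (1, 1)" using a a' by auto
          have "a (0, 1) * a (1, 0) = a (0, 1) * a' (1, 0)"
            using rel[of a] rel[of a'] a a' d eq by simp
          then have "a (1, 0) = a' (1, 0)" using nz(2)[of a] a nz_nonzero by fastforce
          then show "a = a'" using a a' d eq
            by (intro int_arrays_2_ext[of a H a']) (auto simp: det_arrays_def)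
        qed
        show "(\<lambda>a. a (0, 1)) ` ?R \<subseteq> {d. d dvd m}"
        proof (rule image_subsetI)
          fix a assume a: "a \<in> ?R"
          then have "m = a (0, 1) * a (1, 0)" using rel[of a] by (auto simp: m_def)
          then show "a (0, 1) \<in> {d. d dvd m}" by simp
        qed
        show "finite {d. d dvd m}" using K(2) H m by blast
      qed
      also have "real \<dots> \<le> K * H powr \<epsilon>" using K(2) H m by blast
      finally show "real (card ?R) \<le> K * H powr \<epsilon>" by simp
    qed simp
    also have "\<dots> \<le> ((2 * H) * (2 * H)) * (K * H powr \<epsilon>)"
      unfolding card_cartesian_product of_nat_mult
      using card_nz_le[of H] H K(1) by (intro mult_right_mono mult_mono) auto
    also have "\<dots> = 4 * K * (H powr 2 * H powr \<epsilon>)" using H by (simp add: power2_eq_square)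
    also have "\<dots> = 4 * K * H powr (2 + \<epsilon>)" by (simp only: powr_add)
    finally show "real (card (det_arrays 2 H \<delta>)) \<le> 4 * K * H powr (2 + \<epsilon>)" using \<delta> by simp
  qed
qed

text \<open>The determinant is a two-variable equation, with coefficients 1 and -1, in the products
  of the two diagonals, which range up to H^2. Each product then splits in H^(o(1)) ways. Expansion
  along a row would leave the other row free and cost H^2.\<close>

lemma det_bound_2_nonzero: "det_bound 2 (- {0}) 0"
  unfolding det_bound_def
proof (intro allI impI)
  fix \<epsilon> :: real assume eps: "\<epsilon> > 0"
  \<comment> \<open>The equation with variables up to H^2 costs H^(2 e), and the two factorisations
    cost H^e each.\<close>
  define e where "e = \<epsilon> / 4"
  have e: "e > 0" using eps by (simp add: e_def)
  obtain K where K: "K \<ge> 1" "\<forall>H\<ge>1. \<forall>m\<in>nz (H\<^sup>2). finite {d. d dvd m} \<and> real (card {d. d dvd m}) \<le> K * H powr e"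
    using card_int_divisors_nz_le[OF e] by blast
  obtain K1 where K1: "K1 > 0" "\<And>H I A b. H \<ge> 1 \<Longrightarrow> admissible 1 H I A \<Longrightarrow> card I = 2 \<Longrightarrow> b \<in> - {0} \<Longrightarrow>
     real (card (Sol I A b H)) \<le> K1 * H powr (0 + e)"
    by (rule Sol_boundE[OF Sol_bound_2 e]) (rule that)
  define A where "A = (\<lambda>i::nat. if i = 0 then 1 else - 1 :: int)"
  show "\<exists>K\<ge>1. \<forall>H\<ge>1. \<forall>\<delta>\<in>- {0}. real (card (det_arrays 2 H \<delta>)) \<le> K * H powr (0 + \<epsilon>)"
  proof (intro exI[of _ "max 1 (K1 * K * K)"] conjI allI impI ballI)
    fix H :: real and \<delta> :: rat assume H: "H \<ge> 1" and \<delta>: "\<delta> \<in> - {0}"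
    have H2: "H\<^sup>2 \<ge> 1" using H by simp
    let ?X = "Sol {0, 1} A \<delta> (H\<^sup>2)"
    define h where "h a = (\<lambda>i\<in>{0, 1::nat}. if i = 0 then a (0, 0) * a (1, 1) else a (0, 1) * a (1, 0))"
      for a :: "nat \<times> nat \<Rightarrow> int"
    have nz: "a (0, 0) \<in> nz H" "a (0, 1) \<in> nz H" "a (1, 0) \<in> nz H" "a (1, 1) \<in> nz H"
      if "a \<in> det_arrays 2 H \<delta>" for a
      using that by (auto simp: det_arrays_def intro!: int_arrays_nz)
    have "real (card (det_arrays 2 H \<delta>)) \<le> real (card ?X) * ((K * H powr e) * (K * H powr e))"
    proof (rule card_le_fibers[where h = h])
      show "h ` det_arrays 2 H \<delta> \<subseteq> ?X"
      proof (rule image_subsetI)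
        fix a assume a: "a \<in> det_arrays 2 H \<delta>"
        have "(\<Sum>i\<in>{0, 1}. of_int (A i) / of_int (h a i)) = \<delta>"
          using a by (simp add: A_def h_def det_arrays_def det_recip_mat_2)
        moreover have "h a \<in> PiE {0, 1} (\<lambda>_. nz (H\<^sup>2))"
          using nz[OF a] by (auto simp: h_def intro!: mult_in_nz)
        ultimately show "h a \<in> ?X" by (simp add: Sol_def)
      qed
      fix b assume b: "b \<in> ?X"
      let ?R = "{a \<in> det_arrays 2 H \<delta>. h a = b}"
      have bn: "b 0 \<in> nz (H\<^sup>2)" "b 1 \<in> nz (H\<^sup>2)" using Sol_nz[OF b] by auto
      have hb: "b 0 = a (0, 0) * a (1, 1)" "b 1 = a (0, 1) * a (1, 0)" if "a \<in> ?R" for a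
        using that by (auto simp: h_def)
      have "card ?R \<le> card ({d. d dvd b 0} \<times> {d. d dvd b 1})"
      proof (rule card_inj_on_le[of "\<lambda>a. (a (0, 0), a (0, 1))"])
        show "inj_on (\<lambda>a. (a (0, 0), a (0, 1))) ?R"
        proof (rule inj_onI)
          fix a a' assume a: "a \<in> ?R" and a': "a' \<in> ?R" and eq: "(a (0, 0), a (0, 1)) = (a' (0, 0), a' (0, 1))"
          have "a (0, 0) \<noteq> 0" "a (0, 1) \<noteq> 0" using nz[of a] a nz_nonzero by auto
          then have "a (1, 1) = a' (1, 1)" "a (1, 0) = a' (1, 0)"
            using hb[OF a] hb[OF a'] eq by auto
          then show "a = a'" using a a' eq
            by (intro int_arrays_2_ext[of a H a']) (auto simp: det_arrays_def)
        qed
        show "(\<lambda>a. (a (0, 0), a (0, 1))) ` ?R \<subseteq> {d. d dvd b 0} \<times> {d. d dvd b 1}"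
          using hb by auto
        show "finite ({d. d dvd b 0} \<times> {d. d dvd b 1})" using K(2) H bn by blast
      qed
      then have "real (card ?R) \<le> real (card {d. d dvd b 0}) * real (card {d. d dvd b 1})"
        unfolding card_cartesian_product of_nat_mult[symmetric] of_nat_le_iff .
      also have "\<dots> \<le> (K * H powr e) * (K * H powr e)"
        using K H bn by (intro mult_mono) auto
      finally show "real (card ?R) \<le> (K * H powr e) * (K * H powr e)" .
    qed simp
    also have "\<dots> \<le> (K1 * (H\<^sup>2) powr (0 + e)) * ((K * H powr e) * (K * H powr e))"
    proof (intro mult_right_mono K1(2) H2 \<delta>)
      show "admissible 1 (H\<^sup>2) {0, 1} A" using H2 by (auto simp: admissible_def A_def)
    qed (use K in auto)
    also have "(H\<^sup>2) powr (0 + e) = H powr (2 * e)"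
      using H by (simp add: powr_powr flip: powr_numeral)
    also have "K1 * H powr (2 * e) * ((K * H powr e) * (K * H powr e)) = K1 * K * K * (H powr (2 * e) * (H powr e * H powr e))"
      by (simp add: mult_ac)
    also have "H powr (2 * e) * (H powr e * H powr e) = H powr (0 + \<epsilon>)"
      by (simp add: powr_add[symmetric] e_def)
    also have "K1 * K * K * H powr (0 + \<epsilon>) \<le> max 1 (K1 * K * K) * H powr (0 + \<epsilon>)"
      by (intro mult_right_mono) auto
    finally show "real (card (det_arrays 2 H \<delta>)) \<le> max 1 (K1 * K * K) * H powr (0 + \<epsilon>)" .
  qed simp
qed

section \<open>The exponents for each order\<close>

lemma det_bound_3_nonzero: "det_bound 3 (- {0}) 7"
\<comment> \<open>Nonzero cofactors cost 6 + 1 = 7; a vanishing one costs 2 for a singular matrix of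
  order two and 4 for the free entries.\<close>
proof (rule det_bound_nonzero[where c = 1 and s' = 2])
  show "Sol_bound 3 L (- {0}) 1" for L using Sol_bound_3 by (rule Sol_bound_mono) simp
  show "det_bound (3 - 1) {0} 2" using det_bound_2_zero by simp
qed auto

text \<open>The case of nonzero cofactors decides the exponent. A vanishing cofactor leads to at
  most n^2 - n/2 - 1/2, which is smaller because 1/(2 n - 2) <= 1/6.\<close>

lemma det_bound_saved:
  assumes "n \<ge> 4"
  shows "det_bound n (- {0}) ((real n)\<^sup>2 - real n / 2 - 1 / (2 * real n - 2))"
proof (rule det_bound_nonzero[where c = "saved_exponent n" and s' = "singular_exponent (n - 1)"])
  have r: "real (n - 1) = real n - 1" using assms by (simp add: of_nat_diff)
  show "real (n * (n - 1)) + saved_exponent n \<le> (real n)\<^sup>2 - real n / 2 - 1 / (2 * real n - 2)"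
    unfolding of_nat_mult r by (simp add: saved_exponent_def algebra_simps power2_eq_square)
  have "1 / (2 * real n - 2) \<le> 1 / 6" using assms by (intro divide_left_mono) auto
  moreover have "singular_exponent (n - 1) + real (2 * (n - 1)) \<le> (real n)\<^sup>2 - real n / 2 - 1 / 2"
  \<comment> \<open>Order 4 descends to singular matrices of order 3 with their exceptional exponent
    7, and 7 + 6 = 13 is below 16 - 2 - 1/2.\<close>
  proof (cases "n = 4")
    case True
    then show ?thesis by (simp add: singular_exponent_def)
  next
    case False
    then have "n - 1 \<noteq> 3" by simp
    then have e1: "singular_exponent (n - 1) = (real n - 1)\<^sup>2 - (real n - 1) / 2"
      unfolding singular_exponent_def r by simp
    have e2: "real (2 * (n - 1)) = 2 * (real n - 1)" unfolding of_nat_mult r by simp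
    show ?thesis unfolding e1 e2 by (simp add: power2_eq_square field_simps)
  qed
  ultimately show "singular_exponent (n - 1) + real (2 * (n - 1)) \<le> (real n)\<^sup>2 - real n / 2 - 1 / (2 * real n - 2)"
    by linarith
qed (use assms Sol_bound_saved det_bound_singular in auto)

theorem theorem2p5:
  fixes n :: nat
  assumes "n \<ge> 2"
  shows "power_bound_uniform (\<lambda>H \<delta>. card (egyptian_det_mats n H \<delta>)) {\<delta>. \<delta> \<noteq> 0}
           (if n = 2 then 0
            else if n = 3 then 7
            else (real n)\<^sup>2 - real n / 2 - 1 / (2 * real n - 2))
       \<and> power_bound_uniform (\<lambda>H \<delta>. card (egyptian_det_mats n H \<delta>)) {0}
           (if n = 2 then 2
            else if n = 3 then 7
            else (real n)\<^sup>2 - real n / 2)"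
proof (intro conjI power_bound_uniform_if_det_bound)
  have nonzero: "{\<delta>::rat. \<delta> \<noteq> 0} = - {0}" by auto
  consider "n = 2" | "n = 3" | "n \<ge> 4" using assms by linarith
  then show "det_bound n {\<delta>. \<delta> \<noteq> 0}
           (if n = 2 then 0
            else if n = 3 then 7
            else (real n)\<^sup>2 - real n / 2 - 1 / (2 * real n - 2))"
    unfolding nonzero
    by cases (use det_bound_2_nonzero det_bound_3_nonzero det_bound_saved in auto)
  show "det_bound n {0} (if n = 2 then 2 else if n = 3 then 7 else (real n)\<^sup>2 - real n / 2)"
    using det_bound_2_zero det_bound_singular[of n] by (auto simp: singular_exponent_def)
qed

end
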